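(* Let $p>1$. There is a constant $K(p)$, depending on $p$ only, such that for every $M\ge1$ and every nonempty subset $T$ of $\mathbb R^M$ (with $b(T)<\infty$) there is a subset $U$ of $\mathbb R^M$ with $$T\subset U+K(p)\,b(T)\,B_p\qquad\text{and}\qquad \gamma_{1/2}(U)\le K(p)\,b(T).$$
   Context: $B_p=\{t\in\mathbb R^M:\sum_{i\le M}|t_i|^p\le1\}$. With $(\varepsilon_i)_{i\le M}$ independent, $P(\varepsilon_i=1)=P(\varepsilon_i=-1)=1/2$, $$b(T)=\sup\Big\{E\sup_{t\in S}\sum_{i\le M}\varepsilon_it_i:\ S\subset T,\ S\text{ finite}\Big\}.$$ For $U\subset\mathbb R^M$, $$\gamma_{1/2}(U)=\inf_\mu\sup_{x\in U}\int_0^\infty\sqrt{\log\frac1{\mu(B(x,\varepsilon))}}\,d\varepsilon ,$$ where $B(x,\varepsilon)$ is the closed ball of $U$ for the Euclidean distance and the infimum is over probability measures $\mu$ on $U$ (equivalently, supported by a countable set). When $b(T)=\infty$ there is nothing to prove. *)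

theory Defs
  imports
    "HOL-Probability.Probability"
    "HOL-Library.Function_Algebras"
    "HOL-Library.Set_Algebras"
begin

text \<open>
  The dimension \<open>M\<close> is quantified after the constant \<open>K(p)\<close>, so it cannot be a type. A vector
  of \<open>R^M\<close> is a function on the naturals vanishing from index \<open>M\<close> on; coordinates are numbered
  \<open>0, \<dots>, M - 1\<close>. Vector addition and Minkowski sums are the pointwise operations of
  Function_Algebras and Set_Algebras.
\<close>

definition RM :: "nat \<Rightarrow> (nat \<Rightarrow> real) set" where
  "RM M = {x. \<forall>i\<ge>M. x i = 0}"

definition Bp :: "nat \<Rightarrow> real \<Rightarrow> (nat \<Rightarrow> real) set" where
  "Bp M p = {t \<in> RM M. (\<Sum>i<M. \<bar>t i\<bar> powr p) \<le> 1}"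

definition dilate :: "real \<Rightarrow> (nat \<Rightarrow> real) set \<Rightarrow> (nat \<Rightarrow> real) set" where
  "dilate c A = (\<lambda>t i. c * t i) ` A"

definition bernoulli_signs :: "nat \<Rightarrow> (nat \<Rightarrow> real) pmf" where
  "bernoulli_signs M = Pi_pmf {..<M} 0 (\<lambda>_. pmf_of_set {-1, 1})"

text \<open>
  The supremum is over nonempty finite \<open>S\<close>, as \<open>Max\<close> of the empty set is unspecified. The value
  lies in the extended reals and is nonnegative for nonempty \<open>T\<close>.
\<close>

definition bernoulli_b :: "nat \<Rightarrow> (nat \<Rightarrow> real) set \<Rightarrow> ereal" where
  "bernoulli_b M T =
     (SUP S\<in>{S. finite S \<and> S \<noteq> {} \<and> S \<subseteq> T}.
        ereal (measure_pmf.expectation (bernoulli_signs M)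
          (\<lambda>\<epsilon>. Max ((\<lambda>t. \<Sum>i<M. \<epsilon> i * t i) ` S))))"

definition ball_in :: "nat \<Rightarrow> (nat \<Rightarrow> real) set \<Rightarrow> (nat \<Rightarrow> real) \<Rightarrow> real \<Rightarrow> (nat \<Rightarrow> real) set" where
  "ball_in M U x r = {y \<in> U. L2_set (\<lambda>i. x i - y i) {..<M} \<le> r}"

text \<open>
  Borel probability measures on \<open>U\<close>. Here \<open>borel\<close> belongs to the product topology on
  \<^typ>\<open>nat \<Rightarrow> real\<close>, which induces the Euclidean topology on \<^term>\<open>RM M\<close>; \<open>U\<close> itself need not be
  a Borel set.
\<close>

definition prob_measures_on :: "(nat \<Rightarrow> real) set \<Rightarrow> (nat \<Rightarrow> real) measure set" where
  "prob_measures_on U = {\<mu>. prob_space \<mu> \<and> sets \<mu> = sets (restrict_space borel U)}"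

text \<open>\<open>sqrt (log (1 / m))\<close> for a mass \<open>m\<close> in \<open>[0, 1]\<close>, with value \<open>\<infinity>\<close> at \<open>m = 0\<close>.\<close>

definition sqrt_log_inv :: "real \<Rightarrow> ennreal" where
  "sqrt_log_inv m = (if m = 0 then \<infinity> else ennreal (sqrt (ln (1 / m))))"

definition gamma_half :: "nat \<Rightarrow> (nat \<Rightarrow> real) set \<Rightarrow> ennreal" where
  "gamma_half M U =
     (INF \<mu>\<in>prob_measures_on U. SUP x\<in>U.
        (\<integral>\<^sup>+\<epsilon>\<in>{0..}. sqrt_log_inv (measure \<mu> (ball_in M U x \<epsilon>)) \<partial>lborel))"

end

theory Submission
  imports Defs
begin

text \<open>
  After a reduction to finite \<open>T\<close> with expected supremum \<open>b(T) \<le> 1\<close> and to \<open>1 < p < 2\<close>, the set is cut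
  along a tree. A node of level \<open>j\<close> is a finite set \<open>A\<close> in a Euclidean ball of radius \<open>\<rho>\<^sub>j\<close>, where
  \<open>\<rho>\<^sub>j\<close> decreases geometrically with ratio \<open>r\<close>, and it is cut into pieces of radius \<open>\<rho>\<^sub>j\<^sub>+\<^sub>1\<close>
  greedily: the centre of the next piece is the point at which the expected supremum over the ball of
  radius \<open>\<rho>\<^sub>j\<^sub>+\<^sub>2\<close>, within what is left of \<open>A\<close>, is largest. The piece number \<open>k\<close> receives a share of mass
  of order \<open>k\<^sup>-\<^sup>2\<close>, so the entropy integral along a branch is at most a geometric series plus a multiple
  of the sum of \<open>\<rho>\<^sub>j \<surd>(log k\<^sub>j)\<close>.

  That sum is paid for by the expected supremum. If \<open>m\<close> points of \<open>A\<close> have mutual distances at least \<open>a\<close>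
  and each carries a subset of \<open>A\<close> of radius \<open>a / r\<close>, then \<open>b(A)\<close> exceeds the least expected supremum of
  these subsets by a multiple of \<open>a \<surd>(log m)\<close> (\<open>bw_growth\<close>). With the greedy choice it follows that a
  subset of radius \<open>\<rho>\<^sub>j\<^sub>+\<^sub>2\<close> of the piece number \<open>k\<close> has lost a multiple of \<open>\<rho>\<^sub>j\<^sub>+\<^sub>1 \<surd>(log k)\<close> against
  \<open>b(A)\<close> (\<open>greedy_partition\<close>), and the losses telescope over every second level.

  The growth inequality combines Sudakov's minoration (\<open>Sudakov_minoration\<close>) with a bound on lower
  deviations of suprema (\<open>avg_Max_lower_deviation\<close>). For signs in place of Gaussian variables the
  minoration needs the coordinates of the points to stay within \<open>a / \<surd>(log m)\<close> of a common centre, and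
  a multiple of \<open>a\<^sup>2\<close> suffices when \<open>b\<close> is bounded. This is achieved by truncating all coordinates of a
  piece around its centre. Truncation is a contraction, so it does not increase \<open>b\<close>, and what it removes
  is put into the multiple of \<open>B\<^sub>p\<close>: from a set of radius \<open>\<rho>\<close>, truncation at height \<open>w\<close> removes vectors of
  \<open>p\<close>-norm at most \<open>(w\<^sup>p\<^sup>-\<^sup>2 \<rho>\<^sup>2)\<^sup>1\<^sup>/\<^sup>p\<close>. For \<open>w\<close> of order \<open>\<rho>\<^sup>2\<^sup>\<kappa>\<close> this is a positive power of \<open>\<rho>\<close> as soon as
  \<open>\<kappa> < 1 / (2 - p)\<close>. Because \<open>p > 1\<close>, some \<open>\<kappa> > 1\<close> is allowed: the total cost of truncation is a convergent
  geometric series, and one truncation at level \<open>j\<close> serves all levels up to \<open>\<kappa> j\<close>.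

  Truncation moves points by large Euclidean distances, so what was known about small subsets is lost
  and the gain of one step is forfeited. Therefore the levels are grouped into phases
  \<open>e\<^sup>3 \<le> j < (e + 1)\<^sup>3\<close> with a single truncation in each. It takes place at the first step of the phase
  whose cost \<open>\<rho>\<^sub>j\<^sub>+\<^sub>1 \<surd>(log k)\<close> is below a threshold of order \<open>1 / e\<^sup>2\<close>. There is such a step, since
  otherwise the \<open>3 e\<^sup>2\<close> steps of the phase would consume more than \<open>b\<close> offers. The forfeited costs have a
  finite sum, and consecutive cubes have ratio close to \<open>1\<close>, so that any \<open>\<kappa> > 1\<close> is good enough for
  large \<open>e\<close>. The induction that carries this out is \<open>decomposition_tree\<close>.
\<close>

section \<open>Averages over signs\<close>

text \<open>
  The support of \<^const>\<open>bernoulli_signs\<close>, on which that distribution is uniform; \<open>avg\<close> below is its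
  expectation as a finite sum.
\<close>

definition signs :: "nat \<Rightarrow> (nat \<Rightarrow> real) set" where
  "signs M = {\<epsilon>. (\<forall>i<M. \<epsilon> i = 1 \<or> \<epsilon> i = -1) \<and> (\<forall>i\<ge>M. \<epsilon> i = 0)}"

definition avg :: "nat \<Rightarrow> ((nat \<Rightarrow> real) \<Rightarrow> real) \<Rightarrow> real" where
  "avg M F = (\<Sum>\<epsilon>\<in>signs M. F \<epsilon>) / 2 ^ M"

definition ip :: "nat \<Rightarrow> (nat \<Rightarrow> real) \<Rightarrow> (nat \<Rightarrow> real) \<Rightarrow> real" where
  "ip M x t = (\<Sum>i<M. x i * t i)"

lemma signs_PiE_dflt: "signs M = PiE_dflt {..<M} 0 (\<lambda>_. {-1, 1})"
  by (auto simp: signs_def PiE_dflt_def not_less)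

lemma finite_signs [simp]: "finite (signs M)"
  by (auto simp: signs_PiE_dflt intro!: finite_PiE_dflt)

lemma card_signs [simp]: "card (signs M) = 2 ^ M"
  by (simp add: signs_PiE_dflt card_PiE_dflt numeral_2_eq_2)

lemma signs_nonempty [simp]: "signs M \<noteq> {}"
  using card_signs[of M] by (metis card.empty power_not_zero zero_neq_numeral)

lemma expectation_bernoulli_signs:
  "measure_pmf.expectation (bernoulli_signs M) F = avg M F"
proof -
  have "bernoulli_signs M = pmf_of_set (signs M)"
    unfolding bernoulli_signs_def signs_PiE_dflt by (rule Pi_pmf_of_set) auto
  then show ?thesis
    by (simp add: integral_pmf_of_set avg_def)
qed

lemma avg_mono: "(\<And>\<epsilon>. \<epsilon> \<in> signs M \<Longrightarrow> F \<epsilon> \<le> G \<epsilon>) \<Longrightarrow> avg M F \<le> avg M G"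
  unfolding avg_def by (intro divide_right_mono sum_mono) auto

lemma avg_cong: "(\<And>\<epsilon>. \<epsilon> \<in> signs M \<Longrightarrow> F \<epsilon> = G \<epsilon>) \<Longrightarrow> avg M F = avg M G"
  unfolding avg_def by (simp cong: sum.cong)

lemma avg_const [simp]: "avg M (\<lambda>_. c) = c"
  by (simp add: avg_def)

lemma avg_add: "avg M (\<lambda>\<epsilon>. F \<epsilon> + G \<epsilon>) = avg M F + avg M G"
  by (simp add: avg_def sum.distrib add_divide_distrib)

lemma avg_diff: "avg M (\<lambda>\<epsilon>. F \<epsilon> - G \<epsilon>) = avg M F - avg M G"
  by (simp add: avg_def sum_subtractf diff_divide_distrib)

lemma avg_cmult: "avg M (\<lambda>\<epsilon>. c * F \<epsilon>) = c * avg M F"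
  by (simp add: avg_def sum_distrib_left)

lemma avg_sum: "avg M (\<lambda>\<epsilon>. \<Sum>l\<in>I. F l \<epsilon>) = (\<Sum>l\<in>I. avg M (F l))"
  unfolding avg_def by (subst sum.swap) (simp add: sum_divide_distrib)

lemma avg_nonneg: "(\<And>\<epsilon>. \<epsilon> \<in> signs M \<Longrightarrow> 0 \<le> F \<epsilon>) \<Longrightarrow> 0 \<le> avg M F"
  using avg_mono[of M "\<lambda>_. 0" F] by simp

lemma avg_pos: "(\<And>\<epsilon>. \<epsilon> \<in> signs M \<Longrightarrow> 0 < F \<epsilon>) \<Longrightarrow> 0 < avg M F"
  unfolding avg_def by (intro divide_pos_pos sum_pos) auto

text \<open>
  Changing one sign is an involution of the set of sign vectors.
\<close>

lemma avg_flip: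
  assumes "i < M"
  shows "avg M (\<lambda>\<epsilon>. F (\<epsilon>(i := - \<epsilon> i))) = avg M F"
proof -
  have "(\<Sum>\<epsilon>\<in>signs M. F (\<epsilon>(i := - \<epsilon> i))) = (\<Sum>\<epsilon>\<in>signs M. F \<epsilon>)"
    by (rule sum.reindex_bij_witness[of _ "\<lambda>\<epsilon>. \<epsilon>(i := - \<epsilon> i)" "\<lambda>\<epsilon>. \<epsilon>(i := - \<epsilon> i)"])
       (use assms in \<open>auto simp: signs_def\<close>)
  then show ?thesis by (simp add: avg_def)
qed

lemma avg_split:
  assumes "i < M"
  shows "avg M F = avg M (\<lambda>\<epsilon>. (F (\<epsilon>(i := 1)) + F (\<epsilon>(i := -1))) / 2)"
proof -
  have "avg M (\<lambda>\<epsilon>. (F (\<epsilon>(i := 1)) + F (\<epsilon>(i := -1))) / 2)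
      = avg M (\<lambda>\<epsilon>. (1/2) * (F \<epsilon> + F (\<epsilon>(i := - \<epsilon> i))))"
  proof (rule avg_cong)
    fix \<epsilon> assume "\<epsilon> \<in> signs M"
    then have "\<epsilon> i = 1 \<or> \<epsilon> i = -1" using assms by (auto simp: signs_def)
    then show "(F (\<epsilon>(i := 1)) + F (\<epsilon>(i := -1))) / 2 = (1/2) * (F \<epsilon> + F (\<epsilon>(i := - \<epsilon> i)))"
      using fun_upd_triv[of \<epsilon> i] by (elim disjE) (simp_all add: add.commute)
  qed
  also have "\<dots> = avg M F"
    unfolding avg_cmult avg_add avg_flip[OF assms] by simp
  finally show ?thesis by simp
qed

lemma signs_Suc: "signs (Suc M) = (\<lambda>\<epsilon>. \<epsilon>(M := 1)) ` signs M \<union> (\<lambda>\<epsilon>. \<epsilon>(M := -1)) ` signs M"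
proof (intro set_eqI iffI)
  fix \<epsilon> assume e: "\<epsilon> \<in> signs (Suc M)"
  then have "\<epsilon>(M := 0) \<in> signs M" by (auto simp: signs_def)
  moreover have "\<epsilon> = (\<epsilon>(M := 0))(M := 1) \<or> \<epsilon> = (\<epsilon>(M := 0))(M := -1)"
    using e by (auto simp: signs_def fun_eq_iff)
  ultimately show "\<epsilon> \<in> (\<lambda>\<epsilon>. \<epsilon>(M := 1)) ` signs M \<union> (\<lambda>\<epsilon>. \<epsilon>(M := -1)) ` signs M"
    by blast
qed (auto simp: signs_def less_Suc_eq)

lemma avg_Suc: "avg (Suc M) F = avg M (\<lambda>\<epsilon>. (F (\<epsilon>(M := 1)) + F (\<epsilon>(M := -1))) / 2)"
proof -
  have inj: "inj_on (\<lambda>\<epsilon>. \<epsilon>(M := c)) (signs M)" for c :: real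
  proof (rule inj_onI)
    fix x y assume xy: "x \<in> signs M" "y \<in> signs M" "x(M := c) = y(M := c)"
    then have "x M = y M" by (simp add: signs_def)
    then show "x = y" using xy(3) by (metis fun_upd_triv fun_upd_upd)
  qed
  have disj: "(\<lambda>\<epsilon>. \<epsilon>(M := 1)) ` signs M \<inter> (\<lambda>\<epsilon>. \<epsilon>(M := -1)) ` signs M = {}"
  proof -
    have "x(M := 1) \<noteq> y(M := -1)" for x y :: "nat \<Rightarrow> real"
      by (metis fun_upd_same one_neq_neg_one)
    then show ?thesis by blast
  qed
  have "(\<Sum>\<epsilon>\<in>signs (Suc M). F \<epsilon>) = (\<Sum>\<epsilon>\<in>signs M. F (\<epsilon>(M := 1))) + (\<Sum>\<epsilon>\<in>signs M. F (\<epsilon>(M := -1)))"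
    unfolding signs_Suc using disj
    by (subst sum.union_disjoint) (auto simp: sum.reindex[OF inj] o_def)
  then show ?thesis
    by (simp add: avg_def sum.distrib flip: sum_divide_distrib)
qed

text \<open>
  Integration by parts with respect to one sign.
\<close>

lemma avg_sign_times:
  assumes "i < M"
  shows "avg M (\<lambda>\<epsilon>. \<epsilon> i * F \<epsilon>) = avg M (\<lambda>\<epsilon>. (F (\<epsilon>(i := 1)) - F (\<epsilon>(i := -1))) / 2)"
  by (subst avg_split[OF assms]) simp

lemma avg_sign [simp]: "i < M \<Longrightarrow> avg M (\<lambda>\<epsilon>. \<epsilon> i) = 0"
  using avg_sign_times[of i M "\<lambda>_. 1"] by simp

lemma avg_ip [simp]: "avg M (\<lambda>\<epsilon>. ip M \<epsilon> t) = 0"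
proof -
  have "avg M (\<lambda>\<epsilon>. \<epsilon> i * t i) = 0" if "i < M" for i
    using avg_sign_times[OF that, of "\<lambda>_. t i"] by simp
  then show ?thesis unfolding ip_def avg_sum by simp
qed

text \<open>
  Jensen's inequality for the exponential function, from its tangent at the mean.
\<close>

lemma avg_exp_ge: "exp (avg M F) \<le> avg M (\<lambda>\<epsilon>. exp (F \<epsilon>))"
proof -
  let ?a = "avg M F"
  have "avg M (\<lambda>\<epsilon>. exp ?a * (1 + (F \<epsilon> - ?a))) \<le> avg M (\<lambda>\<epsilon>. exp (F \<epsilon>))"
  proof (rule avg_mono)
    fix \<epsilon>
    have "exp ?a * (1 + (F \<epsilon> - ?a)) \<le> exp ?a * exp (F \<epsilon> - ?a)"
      by (intro mult_left_mono exp_ge_add_one_self) auto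
    then show "exp ?a * (1 + (F \<epsilon> - ?a)) \<le> exp (F \<epsilon>)" by (simp add: exp_diff)
  qed
  then show ?thesis by (simp add: avg_cmult avg_add avg_diff)
qed

lemma ip_diff: "ip M x (\<lambda>i. s i - t i) = ip M x s - ip M x t"
  by (simp add: ip_def sum_subtractf algebra_simps)

section \<open>Expected suprema\<close>

definition bw :: "nat \<Rightarrow> (nat \<Rightarrow> real) set \<Rightarrow> real" where
  "bw M S = avg M (\<lambda>\<epsilon>. Max (ip M \<epsilon> ` S))"

lemma bw_mono: "finite S \<Longrightarrow> S' \<noteq> {} \<Longrightarrow> S' \<subseteq> S \<Longrightarrow> bw M S' \<le> bw M S"
  unfolding bw_def by (intro avg_mono Max_mono) auto

lemma bw_nonneg:
  assumes "finite S" "S \<noteq> {}" shows "0 \<le> bw M S"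
proof -
  obtain t where t: "t \<in> S" using assms by auto
  have "avg M (\<lambda>\<epsilon>. ip M \<epsilon> t) \<le> bw M S"
    unfolding bw_def by (intro avg_mono Max_ge) (use assms t in auto)
  then show ?thesis by simp
qed

lemma bw_le_bernoulli_b:
  assumes "finite S" "S \<noteq> {}" "S \<subseteq> T"
  shows "ereal (bw M S) \<le> bernoulli_b M T"
  unfolding bernoulli_b_def expectation_bernoulli_signs bw_def ip_def
  by (rule SUP_upper2[of S]) (use assms in auto)

text \<open>
  If \<open>t\<close> and \<open>s\<close> attain the two maxima on the left, then swapping them or not gives two lower bounds for
  the right-hand side, and one of them suffices according to the sign of \<open>g s - g t\<close>. This is the
  contraction principle for a single sign.
\<close>

lemma two_point_contraction:
  fixes A f g :: "'a \<Rightarrow> real"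
  assumes S: "finite S" "S \<noteq> {}"
    and fg: "\<And>s t. s \<in> S \<Longrightarrow> t \<in> S \<Longrightarrow> \<bar>f s - f t\<bar> \<le> \<bar>g s - g t\<bar>"
  shows "Max ((\<lambda>t. A t + f t) ` S) + Max ((\<lambda>t. A t - f t) ` S)
       \<le> Max ((\<lambda>t. A t + g t) ` S) + Max ((\<lambda>t. A t - g t) ` S)"
proof -
  have "Max ((\<lambda>t. A t + f t) ` S) \<in> (\<lambda>t. A t + f t) ` S"
       "Max ((\<lambda>t. A t - f t) ` S) \<in> (\<lambda>t. A t - f t) ` S"
    using S by (auto intro!: Max_in)
  then obtain t s where ts: "t \<in> S" "s \<in> S"
    and eq: "Max ((\<lambda>t. A t + f t) ` S) = A t + f t" "Max ((\<lambda>t. A t - f t) ` S) = A s - f s"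
    by auto
  have "A u + g u \<le> Max ((\<lambda>t. A t + g t) ` S)" "A u - g u \<le> Max ((\<lambda>t. A t - g t) ` S)"
    if "u \<in> S" for u using that S by (auto intro!: Max_ge)
  from this[OF ts(1)] this[OF ts(2)] fg[OF ts] show ?thesis
    unfolding eq by (auto simp: abs_if split: if_splits)
qed

lemma avg_Max_change_coordinate:
  assumes S: "finite S" "S \<noteq> {}" and i: "i < M"
    and h: "\<And>s t. s \<in> S \<Longrightarrow> t \<in> S \<Longrightarrow> \<bar>h s - h t\<bar> \<le> \<bar>x s i - x t i\<bar>"
  shows "avg M (\<lambda>\<epsilon>. Max ((\<lambda>t. ip M \<epsilon> ((x t)(i := h t))) ` S)) \<le> avg M (\<lambda>\<epsilon>. Max ((\<lambda>t. ip M \<epsilon> (x t)) ` S))"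
proof -
  have split: "ip M (\<epsilon>(i := c)) (y(i := d)) = (\<Sum>k\<in>{..<M} - {i}. \<epsilon> k * y k) + c * d" for \<epsilon> y c d
    unfolding ip_def using i by (subst sum.remove[of _ i]) (auto intro!: sum.cong)
  have split': "ip M (\<epsilon>(i := c)) y = (\<Sum>k\<in>{..<M} - {i}. \<epsilon> k * y k) + c * y i" for \<epsilon> y c
    using split[of \<epsilon> c y "y i"] by simp
  show ?thesis
    apply (subst (1 2) avg_split[OF i])
    apply (rule avg_mono)
    apply (rule divide_right_mono)
    subgoal for \<epsilon>
      using two_point_contraction[OF S, of h "\<lambda>t. x t i" "\<lambda>t. \<Sum>k\<in>{..<M} - {i}. \<epsilon> k * x t k"] h
      by (simp add: split split')
    by simp
qed

lemma bw_contraction: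
  assumes S: "finite S" "S \<noteq> {}"
    and \<psi>: "\<And>i s t. i < M \<Longrightarrow> s \<in> S \<Longrightarrow> t \<in> S \<Longrightarrow> \<bar>\<psi> s i - \<psi> t i\<bar> \<le> \<bar>s i - t i\<bar>"
  shows "bw M (\<psi> ` S) \<le> bw M S"
proof -
  \<comment> \<open>The coordinates are replaced one after the other.\<close>
  define x where "x n t = (\<lambda>i. if i < n then \<psi> t i else t i)" for n :: nat and t :: "nat \<Rightarrow> real"
  have "avg M (\<lambda>\<epsilon>. Max ((\<lambda>t. ip M \<epsilon> (x n t)) ` S)) \<le> avg M (\<lambda>\<epsilon>. Max ((\<lambda>t. ip M \<epsilon> (x 0 t)) ` S))"
    if "n \<le> M" for n
    using that
  proof (induction n)
    case (Suc n)
    have eq: "x (Suc n) t = (x n t)(n := \<psi> t n)" for t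
      by (auto simp: x_def fun_eq_iff less_Suc_eq)
    have "avg M (\<lambda>\<epsilon>. Max ((\<lambda>t. ip M \<epsilon> (x (Suc n) t)) ` S)) \<le> avg M (\<lambda>\<epsilon>. Max ((\<lambda>t. ip M \<epsilon> (x n t)) ` S))"
      unfolding eq by (rule avg_Max_change_coordinate[OF S]) (use Suc.prems \<psi> in \<open>auto simp: x_def\<close>)
    then show ?case using Suc by simp
  qed simp
  from this[of M] have "avg M (\<lambda>\<epsilon>. Max ((\<lambda>t. ip M \<epsilon> (x M t)) ` S)) \<le> avg M (\<lambda>\<epsilon>. Max ((\<lambda>t. ip M \<epsilon> t) ` S))"
    by (simp add: x_def)
  moreover have "ip M \<epsilon> (x M t) = ip M \<epsilon> (\<psi> t)" for \<epsilon> t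
    by (simp add: ip_def x_def)
  ultimately show ?thesis by (simp add: bw_def image_image)
qed

section \<open>Euclidean distance\<close>

definition ed :: "nat \<Rightarrow> (nat \<Rightarrow> real) \<Rightarrow> (nat \<Rightarrow> real) \<Rightarrow> real" where
  "ed M s t = L2_set (\<lambda>i. s i - t i) {..<M}"

lemma ed_nonneg [simp]: "0 \<le> ed M s t" by (simp add: ed_def)
lemma ed_self [simp]: "ed M s s = 0" by (simp add: ed_def L2_set_def)
lemma ed_commute: "ed M s t = ed M t s"
  unfolding ed_def L2_set_def by (simp add: power2_commute)
lemma ed_triangle: "ed M s t \<le> ed M s u + ed M u t"
  using L2_set_triangle_ineq[of "\<lambda>i. s i - u i" "\<lambda>i. u i - t i" "{..<M}"] by (simp add: ed_def)
lemma ed_sq: "(ed M s t)\<^sup>2 = (\<Sum>i<M. (s i - t i)\<^sup>2)"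
  unfolding ed_def L2_set_def by (rule real_sqrt_pow2) (simp add: sum_nonneg)
lemma ed_coord: "i < M \<Longrightarrow> \<bar>s i - t i\<bar> \<le> ed M s t"
  using member_le_L2_set[of "{..<M}" i "\<lambda>i. \<bar>s i - t i\<bar>"] by (simp add: ed_def L2_set_def)

text \<open>
  Induction on the number of signs: adding the term \<open>\<plusminus>c\<close> to a symmetric variable \<open>X\<close> turns the fourth
  moment into \<open>E X\<^sup>4 + 6 c\<^sup>2 E X\<^sup>2 + c\<^sup>4\<close>.
\<close>

lemma avg_ip_moments:
  "avg M (\<lambda>\<epsilon>. (ip M \<epsilon> v)\<^sup>2) = (\<Sum>i<M. (v i)\<^sup>2) \<and> avg M (\<lambda>\<epsilon>. (ip M \<epsilon> v) ^ 4) \<le> 3 * (\<Sum>i<M. (v i)\<^sup>2)\<^sup>2"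
proof (induction M)
  case 0
  show ?case by (simp add: ip_def)
next
  case (Suc M)
  let ?s = "\<Sum>i<M. (v i)\<^sup>2"
  have ip_Suc: "ip (Suc M) (\<epsilon>(M := c)) v = ip M \<epsilon> v + c * v M" for \<epsilon> c
    by (simp add: ip_def)
  have sq: "((x + 1 * y)\<^sup>2 + (x + - 1 * y)\<^sup>2) / 2 = x\<^sup>2 + y\<^sup>2" for x y :: real
    by (simp add: power2_eq_square algebra_simps)
  have fourth: "((x + 1 * y) ^ 4 + (x + - 1 * y) ^ 4) / 2 = x ^ 4 + (6 * y\<^sup>2) * x\<^sup>2 + y ^ 4" for x y :: real
    by (simp add: power2_eq_square power4_eq_xxxx algebra_simps)
  have "avg (Suc M) (\<lambda>\<epsilon>. (ip (Suc M) \<epsilon> v)\<^sup>2) = avg M (\<lambda>\<epsilon>. (ip M \<epsilon> v)\<^sup>2 + (v M)\<^sup>2)"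
    by (subst avg_Suc) (simp only: ip_Suc sq)
  then have 2: "avg (Suc M) (\<lambda>\<epsilon>. (ip (Suc M) \<epsilon> v)\<^sup>2) = ?s + (v M)\<^sup>2"
    using Suc by (simp add: avg_add)
  have "avg (Suc M) (\<lambda>\<epsilon>. (ip (Suc M) \<epsilon> v) ^ 4)
      = avg M (\<lambda>\<epsilon>. (ip M \<epsilon> v) ^ 4 + (6 * (v M)\<^sup>2) * (ip M \<epsilon> v)\<^sup>2 + (v M) ^ 4)"
    by (subst avg_Suc) (simp only: ip_Suc fourth)
  also have "\<dots> = avg M (\<lambda>\<epsilon>. (ip M \<epsilon> v) ^ 4) + (6 * (v M)\<^sup>2) * ?s + (v M) ^ 4"
    using Suc by (simp add: avg_add avg_cmult)
  also have "\<dots> \<le> 3 * ?s\<^sup>2 + (6 * (v M)\<^sup>2) * ?s + 3 * ((v M)\<^sup>2)\<^sup>2"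
  proof -
    have "(v M) ^ 4 \<le> 3 * ((v M)\<^sup>2)\<^sup>2" by (simp flip: power_mult)
    then show ?thesis using Suc by linarith
  qed
  also have "\<dots> = 3 * (?s + (v M)\<^sup>2)\<^sup>2" by (simp add: power2_eq_square algebra_simps)
  finally show ?case using 2 by simp
qed

text \<open>
  The polynomial \<open>3/4 y\<^sup>2 - y\<^sup>4/16\<close> is at most \<open>\<bar>y\<bar>\<close>, since \<open>y\<^sup>3 - 12 y + 16 = (y - 2)\<^sup>2 (y + 4)\<close>. Apply it to
  the normalized sum, whose second moment is \<open>1\<close> and whose fourth moment is at most \<open>3\<close>.
\<close>

lemma Khinchine_L1: "sqrt (\<Sum>i<M. (v i)\<^sup>2) / 2 \<le> avg M (\<lambda>\<epsilon>. \<bar>ip M \<epsilon> v\<bar>)"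
proof -
  define \<sigma> where "\<sigma> = sqrt (\<Sum>i<M. (v i)\<^sup>2)"
  have \<sigma>2: "\<sigma>\<^sup>2 = (\<Sum>i<M. (v i)\<^sup>2)" unfolding \<sigma>_def by (simp add: sum_nonneg)
  show ?thesis
  proof (cases "\<sigma> = 0")
    case True
    then show ?thesis by (simp add: \<sigma>_def[symmetric] avg_nonneg)
  next
    case False
    then have pos: "\<sigma> > 0" unfolding \<sigma>_def by (simp add: sum_nonneg order.not_eq_order_implies_strict)
    have "avg M (\<lambda>\<epsilon>. (3 / (4 * \<sigma>)) * (ip M \<epsilon> v)\<^sup>2 - (1 / (16 * \<sigma> ^ 3)) * (ip M \<epsilon> v) ^ 4) \<le> avg M (\<lambda>\<epsilon>. \<bar>ip M \<epsilon> v\<bar>)"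
    proof (rule avg_mono)
      fix \<epsilon>
      define y where "y = \<bar>ip M \<epsilon> v\<bar> / \<sigma>"
      have y: "y \<ge> 0" "\<bar>ip M \<epsilon> v\<bar> = \<sigma> * y" using pos by (auto simp: y_def)
      have "(ip M \<epsilon> v)\<^sup>2 = (\<sigma> * y)\<^sup>2" "(ip M \<epsilon> v)^4 = (\<sigma> * y)^4"
        unfolding y(2)[symmetric] by (auto simp: power_even_abs)
      moreover have "(3 / (4 * \<sigma>)) * (\<sigma> * y)\<^sup>2 - (1 / (16 * \<sigma> ^ 3)) * (\<sigma> * y) ^ 4 = \<sigma> * (3/4 * y\<^sup>2 - y^4/16)"
        using pos by (simp add: field_simps power2_eq_square power3_eq_cube power4_eq_xxxx)
      moreover have "3/4 * y\<^sup>2 - y^4/16 \<le> y"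
      proof -
        have "0 \<le> y * ((y - 2)\<^sup>2 * (y + 4)) / 16" using y by simp
        also have "\<dots> = y - (3/4 * y\<^sup>2 - y^4/16)" by (simp add: power2_eq_square power4_eq_xxxx field_simps)
        finally show ?thesis by simp
      qed
      ultimately show "(3 / (4 * \<sigma>)) * (ip M \<epsilon> v)\<^sup>2 - (1 / (16 * \<sigma> ^ 3)) * (ip M \<epsilon> v) ^ 4 \<le> \<bar>ip M \<epsilon> v\<bar>"
        using pos y by (auto intro!: mult_left_mono)
    qed
    moreover have "avg M (\<lambda>\<epsilon>. (3 / (4 * \<sigma>)) * (ip M \<epsilon> v)\<^sup>2 - (1 / (16 * \<sigma> ^ 3)) * (ip M \<epsilon> v) ^ 4)
        \<ge> (3 / (4 * \<sigma>)) * \<sigma>\<^sup>2 - (1 / (16 * \<sigma> ^ 3)) * (3 * (\<sigma>\<^sup>2)\<^sup>2)"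
    proof -
      have "(1 / (16 * \<sigma> ^ 3)) * avg M (\<lambda>\<epsilon>. (ip M \<epsilon> v) ^ 4) \<le> (1 / (16 * \<sigma> ^ 3)) * (3 * (\<sigma>\<^sup>2)\<^sup>2)"
        using avg_ip_moments[of M v] pos by (intro mult_left_mono) (auto simp: \<sigma>2)
      then show ?thesis
        using avg_ip_moments[of M v] by (simp only: avg_diff avg_cmult \<sigma>2)
    qed
    moreover have "(3 / (4 * \<sigma>)) * \<sigma>\<^sup>2 - (1 / (16 * \<sigma> ^ 3)) * (3 * (\<sigma>\<^sup>2)\<^sup>2) = 9/16 * \<sigma>"
      using pos by (simp add: field_simps power2_eq_square power3_eq_cube)
    ultimately show ?thesis using pos by (simp add: \<sigma>_def[symmetric])
  qed
qed

text \<open>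
  For two points the maximum is half the sum plus half the modulus of the difference, and the sum is
  centred.
\<close>

lemma ed_le_bw:
  assumes S: "finite S" "s \<in> S" "t \<in> S"
  shows "ed M s t \<le> 4 * bw M S"
proof -
  have "avg M (\<lambda>\<epsilon>. (1/2) * \<bar>ip M \<epsilon> (\<lambda>i. s i - t i)\<bar> + (1/2) * (ip M \<epsilon> s + ip M \<epsilon> t)) \<le> bw M S"
    unfolding bw_def
  proof (rule avg_mono)
    fix \<epsilon>
    have "ip M \<epsilon> s \<le> Max (ip M \<epsilon> ` S)" "ip M \<epsilon> t \<le> Max (ip M \<epsilon> ` S)" using S by auto
    then show "(1/2) * \<bar>ip M \<epsilon> (\<lambda>i. s i - t i)\<bar> + (1/2) * (ip M \<epsilon> s + ip M \<epsilon> t) \<le> Max (ip M \<epsilon> ` S)"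
      by (auto simp: ip_diff abs_if field_simps)
  qed
  then have "(1/2) * avg M (\<lambda>\<epsilon>. \<bar>ip M \<epsilon> (\<lambda>i. s i - t i)\<bar>) \<le> bw M S"
    by (simp add: avg_add avg_cmult del: times_divide_eq_left)
  then show ?thesis
    using Khinchine_L1[of "\<lambda>i. s i - t i" M] by (simp add: ed_def L2_set_def)
qed

section \<open>Sudakov minoration for Bernoulli processes\<close>

lemma two_sinh_ge: "2 * d\<^sup>2 \<le> d * (exp d - exp (- d))" for d :: real
proof -
  have *: "2 * d \<le> exp d - exp (- d)" if "0 \<le> d" for d :: real
  proof -
    have e: "1 + d + d\<^sup>2 / 2 \<le> exp d" using exp_lower_Taylor_quadratic[OF that] by simp
    have p: "0 < 1 + d + d\<^sup>2 / 2" using that by (smt (verit) zero_le_power2 divide_nonneg_pos)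
    have "exp (- d) = 1 / exp d" by (simp add: exp_minus field_simps)
    also have "\<dots> \<le> 1 / (1 + d + d\<^sup>2 / 2)" using e p by (intro divide_left_mono) auto
    also have "\<dots> \<le> 1 - d + d\<^sup>2 / 2"
    proof -
      have "(1 - d + d\<^sup>2 / 2) * (1 + d + d\<^sup>2 / 2) = 1 + d ^ 4 / 4"
        by (simp add: power2_eq_square power4_eq_xxxx field_simps)
      also have "1 + d ^ 4 / 4 \<ge> 1" by simp
      finally show ?thesis using p by (simp add: divide_le_eq)
    qed
    finally show ?thesis using e by simp
  qed
  show ?thesis
  proof (cases "0 \<le> d")
    case True
    then show ?thesis using mult_left_mono[OF *[OF True] True] by (simp add: power2_eq_square algebra_simps)
  next
    case False
    then have d: "0 \<le> - d" by simp
    show ?thesis using mult_left_mono[OF *[OF d] d] by (simp add: power2_eq_square algebra_simps)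
  qed
qed

text \<open>
  The numbers \<open>w l exp (\<beta> s x l) / Z s\<close> are the Gibbs weights after one sign has been set to \<open>s\<close>, and \<open>F s\<close>
  is the mean of \<open>x\<close> under them. Over a common denominator, \<open>F 1 - F (-1)\<close> becomes the double sum of
  \<open>w l w k (x l - x k) sinh (\<beta> (x l - x k))\<close>. As \<open>\<beta> x\<close> is bounded by one,
  changing the sign changes the weights only by bounded factors, so the sum compares with the variance
  under the weights at either value of \<open>s\<close>.
\<close>

lemma Gibbs_mean_increase:
  fixes I :: "'a set" and w x :: "'a \<Rightarrow> real" and \<beta> s :: real
  defines "Z \<equiv> \<lambda>s. \<Sum>l\<in>I. w l * exp (\<beta> * (s * x l))"
  defines "F \<equiv> \<lambda>s. (\<Sum>l\<in>I. w l * exp (\<beta> * (s * x l)) / Z s * x l)"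
  assumes I: "finite I" "I \<noteq> {}" and w: "\<And>l. l \<in> I \<Longrightarrow> 0 < w l" and \<beta>: "0 < \<beta>"
    and x: "\<And>l. l \<in> I \<Longrightarrow> \<bar>\<beta> * x l\<bar> \<le> 1" and s: "s = 1 \<or> s = -1"
  shows "\<beta> * exp (-4) * (\<Sum>l\<in>I. \<Sum>k\<in>I. (w l * exp (\<beta> * (s * x l)) / Z s) * (w k * exp (\<beta> * (s * x k)) / Z s) * (x l - x k)\<^sup>2)
    \<le> F 1 - F (-1)"
proof -
  have Zpos: "0 < Z u" for u
    unfolding Z_def using I w by (intro sum_pos mult_pos_pos) auto
  define D where "D = (\<Sum>l\<in>I. \<Sum>k\<in>I. w l * w k * (x l - x k)\<^sup>2)"
  have FZ: "F u * Z u = (\<Sum>l\<in>I. w l * exp (\<beta> * (u * x l)) * x l)" for u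
    unfolding F_def sum_distrib_right using Zpos[of u] by (intro sum.cong) auto
  define P where "P l k = w l * w k * (exp (\<beta> * (x l - x k)) - exp (- (\<beta> * (x l - x k))))" for l k
  have "(F 1 - F (-1)) * (Z 1 * Z (-1)) = (F 1 * Z 1) * Z (-1) - (F (-1) * Z (-1)) * Z 1"
    by (simp add: algebra_simps)
  also have "\<dots> = (\<Sum>l\<in>I. \<Sum>k\<in>I. x l * P l k)"
    unfolding FZ unfolding Z_def sum_product sum_subtractf[symmetric] P_def
    by (intro sum.cong refl) (simp add: algebra_simps flip: exp_add)
  finally have A: "(F 1 - F (-1)) * (Z 1 * Z (-1)) = (\<Sum>l\<in>I. \<Sum>k\<in>I. x l * P l k)" .
  have "(\<Sum>l\<in>I. \<Sum>k\<in>I. x l * P l k) = (\<Sum>k\<in>I. \<Sum>l\<in>I. x l * P l k)" by (rule sum.swap)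
  also have "\<dots> = (\<Sum>l\<in>I. \<Sum>k\<in>I. - x k * P l k)"
    by (intro sum.cong refl) (simp add: P_def algebra_simps)
  finally have "2 * (\<Sum>l\<in>I. \<Sum>k\<in>I. x l * P l k) = (\<Sum>l\<in>I. \<Sum>k\<in>I. (x l - x k) * P l k)"
    by (simp add: sum_subtractf algebra_simps sum_negf)
  also have "\<dots> \<ge> (\<Sum>l\<in>I. \<Sum>k\<in>I. 2 * \<beta> * (w l * w k * (x l - x k)\<^sup>2))"
  proof (intro sum_mono)
    fix l k assume lk: "l \<in> I" "k \<in> I"
    let ?d = "\<beta> * (x l - x k)"
    have "2 * ?d\<^sup>2 \<le> ?d * (exp ?d - exp (- ?d))" by (rule two_sinh_ge)
    then have "\<beta> * (2 * \<beta> * (x l - x k)\<^sup>2) \<le> \<beta> * ((x l - x k) * (exp ?d - exp (- ?d)))"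
      by (simp add: power2_eq_square algebra_simps)
    then have "2 * \<beta> * (x l - x k)\<^sup>2 \<le> (x l - x k) * (exp ?d - exp (- ?d))"
      using \<beta> by (simp only: mult_le_cancel_left_pos)
    then have "(w l * w k) * (2 * \<beta> * (x l - x k)\<^sup>2) \<le> (w l * w k) * ((x l - x k) * (exp ?d - exp (- ?d)))"
      using w[OF lk(1)] w[OF lk(2)] by (intro mult_left_mono) auto
    then show "2 * \<beta> * (w l * w k * (x l - x k)\<^sup>2) \<le> (x l - x k) * P l k"
      unfolding P_def by (simp only: mult_ac)
  qed
  finally have B: "\<beta> * D \<le> (F 1 - F (-1)) * (Z 1 * Z (-1))"
    unfolding A D_def by (simp add: sum_distrib_left[symmetric] mult.assoc)
  have Zle: "Z u \<le> exp 2 * Z s" if u: "u = 1 \<or> u = -1" for u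
    unfolding Z_def sum_distrib_left
  proof (intro sum_mono)
    fix l assume l: "l \<in> I"
    have "\<beta> * (u * x l) \<le> 2 + \<beta> * (s * x l)" using x[OF l] s u by (auto simp: abs_le_iff)
    then have "exp (\<beta> * (u * x l)) \<le> exp 2 * exp (\<beta> * (s * x l))" by (simp flip: exp_add)
    then show "w l * exp (\<beta> * (u * x l)) \<le> exp 2 * (w l * exp (\<beta> * (s * x l)))"
      using w[OF l] by (simp add: mult.left_commute)
  qed
  have "Z 1 * Z (-1) \<le> exp 2 * (Z s * Z s)"
    using s Zle[of 1] Zle[of "-1"] Zpos[of 1] Zpos[of "-1"] by (auto simp: algebra_simps)
  have C: "exp (-4) * (\<Sum>l\<in>I. \<Sum>k\<in>I. (w l * exp (\<beta> * (s * x l)) / Z s) * (w k * exp (\<beta> * (s * x k)) / Z s) * (x l - x k)\<^sup>2)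
      \<le> exp (-2) * D / (Z s * Z s)"
    unfolding D_def sum_divide_distrib sum_distrib_left
  proof (intro sum_mono)
    fix l k assume lk: "l \<in> I" "k \<in> I"
    have "\<beta> * (s * x l) + \<beta> * (s * x k) \<le> 2" using x[OF lk(1)] x[OF lk(2)] s by (auto simp: abs_le_iff)
    then have "exp (-4) * (exp (\<beta> * (s * x l)) * exp (\<beta> * (s * x k))) \<le> exp (-2)" by (simp flip: exp_add)
    moreover have "0 \<le> w l * w k * (x l - x k)\<^sup>2 / (Z s * Z s)"
      using w[OF lk(1)] w[OF lk(2)] Zpos[of s] by (intro divide_nonneg_pos mult_nonneg_nonneg) auto
    ultimately have "(w l * w k * (x l - x k)\<^sup>2 / (Z s * Z s)) * (exp (-4) * (exp (\<beta> * (s * x l)) * exp (\<beta> * (s * x k))))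
       \<le> (w l * w k * (x l - x k)\<^sup>2 / (Z s * Z s)) * exp (-2)"
      by (rule mult_left_mono)
    then show "exp (-4) * (w l * exp (\<beta> * (s * x l)) / Z s * (w k * exp (\<beta> * (s * x k)) / Z s) * (x l - x k)\<^sup>2)
        \<le> exp (-2) * (w l * w k * (x l - x k)\<^sup>2) / (Z s * Z s)"
      by (simp add: mult_ac)
  qed
  have D0: "0 \<le> D" unfolding D_def using w by (intro sum_nonneg mult_nonneg_nonneg) (auto simp: less_imp_le)
  have "exp (-2) * D / (Z s * Z s) \<le> D / (Z 1 * Z (-1))"
  proof -
    have "exp (-2) * (Z 1 * Z (-1)) \<le> Z s * Z s"
      using mult_left_mono[OF \<open>Z 1 * Z (-1) \<le> exp 2 * (Z s * Z s)\<close>, of "exp (-2)"]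
      by (simp add: mult.assoc[symmetric] flip: exp_add)
    then have "D * (exp (-2) * (Z 1 * Z (-1))) \<le> D * (Z s * Z s)" using D0 by (rule mult_left_mono)
    then show ?thesis using Zpos[of s] Zpos[of 1] Zpos[of "-1"]
      by (simp add: divide_simps) (simp add: algebra_simps)
  qed
  then have "\<beta> * (exp (-4) * (\<Sum>l\<in>I. \<Sum>k\<in>I. (w l * exp (\<beta> * (s * x l)) / Z s) * (w k * exp (\<beta> * (s * x k)) / Z s) * (x l - x k)\<^sup>2))
      \<le> \<beta> * (D / (Z 1 * Z (-1)))"
    using C \<beta> by (intro mult_left_mono) auto
  also have "\<dots> \<le> F 1 - F (-1)"
    using B Zpos[of 1] Zpos[of "-1"] by (simp add: divide_le_eq)
  finally show ?thesis by (simp add: mult.assoc)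
qed

text \<open>
  Consider the Gibbs measure \<open>G\<close> on \<open>I\<close> with weights proportional to \<open>exp (\<beta> X l)\<close>, where \<open>X l\<close> is the
  random sum attached to \<open>t l\<close>, and let \<open>q\<close> be its largest mass. If \<open>G\<close> is spread out, meaning that \<open>1 - q\<close>
  is not small on average, then integration by parts in every sign shows that the Gibbs mean of \<open>X\<close> is
  at least a multiple of \<open>\<beta>\<close> times the mean squared distance of two independent samples from \<open>G\<close>,
  hence of \<open>\<beta> a\<^sup>2 (1 - q)\<close>. If \<open>G\<close> is concentrated, then \<open>\<beta> max X\<close> nearly equals the logarithm of the
  partition function \<open>Z\<close>, whose expectation is at least \<open>ln (card I)\<close> by convexity.
\<close>

lemma Sudakov_minoration:
  fixes t :: "'a \<Rightarrow> nat \<Rightarrow> real"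
  assumes I: "finite I" and lnm: "4 \<le> ln (card I)"
    and \<beta>: "0 < \<beta>" "\<beta>\<^sup>2 * a\<^sup>2 \<le> ln (card I)" and a: "0 \<le> a"
    and bd: "\<And>l i. l \<in> I \<Longrightarrow> i < M \<Longrightarrow> \<bar>\<beta> * t l i\<bar> \<le> 1"
    and sep: "\<And>l k. l \<in> I \<Longrightarrow> k \<in> I \<Longrightarrow> l \<noteq> k \<Longrightarrow> a \<le> ed M (t l) (t k)"
  shows "exp (-4) / 16 * \<beta> * a\<^sup>2 \<le> avg M (\<lambda>\<epsilon>. Max ((\<lambda>l. ip M \<epsilon> (t l)) ` I))"
proof -
  define m where "m = real (card I)"
  have lnm': "4 \<le> ln m" using lnm by (simp add: m_def)
  have m: "0 < m" using lnm unfolding m_def by (cases "card I = 0") auto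
  have ne: "I \<noteq> {}" using m unfolding m_def by auto
  define X where "X \<epsilon> l = ip M \<epsilon> (t l)" for \<epsilon> l
  define Z where "Z \<epsilon> = (\<Sum>l\<in>I. exp (\<beta> * X \<epsilon> l))" for \<epsilon>
  define G where "G \<epsilon> l = exp (\<beta> * X \<epsilon> l) / Z \<epsilon>" for \<epsilon> l
  define mx where "mx \<epsilon> = Max (X \<epsilon> ` I)" for \<epsilon>
  define q where "q \<epsilon> = exp (\<beta> * mx \<epsilon>) / Z \<epsilon>" for \<epsilon>
  have Zpos: "0 < Z \<epsilon>" for \<epsilon> unfolding Z_def using I ne by (intro sum_pos) auto
  have G0: "0 \<le> G \<epsilon> l" for \<epsilon> l unfolding G_def using Zpos[of \<epsilon>] by simp
  have G1: "(\<Sum>l\<in>I. G \<epsilon> l) = 1" for \<epsilon>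
    unfolding G_def sum_divide_distrib[symmetric] Z_def[symmetric] using Zpos[of \<epsilon>] by simp
  have Xmx: "X \<epsilon> l \<le> mx \<epsilon>" if "l \<in> I" for \<epsilon> l unfolding mx_def using that I by auto
  have Gq: "G \<epsilon> l \<le> q \<epsilon>" if "l \<in> I" for \<epsilon> l
    unfolding G_def q_def using Xmx[OF that] \<beta> Zpos[of \<epsilon>] by (intro divide_right_mono) auto
  have q1: "q \<epsilon> \<le> 1" for \<epsilon>
  proof -
    have "mx \<epsilon> \<in> X \<epsilon> ` I" unfolding mx_def using I ne by (intro Max_in) auto
    then obtain l where l: "l \<in> I" "mx \<epsilon> = X \<epsilon> l" by auto
    then have "q \<epsilon> = G \<epsilon> l" by (simp add: q_def G_def)
    also have "\<dots> \<le> (\<Sum>l\<in>I. G \<epsilon> l)" using l I G0 by (intro member_le_sum) auto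
    finally show ?thesis using G1 by simp
  qed
  have q0: "0 < q \<epsilon>" for \<epsilon> unfolding q_def using Zpos[of \<epsilon>] by simp
  have qm: "1 / m \<le> q \<epsilon>" for \<epsilon>
  proof -
    have "Z \<epsilon> \<le> (\<Sum>l\<in>I. exp (\<beta> * mx \<epsilon>))" unfolding Z_def using Xmx \<beta> by (intro sum_mono) auto
    then have "Z \<epsilon> \<le> m * exp (\<beta> * mx \<epsilon>)" by (simp add: m_def)
    then show ?thesis unfolding q_def using m Zpos[of \<epsilon>] by (simp add: field_simps)
  qed
  let ?D = "avg M (\<lambda>\<epsilon>. 1 - q \<epsilon>)"
  have GG: "1 - q \<epsilon> \<le> (\<Sum>l\<in>I. \<Sum>k\<in>I - {l}. G \<epsilon> l * G \<epsilon> k)" for \<epsilon>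
  proof -
    have "(\<Sum>k\<in>I - {l}. G \<epsilon> l * G \<epsilon> k) = G \<epsilon> l * (1 - G \<epsilon> l)" if "l \<in> I" for l
    proof -
      have "(\<Sum>k\<in>I - {l}. G \<epsilon> k) = 1 - G \<epsilon> l"
        using G1[of \<epsilon>] that I by (simp add: sum_diff1)
      then show ?thesis by (simp add: sum_distrib_left[symmetric])
    qed
    then have "(\<Sum>l\<in>I. \<Sum>k\<in>I - {l}. G \<epsilon> l * G \<epsilon> k) = (\<Sum>l\<in>I. G \<epsilon> l * (1 - G \<epsilon> l))" by simp
    also have "\<dots> \<ge> (\<Sum>l\<in>I. G \<epsilon> l * (1 - q \<epsilon>))" using Gq G0 by (intro sum_mono mult_left_mono) auto
    finally show ?thesis by (simp add: sum_distrib_right[symmetric] G1)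
  qed
  \<comment> \<open>The bound that is good for a spread-out Gibbs measure.\<close>
  have low1: "\<beta> * exp (-4) / 2 * a\<^sup>2 * ?D \<le> avg M mx"
  proof -
    have coord: "avg M (\<lambda>\<epsilon>. \<epsilon> i * (\<Sum>l\<in>I. G \<epsilon> l * t l i))
        \<ge> avg M (\<lambda>\<epsilon>. \<beta> * exp (-4) / 2 * (\<Sum>l\<in>I. \<Sum>k\<in>I. G \<epsilon> l * G \<epsilon> k * (t l i - t k i)\<^sup>2))" if i: "i < M" for i
      unfolding avg_sign_times[OF i]
    proof (rule avg_mono)
      fix \<epsilon> assume e: "\<epsilon> \<in> signs M"
      \<comment> \<open>The unnormalized Gibbs weight without the contribution of the \<open>i\<close>-th sign.\<close>
      define w where "w l = exp (\<beta> * (\<Sum>k\<in>{..<M} - {i}. \<epsilon> k * t l k))" for l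
      have Xs: "exp (\<beta> * X (\<epsilon>(i := s)) l) = w l * exp (\<beta> * (s * t l i))" for s l
        unfolding X_def ip_def w_def exp_add[symmetric] distrib_left[symmetric]
        using i by (subst sum.remove[of _ i]) (auto intro!: sum.cong arg_cong[of _ _ exp])
      have Gs: "G (\<epsilon>(i := s)) l = w l * exp (\<beta> * (s * t l i)) / (\<Sum>l\<in>I. w l * exp (\<beta> * (s * t l i)))" for s l
        unfolding G_def Z_def Xs ..
      have Ge: "G \<epsilon> l = w l * exp (\<beta> * (\<epsilon> i * t l i)) / (\<Sum>l\<in>I. w l * exp (\<beta> * (\<epsilon> i * t l i)))" for l
        using Gs[of "\<epsilon> i" l] by simp
      have "\<beta> * exp (-4) * (\<Sum>l\<in>I. \<Sum>k\<in>I. G \<epsilon> l * G \<epsilon> k * (t l i - t k i)\<^sup>2)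
          \<le> (\<Sum>l\<in>I. G (\<epsilon>(i := 1)) l * t l i) - (\<Sum>l\<in>I. G (\<epsilon>(i := -1)) l * t l i)"
        unfolding Gs Ge
        by (rule Gibbs_mean_increase[OF I ne]) (use \<beta> bd i e in \<open>auto simp: w_def signs_def\<close>)
      then show "\<beta> * exp (-4) / 2 * (\<Sum>l\<in>I. \<Sum>k\<in>I. G \<epsilon> l * G \<epsilon> k * (t l i - t k i)\<^sup>2)
          \<le> ((\<Sum>l\<in>I. G (\<epsilon>(i := 1)) l * t l i) - (\<Sum>l\<in>I. G (\<epsilon>(i := -1)) l * t l i)) / 2"
        by simp
    qed
    have GX: "(\<Sum>l\<in>I. G \<epsilon> l * X \<epsilon> l) = (\<Sum>i<M. \<epsilon> i * (\<Sum>l\<in>I. G \<epsilon> l * t l i))" for \<epsilon>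
      unfolding X_def ip_def sum_distrib_left by (subst sum.swap) (simp add: mult_ac)
    have "\<beta> * exp (-4) / 2 * a\<^sup>2 * ?D = avg M (\<lambda>\<epsilon>. \<beta> * exp (-4) / 2 * a\<^sup>2 * (1 - q \<epsilon>))" by (simp only: avg_cmult)
    also have "\<dots> \<le> avg M (\<lambda>\<epsilon>. \<Sum>i<M. \<beta> * exp (-4) / 2 * (\<Sum>l\<in>I. \<Sum>k\<in>I. G \<epsilon> l * G \<epsilon> k * (t l i - t k i)\<^sup>2))"
    proof (rule avg_mono)
      fix \<epsilon>
      have "a\<^sup>2 * (1 - q \<epsilon>) \<le> a\<^sup>2 * (\<Sum>l\<in>I. \<Sum>k\<in>I - {l}. G \<epsilon> l * G \<epsilon> k)"
        using GG by (intro mult_left_mono) auto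
      also have "\<dots> \<le> (\<Sum>l\<in>I. \<Sum>k\<in>I - {l}. G \<epsilon> l * G \<epsilon> k * (ed M (t l) (t k))\<^sup>2)"
        unfolding sum_distrib_left
      proof (intro sum_mono)
        fix l k assume lk: "l \<in> I" "k \<in> I - {l}"
        have "a\<^sup>2 \<le> (ed M (t l) (t k))\<^sup>2" using sep[of l k] lk a by (intro power_mono) auto
        then show "a\<^sup>2 * (G \<epsilon> l * G \<epsilon> k) \<le> G \<epsilon> l * G \<epsilon> k * (ed M (t l) (t k))\<^sup>2"
          using mult_left_mono[of _ _ "G \<epsilon> l * G \<epsilon> k"] G0[of \<epsilon> l] G0[of \<epsilon> k]
          by (simp add: mult.commute[of "a\<^sup>2"])
      qed
      also have "\<dots> \<le> (\<Sum>l\<in>I. \<Sum>k\<in>I. G \<epsilon> l * G \<epsilon> k * (ed M (t l) (t k))\<^sup>2)"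
        using I G0 by (intro sum_mono sum_mono2) auto
      also have "\<dots> = (\<Sum>i<M. \<Sum>l\<in>I. \<Sum>k\<in>I. G \<epsilon> l * G \<epsilon> k * (t l i - t k i)\<^sup>2)"
        unfolding ed_sq sum_distrib_left
        by (rule sym, rule trans[OF sum.swap], rule sum.cong[OF refl], rule sum.swap)
      finally have "\<beta> * exp (-4) / 2 * (a\<^sup>2 * (1 - q \<epsilon>))
          \<le> \<beta> * exp (-4) / 2 * (\<Sum>i<M. \<Sum>l\<in>I. \<Sum>k\<in>I. G \<epsilon> l * G \<epsilon> k * (t l i - t k i)\<^sup>2)"
        using \<beta> by (intro mult_left_mono) auto
      then show "\<beta> * exp (-4) / 2 * a\<^sup>2 * (1 - q \<epsilon>)
          \<le> (\<Sum>i<M. \<beta> * exp (-4) / 2 * (\<Sum>l\<in>I. \<Sum>k\<in>I. G \<epsilon> l * G \<epsilon> k * (t l i - t k i)\<^sup>2))"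
        by (simp only: sum_distrib_left[symmetric] mult.assoc)
    qed
    also have "\<dots> \<le> avg M (\<lambda>\<epsilon>. \<Sum>l\<in>I. G \<epsilon> l * X \<epsilon> l)"
      unfolding GX avg_sum using coord by (intro sum_mono) auto
    also have "\<dots> \<le> avg M mx"
    proof (rule avg_mono)
      fix \<epsilon>
      have "(\<Sum>l\<in>I. G \<epsilon> l * X \<epsilon> l) \<le> (\<Sum>l\<in>I. G \<epsilon> l * mx \<epsilon>)"
        using G0 Xmx by (intro sum_mono mult_left_mono) auto
      then show "(\<Sum>l\<in>I. G \<epsilon> l * X \<epsilon> l) \<le> mx \<epsilon>" by (simp add: sum_distrib_right[symmetric] G1)
    qed
    finally show ?thesis .
  qed
  \<comment> \<open>The bound that is good for a concentrated Gibbs measure.\<close>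
  have low2: "ln m - ln 2 - 2 * ln m * ?D \<le> \<beta> * avg M mx"
  proof -
    have "avg M (\<lambda>\<epsilon>. ln m + (\<beta> / m) * (\<Sum>l\<in>I. X \<epsilon> l)) \<le> avg M (\<lambda>\<epsilon>. \<beta> * mx \<epsilon> + (ln 2 + (2 * ln m) * (1 - q \<epsilon>)))"
    proof (rule avg_mono)
      fix \<epsilon>
      define c where "c = (\<beta> / m) * (\<Sum>l\<in>I. X \<epsilon> l)"
      \<comment> \<open>Jensen's inequality for the uniform measure on \<open>I\<close>, by the tangent at the mean \<open>c\<close>.\<close>
      have "(\<Sum>l\<in>I. exp c * (1 + (\<beta> * X \<epsilon> l - c))) \<le> Z \<epsilon>"
        unfolding Z_def
      proof (rule sum_mono)
        fix l
        have "exp c * (1 + (\<beta> * X \<epsilon> l - c)) \<le> exp c * exp (\<beta> * X \<epsilon> l - c)"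
          by (intro mult_left_mono exp_ge_add_one_self) auto
        then show "exp c * (1 + (\<beta> * X \<epsilon> l - c)) \<le> exp (\<beta> * X \<epsilon> l)" by (simp flip: exp_add)
      qed
      moreover have "(\<Sum>l\<in>I. exp c * (1 + (\<beta> * X \<epsilon> l - c))) = m * exp c"
      proof -
        have "(\<Sum>l\<in>I. 1 + (\<beta> * X \<epsilon> l - c)) = m + \<beta> * (\<Sum>l\<in>I. X \<epsilon> l) - m * c"
          by (simp add: sum.distrib sum_subtractf sum_distrib_left m_def)
        also have "\<dots> = m" unfolding c_def using m by simp
        finally show ?thesis by (simp add: sum_distrib_left[symmetric])
      qed
      ultimately have "ln (m * exp c) \<le> ln (Z \<epsilon>)" using m Zpos[of \<epsilon>] by (subst ln_le_cancel_iff) auto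
      then have 1: "ln m + c \<le> ln (Z \<epsilon>)" using m by (simp add: ln_mult)
      have "Z \<epsilon> = exp (\<beta> * mx \<epsilon>) / q \<epsilon>" unfolding q_def using Zpos[of \<epsilon>] by simp
      then have 2: "ln (Z \<epsilon>) = \<beta> * mx \<epsilon> - ln (q \<epsilon>)" using q0[of \<epsilon>] by (simp add: ln_div)
      have 3: "- ln (q \<epsilon>) \<le> ln 2 + (2 * ln m) * (1 - q \<epsilon>)"
      proof (cases "q \<epsilon> \<le> 1/2")
        case True
        have "ln (1 / m) \<le> ln (q \<epsilon>)" using qm[of \<epsilon>] m q0[of \<epsilon>] by (subst ln_le_cancel_iff) auto
        then have "- ln (q \<epsilon>) \<le> ln m" using m by (simp add: ln_div)
        also have "ln m * 1 \<le> ln m * (2 * (1 - q \<epsilon>))" using True lnm' by (intro mult_left_mono) auto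
        also have "ln m * (2 * (1 - q \<epsilon>)) = (2 * ln m) * (1 - q \<epsilon>)" by (simp only: mult_ac)
        finally show ?thesis using ln_gt_zero[of "2::real"] by linarith
      next
        case False
        have "ln (1 / 2) \<le> ln (q \<epsilon>)" using False q0[of \<epsilon>] by (subst ln_le_cancel_iff) auto
        moreover have "0 \<le> (2 * ln m) * (1 - q \<epsilon>)" using q1[of \<epsilon>] lnm' by (intro mult_nonneg_nonneg) auto
        ultimately show ?thesis by (simp add: ln_div)
      qed
      show "ln m + (\<beta> / m) * (\<Sum>l\<in>I. X \<epsilon> l) \<le> \<beta> * mx \<epsilon> + (ln 2 + (2 * ln m) * (1 - q \<epsilon>))"
        using 1 2 3 unfolding c_def by linarith
    qed
    moreover have "avg M (\<lambda>\<epsilon>. \<Sum>l\<in>I. X \<epsilon> l) = 0" unfolding X_def avg_sum by simp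
    ultimately show ?thesis by (simp add: avg_add avg_cmult del: times_divide_eq_left)
  qed
  have mx: "avg M mx = avg M (\<lambda>\<epsilon>. Max ((\<lambda>l. ip M \<epsilon> (t l)) ` I))"
    by (rule avg_cong) (simp add: mx_def X_def[abs_def])
  show ?thesis
  proof (cases "1 / 8 \<le> ?D")
    case True
    have "exp (-4) / 16 * \<beta> * a\<^sup>2 = \<beta> * exp (-4) / 2 * a\<^sup>2 * (1 / 8)" by simp
    also have "\<dots> \<le> \<beta> * exp (-4) / 2 * a\<^sup>2 * ?D" using True \<beta> by (intro mult_left_mono) auto
    also have "\<dots> \<le> avg M mx" by (rule low1)
    finally show ?thesis using mx by simp
  next
    case False
    have "ln m * ?D \<le> ln m * (1/8)" using False lnm' by (intro mult_left_mono) auto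
    moreover have "ln (2::real) \<le> 1" using ln_le_minus_one[of "2::real"] by simp
    ultimately have "ln m / 2 \<le> \<beta> * avg M mx" using low2 lnm' by linarith
    moreover have "exp (-4) / 16 * (\<beta>\<^sup>2 * a\<^sup>2) \<le> 1 / 2 * (\<beta>\<^sup>2 * a\<^sup>2)"
    proof (rule mult_right_mono)
      have "exp (-4::real) \<le> 1" by simp
      then show "exp (-4::real) / 16 \<le> 1 / 2" by linarith
    qed simp
    moreover have "\<beta> * (exp (-4) / 16 * \<beta> * a\<^sup>2) = exp (-4) / 16 * (\<beta>\<^sup>2 * a\<^sup>2)"
      by (simp add: power2_eq_square)
    ultimately have "\<beta> * (exp (-4) / 16 * \<beta> * a\<^sup>2) \<le> \<beta> * avg M mx"
      using \<beta>(2) unfolding m_def by linarith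
    then show ?thesis using \<beta> mx by (simp only: mult_le_cancel_left_pos)
  qed
qed

section \<open>Concentration of convex functions on the cube\<close>

text \<open>
  The choice \<open>\<theta> = - 2 ln \<rho>\<close> minimizes the exponent. It is admissible only for \<open>\<rho> \<ge> exp (-1/2)\<close>; below
  this value \<open>\<theta> = 1\<close> is good enough.
\<close>

lemma two_point_exponent:
  fixes \<rho> :: real
  assumes "0 < \<rho>" "\<rho> \<le> 1"
  obtains \<theta> where "0 \<le> \<theta>" "\<theta> \<le> 1" "exp ((\<theta> - 1) * ln \<rho> + \<theta>\<^sup>2 / 4) \<le> 2 - \<rho>"
proof (cases "exp (-1/2) \<le> \<rho>")
  case True
  define f where "f x = ln (2 - x) + ln x + (ln x)\<^sup>2" for x :: real
  have "f \<rho> \<ge> f 1"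
  proof (rule DERIV_nonpos_imp_nonincreasing[OF assms(2)])
    fix x assume x: "\<rho> \<le> x" "x \<le> 1"
    then have x0: "0 < x" using assms by simp
    have "(f has_real_derivative (- 1 / (2 - x) + 1 / x + 2 * ln x * (1 / x))) (at x)"
      unfolding f_def using x x0 by (auto intro!: derivative_eq_intros simp: power2_eq_square)
    moreover have "- 1 / (2 - x) + 1 / x + 2 * ln x * (1 / x) \<le> 0"
    proof -
      have l: "ln x \<le> x - 1" using ln_le_minus_one[OF x0] .
      have "(1 - x) / (2 - x) \<le> 1 - x"
        using divide_left_mono[of 1 "2 - x" "1 - x"] x by simp
      then have "2 * ((1 - x) / (2 - x)) + 2 * ln x \<le> 0" using l by linarith
      then have "2 * (1 - x) / (2 - x) + 2 * ln x \<le> 0" by (simp only: times_divide_eq_right)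
      then have "(2 * (1 - x) / (2 - x) + 2 * ln x) / x \<le> 0" using x0 by (simp add: divide_nonpos_pos)
      moreover have "(2 * (1 - x) / (2 - x) + 2 * ln x) / x = - 1 / (2 - x) + 1 / x + 2 * ln x * (1 / x)"
        using x x0 by (simp add: field_simps)
      ultimately show ?thesis by simp
    qed
    ultimately show "\<exists>y. (f has_real_derivative y) (at x) \<and> y \<le> 0" by blast
  qed
  then have "- ln \<rho> - (ln \<rho>)\<^sup>2 \<le> ln (2 - \<rho>)" by (simp add: f_def)
  then have "exp (- ln \<rho> - (ln \<rho>)\<^sup>2) \<le> exp (ln (2 - \<rho>))" by (simp only: exp_le_cancel_iff)
  moreover have "((- 2 * ln \<rho>) - 1) * ln \<rho> + (- 2 * ln \<rho>)\<^sup>2 / 4 = - ln \<rho> - (ln \<rho>)\<^sup>2"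
    by (simp add: power2_eq_square algebra_simps)
  moreover have "- 1 / 2 \<le> ln \<rho>" using True assms by (simp add: ln_ge_iff)
  ultimately show ?thesis using assms by (intro that[of "- 2 * ln \<rho>"]) (simp_all only:, auto)
next
  case False
  have "exp (1/4 :: real) \<le> 1 + 1/4 + (1/4)\<^sup>2" by (rule exp_bound) auto
  then have 1: "exp (1/4 :: real) \<le> 21 / 16" by (simp add: power2_eq_square)
  have "1 + 1/2 + (1/2)\<^sup>2 / 2 \<le> exp (1/2 :: real)" by (rule exp_lower_Taylor_quadratic) auto
  then have "13 / 8 \<le> exp (1/2 :: real)" by (simp add: power2_eq_square)
  then have "exp (-1/2 :: real) \<le> 1 / (13 / 8)"
    using divide_left_mono[of "13/8" "exp (1/2 :: real)" 1] by (simp add: exp_minus inverse_eq_divide)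
  then show ?thesis using False 1 by (intro that[of 1]) auto
qed

text \<open>
  The two-point case of the concentration inequality. With \<open>A \<le> B\<close>, the bound for \<open>b\<close> is used at
  \<open>\<theta> = 0\<close>, the one for \<open>a\<close> at the optimal \<open>\<theta>\<close>, and the product is at most
  \<open>(3 - \<rho>) (1 + \<rho>) / 4 = 1 - (1 - \<rho>)\<^sup>2 / 4\<close> with \<open>\<rho> = A / B\<close>.
\<close>

lemma two_point_product:
  fixes a b A B :: real
  assumes AB: "0 < A" "0 < B"
    and a: "\<And>\<theta>. 0 \<le> \<theta> \<Longrightarrow> \<theta> \<le> 1 \<Longrightarrow> a \<le> exp (\<theta>\<^sup>2 / 4 - (1 - \<theta>) * ln A - \<theta> * ln B)"
    and b: "\<And>\<theta>. 0 \<le> \<theta> \<Longrightarrow> \<theta> \<le> 1 \<Longrightarrow> b \<le> exp (\<theta>\<^sup>2 / 4 - (1 - \<theta>) * ln B - \<theta> * ln A)"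
  shows "(a + b) / 2 * ((A + B) / 2) \<le> 1"
proof -
  have *: "(a + b) / 2 * ((A + B) / 2) \<le> 1"
    if AB: "0 < A" "A \<le> B"
    and a: "\<And>\<theta>. 0 \<le> \<theta> \<Longrightarrow> \<theta> \<le> 1 \<Longrightarrow> a \<le> exp (\<theta>\<^sup>2 / 4 - (1 - \<theta>) * ln A - \<theta> * ln B)"
    and b: "b \<le> exp (- ln B)" for a b A B :: real
  proof -
    define \<rho> where "\<rho> = A / B"
    have \<rho>: "0 < \<rho>" "\<rho> \<le> 1" using AB by (auto simp: \<rho>_def)
    obtain \<theta> where \<theta>: "0 \<le> \<theta>" "\<theta> \<le> 1" "exp ((\<theta> - 1) * ln \<rho> + \<theta>\<^sup>2 / 4) \<le> 2 - \<rho>"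
      using two_point_exponent[OF \<rho>] by blast
    have "\<theta>\<^sup>2 / 4 - (1 - \<theta>) * ln A - \<theta> * ln B = - ln B + ((\<theta> - 1) * ln \<rho> + \<theta>\<^sup>2 / 4)"
      unfolding \<rho>_def using AB by (simp add: ln_div algebra_simps)
    then have "a \<le> exp (- ln B) * exp ((\<theta> - 1) * ln \<rho> + \<theta>\<^sup>2 / 4)"
      using a[OF \<theta>(1,2)] by (simp only: exp_add[symmetric])
    also have "\<dots> \<le> exp (- ln B) * (2 - \<rho>)" using \<theta>(3) by (intro mult_left_mono) auto
    finally have "a \<le> (2 - \<rho>) / B" using AB by (simp add: exp_minus field_simps)
    moreover have "b \<le> 1 / B" using b AB by (simp add: exp_minus field_simps)
    ultimately have "a + b \<le> (3 - \<rho>) / B" by (simp add: diff_divide_distrib)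
    moreover have "A + B = B * (1 + \<rho>)" unfolding \<rho>_def using AB by (simp add: field_simps)
    moreover have "0 \<le> A + B" using AB by simp
    ultimately have "(a + b) * (A + B) \<le> (3 - \<rho>) / B * (B * (1 + \<rho>))"
      using mult_right_mono[of "a + b" "(3 - \<rho>) / B" "A + B"] by (simp only:)
    also have "\<dots> = 4 - (1 - \<rho>)\<^sup>2" using AB by (simp add: power2_eq_square field_simps)
    finally have "(a + b) * (A + B) \<le> 4" by (smt (verit) zero_le_power2)
    then show ?thesis by simp
  qed
  show ?thesis
  proof (cases "A \<le> B")
    case True
    show ?thesis using *[OF AB(1) True a] b[of 0] by simp
  next
    case False
    then have "B \<le> A" by simp
    then show ?thesis using *[OF AB(2) _ b] a[of 0] by (simp add: add.commute)
  qed
qed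

lemma exp_convex_combination:
  fixes x y \<theta> :: real
  assumes "0 \<le> \<theta>" "\<theta> \<le> 1"
  shows "exp ((1 - \<theta>) * x + \<theta> * y) \<le> (1 - \<theta>) * exp x + \<theta> * exp y"
proof -
  have "convex_on UNIV (exp :: real \<Rightarrow> real)" by (rule exp_convex)
  then show ?thesis using assms unfolding convex_on_def by (auto dest!: spec[of _ x] spec[of _ y])
qed

text \<open>
  Hoelder's inequality, by convexity of the exponential function after normalizing both factors to
  mean one.
\<close>

lemma avg_exp_Hoelder:
  assumes "0 \<le> \<theta>" "\<theta> \<le> 1"
  shows "avg M (\<lambda>\<epsilon>. exp ((1 - \<theta>) * g \<epsilon> + \<theta> * h \<epsilon>))
    \<le> exp ((1 - \<theta>) * ln (avg M (\<lambda>\<epsilon>. exp (g \<epsilon>))) + \<theta> * ln (avg M (\<lambda>\<epsilon>. exp (h \<epsilon>))))"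
proof -
  let ?P = "avg M (\<lambda>\<epsilon>. exp (g \<epsilon>))" and ?Q = "avg M (\<lambda>\<epsilon>. exp (h \<epsilon>))"
  have P: "0 < ?P" "0 < ?Q" by (auto intro: avg_pos)
  let ?E = "exp ((1 - \<theta>) * ln ?P + \<theta> * ln ?Q)"
  have "avg M (\<lambda>\<epsilon>. exp ((1 - \<theta>) * g \<epsilon> + \<theta> * h \<epsilon>))
      \<le> avg M (\<lambda>\<epsilon>. ?E * ((1 - \<theta>) / ?P * exp (g \<epsilon>) + \<theta> / ?Q * exp (h \<epsilon>)))"
  proof (rule avg_mono)
    fix \<epsilon>
    have "exp ((1 - \<theta>) * g \<epsilon> + \<theta> * h \<epsilon>) = ?E * exp ((1 - \<theta>) * (g \<epsilon> - ln ?P) + \<theta> * (h \<epsilon> - ln ?Q))"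
      by (simp add: algebra_simps flip: exp_add)
    also have "\<dots> \<le> ?E * ((1 - \<theta>) * exp (g \<epsilon> - ln ?P) + \<theta> * exp (h \<epsilon> - ln ?Q))"
      using exp_convex_combination[OF assms] by (intro mult_left_mono) auto
    finally show "exp ((1 - \<theta>) * g \<epsilon> + \<theta> * h \<epsilon>) \<le> ?E * ((1 - \<theta>) / ?P * exp (g \<epsilon>) + \<theta> / ?Q * exp (h \<epsilon>))"
      using P by (simp add: exp_diff)
  qed
  also have "\<dots> = ?E * ((1 - \<theta>) / ?P * ?P + \<theta> / ?Q * ?Q)"
    by (simp only: avg_cmult avg_add)
  also have "\<dots> = ?E" using P by simp
  finally show ?thesis .
qed

definition cube :: "(nat \<Rightarrow> real) set" where "cube = {y. \<forall>i. \<bar>y i\<bar> \<le> 1}"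

lemma zero_in_cube: "(\<lambda>_. 0) \<in> cube" by (simp add: cube_def)

lemma cube_convex:
  assumes "x \<in> cube" "y \<in> cube" "0 \<le> \<theta>" "\<theta> \<le> 1"
  shows "(\<lambda>i. (1 - \<theta>) * x i + \<theta> * y i) \<in> cube"
  unfolding cube_def
proof (intro CollectI allI)
  fix i
  have "\<bar>(1 - \<theta>) * x i + \<theta> * y i\<bar> \<le> (1 - \<theta>) * \<bar>x i\<bar> + \<theta> * \<bar>y i\<bar>"
    using assms by (metis abs_mult abs_of_nonneg abs_triangle_ineq diff_ge_0_iff_ge)
  also have "\<dots> \<le> (1 - \<theta>) * 1 + \<theta> * 1"
    using assms by (intro add_mono mult_left_mono) (auto simp: cube_def)
  finally show "\<bar>(1 - \<theta>) * x i + \<theta> * y i\<bar> \<le> 1" by simp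
qed

lemma square_convex_combination:
  fixes a b c \<theta> :: real
  assumes "0 \<le> \<theta>" "\<theta> \<le> 1"
  shows "(a - ((1 - \<theta>) * b + \<theta> * c))\<^sup>2 \<le> (1 - \<theta>) * (a - b)\<^sup>2 + \<theta> * (a - c)\<^sup>2"
proof -
  have "(1 - \<theta>) * (a - b)\<^sup>2 + \<theta> * (a - c)\<^sup>2 - (a - ((1 - \<theta>) * b + \<theta> * c))\<^sup>2 = \<theta> * (1 - \<theta>) * (b - c)\<^sup>2"
    by (simp add: power2_eq_square algebra_simps)
  moreover have "0 \<le> \<theta> * (1 - \<theta>) * (b - c)\<^sup>2" using assms by (intro mult_nonneg_nonneg) auto
  ultimately show ?thesis by linarith
qed

lemma le_Inf_convex_combination:
  fixes f h :: "'a \<Rightarrow> real"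
  assumes C: "C \<noteq> {}" and f: "\<And>y. y \<in> C \<Longrightarrow> 0 \<le> f y" and h: "\<And>y. y \<in> C \<Longrightarrow> 0 \<le> h y"
    and \<theta>: "0 \<le> \<theta>" "\<theta> \<le> 1"
    and le: "\<And>y z. y \<in> C \<Longrightarrow> z \<in> C \<Longrightarrow> g \<le> (1 - \<theta>) * f y + \<theta> * h z + d"
  shows "g \<le> (1 - \<theta>) * (INF y\<in>C. f y) + \<theta> * (INF y\<in>C. h y) + d"
proof (rule field_le_epsilon)
  fix e :: real assume e: "0 < e"
  have "bdd_below (f ` C)" "bdd_below (h ` C)" using f h by (auto intro!: bdd_belowI2)
  then obtain y z where yz: "y \<in> C" "f y < (INF y\<in>C. f y) + e" "z \<in> C" "h z < (INF y\<in>C. h y) + e"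
    using cINF_less_iff[OF C, of f "(INF y\<in>C. f y) + e"] cINF_less_iff[OF C, of h "(INF y\<in>C. h y) + e"] e
    by auto
  have "(1 - \<theta>) * f y + \<theta> * h z \<le> (1 - \<theta>) * ((INF y\<in>C. f y) + e) + \<theta> * ((INF y\<in>C. h y) + e)"
    using yz \<theta> by (intro add_mono mult_left_mono) auto
  also have "\<dots> = (1 - \<theta>) * (INF y\<in>C. f y) + \<theta> * (INF y\<in>C. h y) + e" by (simp add: algebra_simps)
  finally show "g \<le> (1 - \<theta>) * (INF y\<in>C. f y) + \<theta> * (INF y\<in>C. h y) + d + e"
    using le[OF yz(1,3)] by linarith
qed

text \<open>
  Maurey's property (tau) for convex functions on the cube: \<open>G\<close> is dominated by the infimal convolution
  of \<open>F\<close> with \<open>\<bar>\<cdot>\<bar>\<^sup>2 / 16\<close>. Induction on the dimension: to bound \<open>G\<close> at the last sign \<open>s\<close>, move the last coordinate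
  of the comparison point from \<open>s\<close> by \<open>2 \<theta>\<close> towards \<open>-s\<close>. Convexity of \<open>F\<close> then interpolates between the
  two facets, Hoelder's inequality transfers this to exponential moments, and the freedom in \<open>\<theta>\<close> is what
  \<open>two_point_product\<close> needs.
\<close>

lemma property_tau:
  assumes "\<And>x y \<theta>. x \<in> cube \<Longrightarrow> y \<in> cube \<Longrightarrow> 0 \<le> \<theta> \<Longrightarrow> \<theta> \<le> 1 \<Longrightarrow>
      F (\<lambda>i. (1 - \<theta>) * x i + \<theta> * y i) \<le> (1 - \<theta>) * F x + \<theta> * F y"
    and "\<And>y. y \<in> cube \<Longrightarrow> 0 \<le> F y"
    and "\<And>\<epsilon> y. \<epsilon> \<in> signs M \<Longrightarrow> y \<in> cube \<Longrightarrow> G \<epsilon> \<le> F y + (\<Sum>i<M. (\<epsilon> i - y i)\<^sup>2) / 16"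
  shows "avg M (\<lambda>\<epsilon>. exp (G \<epsilon>)) * avg M (\<lambda>\<epsilon>. exp (- F \<epsilon>)) \<le> 1"
  using assms
proof (induction M arbitrary: F G)
  case 0
  have s: "signs 0 = {\<lambda>_. 0}" by (auto simp: signs_def)
  have "G (\<lambda>_. 0) \<le> F (\<lambda>_. 0)" using "0.prems"(3)[of "\<lambda>_. 0" "\<lambda>_. 0"] zero_in_cube s by simp
  then show ?case by (simp add: avg_def s flip: exp_add)
next
  case (Suc M)
  note conv = Suc.prems(1) and nonneg = Suc.prems(2) and le = Suc.prems(3)
  define Fs where "Fs s y = F (y(M := s))" for s y
  define K where "K s \<epsilon> y = Fs s y + (\<Sum>i<M. (\<epsilon> i - y i)\<^sup>2) / 16" for s and \<epsilon> y :: "nat \<Rightarrow> real"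
  define Gs where "Gs s \<epsilon> = (INF y\<in>cube. K s \<epsilon> y)" for s \<epsilon>
  have upd: "y(M := s) \<in> cube" if "y \<in> cube" "s = 1 \<or> s = -1" for y s
    using that by (auto simp: cube_def)
  have Fs0: "0 \<le> Fs s y" if "y \<in> cube" "s = 1 \<or> s = -1" for s y
    unfolding Fs_def using nonneg upd that by blast
  have K0: "0 \<le> K s \<epsilon> y" if "y \<in> cube" "s = 1 \<or> s = -1" for s y \<epsilon>
    unfolding K_def using Fs0[OF that] by (simp add: sum_nonneg)
  have IH: "avg M (\<lambda>\<epsilon>. exp (Gs s \<epsilon>)) * avg M (\<lambda>\<epsilon>. exp (- Fs s \<epsilon>)) \<le> 1" if s: "s = 1 \<or> s = -1" for s
  proof (rule Suc.IH)
    fix x y \<theta> assume xy: "x \<in> cube" "y \<in> cube" "0 \<le> \<theta>" "\<theta> \<le> (1::real)"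
    have "(\<lambda>i. (1 - \<theta>) * x i + \<theta> * y i)(M := s) = (\<lambda>i. (1 - \<theta>) * (x(M := s)) i + \<theta> * (y(M := s)) i)"
      by (auto simp: fun_eq_iff algebra_simps)
    then show "Fs s (\<lambda>i. (1 - \<theta>) * x i + \<theta> * y i) \<le> (1 - \<theta>) * Fs s x + \<theta> * Fs s y"
      unfolding Fs_def using conv[OF upd[OF xy(1) s] upd[OF xy(2) s] xy(3,4)] by (simp only:)
  next
    fix \<epsilon> y assume "\<epsilon> \<in> signs M" "y \<in> cube"
    then show "Gs s \<epsilon> \<le> Fs s y + (\<Sum>i<M. (\<epsilon> i - y i)\<^sup>2) / 16"
      unfolding Gs_def K_def[symmetric] using K0 s
      by (intro cINF_lower bdd_belowI2[of _ 0]) auto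
  qed (use Fs0 s in auto)
  have GG: "G (\<epsilon>(M := s)) \<le> (1 - \<theta>) * Gs s \<epsilon> + \<theta> * Gs (- s) \<epsilon> + \<theta>\<^sup>2 / 4"
    if e: "\<epsilon> \<in> signs M" and s: "s = 1 \<or> s = -1" and \<theta>: "0 \<le> \<theta>" "\<theta> \<le> 1" for \<epsilon> s \<theta>
    unfolding Gs_def
  proof (rule le_Inf_convex_combination)
    show "cube \<noteq> {}" using zero_in_cube by blast
    fix y z assume yz: "y \<in> cube" "z \<in> cube"
    define x where "x = (\<lambda>i. (1 - \<theta>) * (y(M := s)) i + \<theta> * (z(M := - s)) i)"
    have s': "- s = 1 \<or> - s = -1" using s by auto
    have x: "x \<in> cube" unfolding x_def by (rule cube_convex[OF upd[OF yz(1) s] upd[OF yz(2) s'] \<theta>])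
    have "\<epsilon>(M := s) \<in> signs (Suc M)" using e s by (auto simp: signs_def)
    then have "G (\<epsilon>(M := s)) \<le> F x + (\<Sum>i<Suc M. ((\<epsilon>(M := s)) i - x i)\<^sup>2) / 16" by (rule le[OF _ x])
    also have "(\<Sum>i<Suc M. ((\<epsilon>(M := s)) i - x i)\<^sup>2)
        = (\<Sum>i<M. (\<epsilon> i - ((1 - \<theta>) * y i + \<theta> * z i))\<^sup>2) + (s - ((1 - \<theta>) * s - \<theta> * s))\<^sup>2"
      by (simp add: x_def)
    also have "(s - ((1 - \<theta>) * s - \<theta> * s))\<^sup>2 = 4 * \<theta>\<^sup>2"
      using s by (auto simp: power2_eq_square algebra_simps)
    also have "(\<Sum>i<M. (\<epsilon> i - ((1 - \<theta>) * y i + \<theta> * z i))\<^sup>2)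
        \<le> (\<Sum>i<M. (1 - \<theta>) * (\<epsilon> i - y i)\<^sup>2 + \<theta> * (\<epsilon> i - z i)\<^sup>2)"
      by (intro sum_mono square_convex_combination[OF \<theta>])
    also have "\<dots> = (1 - \<theta>) * (\<Sum>i<M. (\<epsilon> i - y i)\<^sup>2) + \<theta> * (\<Sum>i<M. (\<epsilon> i - z i)\<^sup>2)"
      by (simp add: sum.distrib sum_distrib_left)
    also have "F x \<le> (1 - \<theta>) * Fs s y + \<theta> * Fs (- s) z"
      unfolding Fs_def x_def by (rule conv[OF upd[OF yz(1) s] upd[OF yz(2) s'] \<theta>])
    finally have "G (\<epsilon>(M := s)) \<le> ((1 - \<theta>) * Fs s y + \<theta> * Fs (- s) z)
        + ((1 - \<theta>) * (\<Sum>i<M. (\<epsilon> i - y i)\<^sup>2) + \<theta> * (\<Sum>i<M. (\<epsilon> i - z i)\<^sup>2) + 4 * \<theta>\<^sup>2) / 16"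
      by (simp_all del: fun_upd_apply)
    moreover have "(1 - \<theta>) * K s \<epsilon> y + \<theta> * K (- s) \<epsilon> z + \<theta>\<^sup>2 / 4 = ((1 - \<theta>) * Fs s y + \<theta> * Fs (- s) z)
        + ((1 - \<theta>) * (\<Sum>i<M. (\<epsilon> i - y i)\<^sup>2) + \<theta> * (\<Sum>i<M. (\<epsilon> i - z i)\<^sup>2) + 4 * \<theta>\<^sup>2) / 16"
      by (simp add: K_def field_simps)
    ultimately show "G (\<epsilon>(M := s)) \<le> (1 - \<theta>) * K s \<epsilon> y + \<theta> * K (- s) \<epsilon> z + \<theta>\<^sup>2 / 4" by linarith
  qed (use K0 s \<theta> in auto)
  let ?A = "\<lambda>s. avg M (\<lambda>\<epsilon>. exp (- Fs s \<epsilon>))"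
  have Apos: "0 < ?A s" for s by (auto intro: avg_pos)
  have Gln: "ln (avg M (\<lambda>\<epsilon>. exp (Gs s \<epsilon>))) \<le> - ln (?A s)" if "s = 1 \<or> s = -1" for s
  proof -
    have G0: "0 < avg M (\<lambda>\<epsilon>. exp (Gs s \<epsilon>))" by (auto intro: avg_pos)
    have "ln (avg M (\<lambda>\<epsilon>. exp (Gs s \<epsilon>)) * ?A s) \<le> ln 1"
      using IH[OF that] G0 Apos[of s] by (subst ln_le_cancel_iff) auto
    then have "ln (avg M (\<lambda>\<epsilon>. exp (Gs s \<epsilon>))) + ln (?A s) \<le> 0"
      using G0 Apos[of s] by (simp add: ln_mult)
    then show ?thesis by simp
  qed
  have half: "avg M (\<lambda>\<epsilon>. exp (G (\<epsilon>(M := s)))) \<le> exp (\<theta>\<^sup>2 / 4 - (1 - \<theta>) * ln (?A s) - \<theta> * ln (?A (- s)))"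
    if s: "s = 1 \<or> s = -1" and \<theta>: "0 \<le> \<theta>" "\<theta> \<le> 1" for s \<theta>
  proof -
    have s': "- s = 1 \<or> - s = -1" using s by auto
    have "avg M (\<lambda>\<epsilon>. exp (G (\<epsilon>(M := s)))) \<le> avg M (\<lambda>\<epsilon>. exp (\<theta>\<^sup>2 / 4) * exp ((1 - \<theta>) * Gs s \<epsilon> + \<theta> * Gs (- s) \<epsilon>))"
      using GG[OF _ s \<theta>] by (intro avg_mono) (simp add: add.commute flip: exp_add)
    also have "\<dots> \<le> exp (\<theta>\<^sup>2 / 4) * exp ((1 - \<theta>) * ln (avg M (\<lambda>\<epsilon>. exp (Gs s \<epsilon>)))
          + \<theta> * ln (avg M (\<lambda>\<epsilon>. exp (Gs (- s) \<epsilon>))))"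
      unfolding avg_cmult using avg_exp_Hoelder[OF \<theta>] by (intro mult_left_mono) auto
    also have "\<dots> \<le> exp (\<theta>\<^sup>2 / 4) * exp ((1 - \<theta>) * (- ln (?A s)) + \<theta> * (- ln (?A (- s))))"
    proof -
      have "(1 - \<theta>) * ln (avg M (\<lambda>\<epsilon>. exp (Gs s \<epsilon>))) + \<theta> * ln (avg M (\<lambda>\<epsilon>. exp (Gs (- s) \<epsilon>)))
        \<le> (1 - \<theta>) * (- ln (?A s)) + \<theta> * (- ln (?A (- s)))"
        using Gln[OF s] Gln[OF s'] \<theta> by (intro add_mono mult_left_mono) auto
      then show ?thesis by simp
    qed
    also have "\<dots> = exp (\<theta>\<^sup>2 / 4 - (1 - \<theta>) * ln (?A s) - \<theta> * ln (?A (- s)))"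
      by (simp flip: exp_add)
    finally show ?thesis .
  qed
  have prod: "(avg M (\<lambda>\<epsilon>. exp (G (\<epsilon>(M := 1)))) + avg M (\<lambda>\<epsilon>. exp (G (\<epsilon>(M := -1))))) / 2 * ((?A 1 + ?A (-1)) / 2) \<le> 1"
    using Apos half[of 1] half[of "-1"] by (intro two_point_product) auto
  have split: "avg (Suc M) H = (avg M (\<lambda>\<epsilon>. H (\<epsilon>(M := 1))) + avg M (\<lambda>\<epsilon>. H (\<epsilon>(M := -1)))) / 2" for H
    using avg_cmult[of M "1/2" "\<lambda>\<epsilon>. H (\<epsilon>(M := 1)) + H (\<epsilon>(M := -1))"] by (simp add: avg_Suc avg_add)
  show ?case
    unfolding split[of "\<lambda>\<epsilon>. exp (G \<epsilon>)"] split[of "\<lambda>\<epsilon>. exp (- F \<epsilon>)"]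
    using prod by (simp only: Fs_def)
qed

lemma ip_convex_combination:
  "ip M (\<lambda>i. (1 - \<theta>) * x i + \<theta> * y i) t = (1 - \<theta>) * ip M x t + \<theta> * ip M y t"
  unfolding ip_def sum_distrib_left sum.distrib[symmetric] by (intro sum.cong) (auto simp: algebra_simps)

lemma ip_diff_le:
  "ip M x v - ip M y v \<le> sqrt (\<Sum>i<M. (x i - y i)\<^sup>2) * sqrt (\<Sum>i<M. (v i)\<^sup>2)"
proof -
  have "ip M x v - ip M y v = (\<Sum>i<M. (x i - y i) * v i)"
    by (simp add: ip_def sum_subtractf algebra_simps)
  also have "\<dots> \<le> (\<Sum>i<M. \<bar>x i - y i\<bar> * \<bar>v i\<bar>)"
    by (intro sum_mono) (metis abs_ge_self abs_mult)
  also have "\<dots> \<le> sqrt (\<Sum>i<M. (x i - y i)\<^sup>2) * sqrt (\<Sum>i<M. (v i)\<^sup>2)"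
    using L2_set_mult_ineq[of "\<lambda>i. x i - y i" v "{..<M}"] by (simp add: L2_set_def)
  finally show ?thesis .
qed

text \<open>
  The function \<open>\<kappa> Y\<close>, where \<open>Y\<close> is the maximum over \<open>H\<close> centred at \<open>t0\<close>, is convex, nonnegative because
  \<open>t0 \<in> H\<close>, and \<open>\<kappa> \<sigma>\<close>-Lipschitz. Hence its infimal convolution with \<open>\<bar>\<cdot>\<bar>\<^sup>2 / 16\<close> is at least
  \<open>\<kappa> Y - 4 \<kappa>\<^sup>2 \<sigma>\<^sup>2\<close>, and property (tau) together with Jensen's inequality bounds the moment.
\<close>

lemma Max_ip_lower_deviation:
  assumes H: "finite H" "t0 \<in> H" and \<sigma>: "\<And>t. t \<in> H \<Longrightarrow> ed M t t0 \<le> \<sigma>" and \<kappa>: "0 \<le> \<kappa>"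
  shows "avg M (\<lambda>\<epsilon>. exp (\<kappa> * (bw M H - Max ((\<lambda>t. ip M \<epsilon> (\<lambda>i. t i - t0 i)) ` H)))) \<le> exp (4 * \<kappa>\<^sup>2 * \<sigma>\<^sup>2)"
proof -
  define Y where "Y x = Max ((\<lambda>t. ip M x (\<lambda>i. t i - t0 i)) ` H)" for x
  have Yge: "ip M x (\<lambda>i. t i - t0 i) \<le> Y x" if "t \<in> H" for t x
    unfolding Y_def using H that by auto
  have Yle: "Y x \<le> c" if "\<And>t. t \<in> H \<Longrightarrow> ip M x (\<lambda>i. t i - t0 i) \<le> c" for x c
    unfolding Y_def using H that by (intro Max.boundedI) auto
  have Y0: "0 \<le> Y x" for x using Yge[OF H(2), of x] by (simp add: ip_def)
  have \<sigma>0: "0 \<le> \<sigma>" using \<sigma>[OF H(2)] by simp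
  have meanY: "avg M Y = bw M H"
  proof -
    have "Y x = Max (ip M x ` H) - ip M x t0" for x
    proof (rule antisym)
      show "Y x \<le> Max (ip M x ` H) - ip M x t0" using H by (intro Yle) (auto simp: ip_diff)
      have "Max (ip M x ` H) \<le> Y x + ip M x t0"
      proof (rule Max.boundedI)
        fix a assume "a \<in> ip M x ` H"
        then obtain t where "t \<in> H" "a = ip M x t" by auto
        then show "a \<le> Y x + ip M x t0" using Yge[of t x] by (simp add: ip_diff)
      qed (use H in auto)
      then show "Max (ip M x ` H) - ip M x t0 \<le> Y x" by simp
    qed
    then have "avg M Y = avg M (\<lambda>x. Max (ip M x ` H) - ip M x t0)" by presburger
    then show ?thesis by (simp add: avg_diff bw_def)
  qed
  have "avg M (\<lambda>\<epsilon>. exp (\<kappa> * Y \<epsilon> - 4 * \<kappa>\<^sup>2 * \<sigma>\<^sup>2)) * avg M (\<lambda>\<epsilon>. exp (- (\<kappa> * Y \<epsilon>))) \<le> 1"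
  proof (rule property_tau)
    fix x y \<theta> assume "0 \<le> \<theta>" "\<theta> \<le> (1::real)"
    then have "Y (\<lambda>i. (1 - \<theta>) * x i + \<theta> * y i) \<le> (1 - \<theta>) * Y x + \<theta> * Y y"
      by (intro Yle) (auto simp: ip_convex_combination intro!: add_mono mult_left_mono Yge)
    then have "\<kappa> * Y (\<lambda>i. (1 - \<theta>) * x i + \<theta> * y i) \<le> \<kappa> * ((1 - \<theta>) * Y x + \<theta> * Y y)"
      using \<kappa> by (intro mult_left_mono) auto
    then show "\<kappa> * Y (\<lambda>i. (1 - \<theta>) * x i + \<theta> * y i) \<le> (1 - \<theta>) * (\<kappa> * Y x) + \<theta> * (\<kappa> * Y y)"
      by (simp add: algebra_simps)
  next
    fix x y :: "nat \<Rightarrow> real"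
    define D where "D = (\<Sum>i<M. (x i - y i)\<^sup>2)"
    have D0: "0 \<le> D" unfolding D_def by (simp add: sum_nonneg)
    have "Y x \<le> Y y + sqrt D * \<sigma>"
    proof (rule Yle)
      fix t assume t: "t \<in> H"
      have "ip M x (\<lambda>i. t i - t0 i) - ip M y (\<lambda>i. t i - t0 i) \<le> sqrt D * ed M t t0"
        using ip_diff_le[of M x "\<lambda>i. t i - t0 i" y] by (simp add: D_def ed_def L2_set_def)
      also have "\<dots> \<le> sqrt D * \<sigma>" using \<sigma>[OF t] D0 by (intro mult_left_mono) auto
      finally show "ip M x (\<lambda>i. t i - t0 i) \<le> Y y + sqrt D * \<sigma>" using Yge[OF t, of y] by linarith
    qed
    then have "\<kappa> * Y x \<le> \<kappa> * Y y + \<kappa> * sqrt D * \<sigma>"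
      using mult_left_mono[OF _ \<kappa>] by (fastforce simp: algebra_simps)
    moreover have "\<kappa> * sqrt D * \<sigma> \<le> D / 16 + 4 * \<kappa>\<^sup>2 * \<sigma>\<^sup>2"
    proof -
      have "0 \<le> (sqrt D / 4 - 2 * \<kappa> * \<sigma>)\<^sup>2" by simp
      also have "\<dots> = (sqrt D)\<^sup>2 / 16 + 4 * \<kappa>\<^sup>2 * \<sigma>\<^sup>2 - \<kappa> * sqrt D * \<sigma>"
        by (simp add: power2_eq_square field_simps)
      finally show ?thesis using D0 by simp
    qed
    ultimately show "\<kappa> * Y x - 4 * \<kappa>\<^sup>2 * \<sigma>\<^sup>2 \<le> \<kappa> * Y y + (\<Sum>i<M. (x i - y i)\<^sup>2) / 16"
      unfolding D_def by linarith
  qed (use Y0 \<kappa> in auto)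
  then have 1: "exp (- (4 * \<kappa>\<^sup>2 * \<sigma>\<^sup>2)) * avg M (\<lambda>\<epsilon>. exp (\<kappa> * Y \<epsilon>)) * avg M (\<lambda>\<epsilon>. exp (- (\<kappa> * Y \<epsilon>))) \<le> 1"
    by (simp add: exp_diff exp_minus inverse_eq_divide avg_cmult[symmetric])
  have "exp (\<kappa> * bw M H) \<le> avg M (\<lambda>\<epsilon>. exp (\<kappa> * Y \<epsilon>))"
    using avg_exp_ge[of M "\<lambda>\<epsilon>. \<kappa> * Y \<epsilon>"] by (simp add: avg_cmult meanY)
  then have "exp (- (4 * \<kappa>\<^sup>2 * \<sigma>\<^sup>2)) * exp (\<kappa> * bw M H) * avg M (\<lambda>\<epsilon>. exp (- (\<kappa> * Y \<epsilon>))) \<le> 1"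
    by (intro order_trans[OF _ 1] mult_right_mono mult_left_mono avg_nonneg) auto
  then have "exp (4 * \<kappa>\<^sup>2 * \<sigma>\<^sup>2) * (exp (- (4 * \<kappa>\<^sup>2 * \<sigma>\<^sup>2)) * exp (\<kappa> * bw M H) * avg M (\<lambda>\<epsilon>. exp (- (\<kappa> * Y \<epsilon>)))) \<le> exp (4 * \<kappa>\<^sup>2 * \<sigma>\<^sup>2) * 1"
    by (rule mult_left_mono) simp
  then have "exp (\<kappa> * bw M H) * avg M (\<lambda>\<epsilon>. exp (- (\<kappa> * Y \<epsilon>))) \<le> exp (4 * \<kappa>\<^sup>2 * \<sigma>\<^sup>2)"
    by (simp add: exp_minus mult.assoc[symmetric])
  moreover have "avg M (\<lambda>\<epsilon>. exp (\<kappa> * (bw M H - Y \<epsilon>))) = exp (\<kappa> * bw M H) * avg M (\<lambda>\<epsilon>. exp (- (\<kappa> * Y \<epsilon>)))"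
    unfolding avg_cmult[symmetric] by (simp add: right_diff_distrib flip: exp_add)
  ultimately show ?thesis by (simp add: Y_def)
qed

lemma avg_Max_lower_deviation:
  assumes I: "finite I" and m: "0 < ln (card I)"
    and H: "\<And>l. l \<in> I \<Longrightarrow> finite (H l)" "\<And>l. l \<in> I \<Longrightarrow> t l \<in> H l"
    and \<sigma>: "\<And>l s. l \<in> I \<Longrightarrow> s \<in> H l \<Longrightarrow> ed M s (t l) \<le> \<sigma>" and \<sigma>0: "0 < \<sigma>"
  shows "avg M (\<lambda>\<epsilon>. Max ((\<lambda>l. bw M (H l) - Max ((\<lambda>s. ip M \<epsilon> (\<lambda>i. s i - t l i)) ` H l)) ` I))
     \<le> 4 * \<sigma> * sqrt (ln (card I))"
proof -
  define m where "m = real (card I)"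
  have lnm: "0 < ln m" using m by (simp add: m_def)
  have m0: "0 < m" using m unfolding m_def by (cases "card I = 0") auto
  have ne: "I \<noteq> {}" using m0 unfolding m_def by auto
  define V where "V \<epsilon> l = bw M (H l) - Max ((\<lambda>s. ip M \<epsilon> (\<lambda>i. s i - t l i)) ` H l)" for \<epsilon> l
  define mx where "mx \<epsilon> = Max (V \<epsilon> ` I)" for \<epsilon>
  \<comment> \<open>This value minimizes \<open>(ln m + 4 \<kappa>\<^sup>2 \<sigma>\<^sup>2) / \<kappa>\<close>.\<close>
  define \<kappa> where "\<kappa> = sqrt (ln m) / (2 * \<sigma>)"
  have \<kappa>: "0 < \<kappa>" unfolding \<kappa>_def using lnm \<sigma>0 by simp
  have "exp (\<kappa> * avg M mx) \<le> avg M (\<lambda>\<epsilon>. exp (\<kappa> * mx \<epsilon>))"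
    using avg_exp_ge[of M "\<lambda>\<epsilon>. \<kappa> * mx \<epsilon>"] by (simp add: avg_cmult)
  also have "\<dots> \<le> avg M (\<lambda>\<epsilon>. \<Sum>l\<in>I. exp (\<kappa> * V \<epsilon> l))"
  proof (rule avg_mono)
    fix \<epsilon>
    have "mx \<epsilon> \<in> V \<epsilon> ` I" unfolding mx_def using I ne by (intro Max_in) auto
    then obtain l where l: "l \<in> I" "mx \<epsilon> = V \<epsilon> l" by auto
    then show "exp (\<kappa> * mx \<epsilon>) \<le> (\<Sum>l\<in>I. exp (\<kappa> * V \<epsilon> l))"
      using I by (auto intro!: member_le_sum)
  qed
  also have "\<dots> \<le> (\<Sum>l\<in>I. exp (4 * \<kappa>\<^sup>2 * \<sigma>\<^sup>2))"
    unfolding avg_sum V_def using H \<sigma> \<kappa> by (intro sum_mono Max_ip_lower_deviation) auto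
  also have "\<dots> = exp (ln m + 4 * \<kappa>\<^sup>2 * \<sigma>\<^sup>2)"
    using m0 by (simp add: m_def exp_add)
  finally have "\<kappa> * avg M mx \<le> ln m + 4 * \<kappa>\<^sup>2 * \<sigma>\<^sup>2" by simp
  also have "\<dots> = \<kappa> * (4 * \<sigma> * sqrt (ln m))"
  proof -
    have "4 * \<kappa>\<^sup>2 * \<sigma>\<^sup>2 = ln m" "\<kappa> * (4 * \<sigma> * sqrt (ln m)) = 2 * ln m"
      unfolding \<kappa>_def using \<sigma>0 lnm by (auto simp: power_divide power_mult_distrib)
    then show ?thesis by simp
  qed
  finally show ?thesis using \<kappa> unfolding mx_def V_def m_def by (simp only: mult_le_cancel_left_pos)
qed

section \<open>Growth of expected suprema\<close>

text \<open>
  Half of \<open>exp (-4) / 16\<close>, the constant of \<open>Sudakov_minoration\<close>. The other half absorbs the fluctuations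
  of the suprema over the small sets, and \<open>ratio\<close> is chosen such that \<open>4 / ratio\<close> equals this half.
\<close>

definition gain :: real where "gain = exp (-4) / 32"

definition ratio :: real where "ratio = 128 * exp 4"

lemma gain_pos: "0 < gain" by (simp add: gain_def)

lemma ratio_ge: "128 \<le> ratio"
  using one_le_exp_iff[of "4::real"] by (simp add: ratio_def)

lemma ratio_gain: "4 / ratio = gain"
  by (simp add: ratio_def gain_def exp_minus field_simps)

text \<open>
  The supremum over \<open>A\<close> is at least the maximum over \<open>l\<close> of the value at \<open>t l\<close> plus the supremum over
  \<open>H l\<close> relative to \<open>t l\<close>. Sudakov's minoration bounds the first part, and the relative suprema fall
  below their means by little because the sets \<open>H l\<close> have small radius. Since \<open>bw M A \<le> 2\<close>, the width \<open>w\<close>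
  of order \<open>a\<^sup>2\<close> is already at most \<open>a / sqrt (ln (card I))\<close>: otherwise the minoration with \<open>\<beta> = 1 / w\<close>
  would contradict \<open>bw M A \<le> 2\<close>.
\<close>

lemma bw_growth:
  assumes I: "finite I" and lnm: "4 \<le> ln (card I)"
    and a: "0 < a" and w: "0 < w" "w \<le> gain / 2 * a\<^sup>2"
    and A: "finite A" "bw M A \<le> 2"
    and H: "\<And>l. l \<in> I \<Longrightarrow> H l \<subseteq> A" "\<And>l. l \<in> I \<Longrightarrow> t l \<in> H l"
    and small: "\<And>l s. l \<in> I \<Longrightarrow> s \<in> H l \<Longrightarrow> ed M s (t l) \<le> a / ratio"
    and sep: "\<And>l k. l \<in> I \<Longrightarrow> k \<in> I \<Longrightarrow> l \<noteq> k \<Longrightarrow> a \<le> ed M (t l) (t k)"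
    and bd: "\<And>l i. l \<in> I \<Longrightarrow> i < M \<Longrightarrow> \<bar>t l i - y i\<bar> \<le> w"
    and h: "\<And>l. l \<in> I \<Longrightarrow> h \<le> bw M (H l)"
  shows "gain * a * sqrt (ln (card I)) + h \<le> bw M A"
proof -
  define L where "L = ln (real (card I))"
  have L: "4 \<le> L" using lnm by (simp add: L_def)
  have ne: "I \<noteq> {}" using lnm by auto
  have tA: "t l \<in> A" if "l \<in> I" for l using H that by blast
  define MX where "MX = avg M (\<lambda>\<epsilon>. Max ((\<lambda>l. ip M \<epsilon> (t l)) ` I))"
  have MXA: "MX \<le> bw M A"
    unfolding MX_def bw_def by (intro avg_mono Max_mono) (use A ne tA in auto)
  have sud: "2 * gain * \<beta> * a\<^sup>2 \<le> MX" if \<beta>: "0 < \<beta>" "\<beta>\<^sup>2 * a\<^sup>2 \<le> L" "\<beta> * w \<le> 1" for \<beta>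
  proof -
    have "exp (-4) / 16 * \<beta> * a\<^sup>2 \<le> avg M (\<lambda>\<epsilon>. Max ((\<lambda>l. ip M \<epsilon> (\<lambda>i. t l i - y i)) ` I))"
    proof (rule Sudakov_minoration[OF I lnm \<beta>(1)])
      fix l i assume li: "l \<in> I" "i < M"
      have "\<bar>\<beta> * (t l i - y i)\<bar> \<le> \<beta> * w" using bd[OF li] \<beta> by (simp add: abs_mult)
      then show "\<bar>\<beta> * (t l i - y i)\<bar> \<le> 1" using \<beta> by linarith
    next
      fix l k assume "l \<in> I" "k \<in> I" "l \<noteq> k"
      then show "a \<le> ed M (\<lambda>i. t l i - y i) (\<lambda>i. t k i - y i)" using sep by (simp add: ed_def)
    qed (use \<beta> a in \<open>auto simp: L_def\<close>)
    also have "\<dots> \<le> avg M (\<lambda>\<epsilon>. Max ((\<lambda>l. ip M \<epsilon> (t l)) ` I) - ip M \<epsilon> y)"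
    proof (rule avg_mono)
      fix \<epsilon>
      show "Max ((\<lambda>l. ip M \<epsilon> (\<lambda>i. t l i - y i)) ` I) \<le> Max ((\<lambda>l. ip M \<epsilon> (t l)) ` I) - ip M \<epsilon> y"
        using I ne by (intro Max.boundedI) (auto simp: ip_diff)
    qed
    also have "\<dots> = MX" by (simp add: avg_diff MX_def)
    finally show ?thesis by (simp add: gain_def)
  qed
  have aw: "sqrt L * w \<le> a"
  proof (rule ccontr)
    assume "\<not> sqrt L * w \<le> a"
    then have "a / w \<le> sqrt L" using w by (simp add: divide_le_eq)
    then have "(a / w)\<^sup>2 \<le> L" using a w L power_mono[of "a / w" "sqrt L" 2] by simp
    then have "2 * gain * (1 / w) * a\<^sup>2 \<le> MX" using w by (intro sud) (auto simp: power_divide)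
    moreover have "4 \<le> 2 * gain * (1 / w) * a\<^sup>2"
      using w by (simp add: field_simps)
    ultimately show False using MXA A by linarith
  qed
  have "2 * gain * (sqrt L / a) * a\<^sup>2 \<le> MX"
    using a w L aw by (intro sud) (auto simp: power_divide divide_le_eq)
  then have 1: "2 * gain * a * sqrt L \<le> MX" using a by (simp add: power2_eq_square mult_ac)
  define V where "V \<epsilon> = Max ((\<lambda>l. bw M (H l) - Max ((\<lambda>s. ip M \<epsilon> (\<lambda>i. s i - t l i)) ` H l)) ` I)" for \<epsilon>
  have finH: "finite (H l)" if "l \<in> I" for l using H(1)[OF that] A(1) by (rule finite_subset)
  have "avg M V \<le> 4 * (a / ratio) * sqrt L"
    unfolding V_def L_def
    by (rule avg_Max_lower_deviation) (use I lnm finH H small a ratio_ge in auto)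
  also have "4 * (a / ratio) * sqrt L = gain * a * sqrt L" unfolding ratio_gain[symmetric] by simp
  finally have 2: "avg M V \<le> gain * a * sqrt L" .
  have "avg M (\<lambda>\<epsilon>. Max ((\<lambda>l. ip M \<epsilon> (t l)) ` I) + h - V \<epsilon>) \<le> bw M A"
    unfolding bw_def
  proof (rule avg_mono)
    fix \<epsilon>
    have "Max ((\<lambda>l. ip M \<epsilon> (t l)) ` I) \<in> (\<lambda>l. ip M \<epsilon> (t l)) ` I" using I ne by (intro Max_in) auto
    then obtain l where l: "l \<in> I" "Max ((\<lambda>l. ip M \<epsilon> (t l)) ` I) = ip M \<epsilon> (t l)" by auto
    let ?Y = "(\<lambda>s. ip M \<epsilon> (\<lambda>i. s i - t l i)) ` H l"
    have "Max ?Y \<in> ?Y" using finH[OF l(1)] H(2)[OF l(1)] by (intro Max_in) auto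
    then obtain s where s: "s \<in> H l" "Max ?Y = ip M \<epsilon> s - ip M \<epsilon> (t l)" by (auto simp: ip_diff)
    have "bw M (H l) - Max ?Y \<le> V \<epsilon>" unfolding V_def using I l(1) by (intro Max_ge) auto
    moreover have "ip M \<epsilon> s \<le> Max (ip M \<epsilon> ` A)" using A H(1)[OF l(1)] s(1) by (intro Max_ge) auto
    ultimately show "Max ((\<lambda>l. ip M \<epsilon> (t l)) ` I) + h - V \<epsilon> \<le> Max (ip M \<epsilon> ` A)"
      using h[OF l(1)] l(2) s(2) by linarith
  qed
  then have "MX + h - avg M V \<le> bw M A" by (simp add: avg_diff avg_add MX_def)
  then show ?thesis using 1 2 unfolding L_def by linarith
qed

section \<open>Greedy partitions\<close>

text \<open>
  The part of \<open>sqrt (ln (k + 1))\<close> that counts. Subtracting \<open>2\<close> makes it vanish where \<open>ln (k + 1) < 4\<close>, which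
  is outside the range of \<open>bw_growth\<close>.
\<close>

definition excess :: "nat \<Rightarrow> real" where "excess k = max 0 (sqrt (ln (real (k + 1))) - 2)"

text \<open>
  Let \<open>R k\<close> be what is left before the step \<open>k\<close>. The centre \<open>t k\<close> maximizes the expected supremum over the
  small neighbourhoods of points within \<open>R k\<close>, and the piece \<open>P k\<close> is the ball of radius \<open>a\<close> around it in
  \<open>R k\<close>. The sets \<open>R k\<close> decrease, so the neighbourhoods of \<open>t 0, \<dots>, t k\<close> all have an expected supremum at
  least as large as any neighbourhood inside \<open>P k\<close>, and the growth inequality applies to these \<open>k + 1\<close>
  separated points.
\<close>

lemma greedy_partition:
  assumes A: "finite A" "A \<noteq> {}" "bw M A \<le> 2"
    and a: "0 < a" and w: "0 < w" "w \<le> gain / 2 * a\<^sup>2"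
    and bd: "\<forall>t\<in>A. \<forall>i<M. \<bar>t i - y i\<bar> \<le> w"
  obtains K :: nat and t :: "nat \<Rightarrow> nat \<Rightarrow> real" and P :: "nat \<Rightarrow> (nat \<Rightarrow> real) set"
  where "0 < K" "A = (\<Union>k<K. P k)" "\<And>k l. k < K \<Longrightarrow> l < K \<Longrightarrow> k \<noteq> l \<Longrightarrow> P k \<inter> P l = {}"
    "\<And>k. k < K \<Longrightarrow> t k \<in> P k" "\<And>k s. k < K \<Longrightarrow> s \<in> P k \<Longrightarrow> ed M s (t k) \<le> a"
    "\<And>k s. k < K \<Longrightarrow> s \<in> P k \<Longrightarrow>
       bw M {z \<in> P k. ed M z s \<le> a / ratio} \<le> bw M A - gain * a * excess k"
proof -
  define nb where "nb D s = {z \<in> D. ed M z s \<le> a / ratio}" for D s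
  define sel where "sel D = (SOME t. t \<in> D \<and> (\<forall>s\<in>D. bw M (nb D s) \<le> bw M (nb D t)))" for D
  have r0: "0 \<le> a / ratio" using a ratio_ge by simp
  have sel: "sel D \<in> D \<and> (\<forall>s\<in>D. bw M (nb D s) \<le> bw M (nb D (sel D)))" if D: "finite D" "D \<noteq> {}" for D
  proof -
    have "Max ((\<lambda>s. bw M (nb D s)) ` D) \<in> (\<lambda>s. bw M (nb D s)) ` D" using D by (intro Max_in) auto
    then obtain u where "u \<in> D" "Max ((\<lambda>s. bw M (nb D s)) ` D) = bw M (nb D u)" by auto
    moreover have "bw M (nb D s) \<le> Max ((\<lambda>s. bw M (nb D s)) ` D)" if "s \<in> D" for s using D that by auto
    ultimately have "\<exists>t. t \<in> D \<and> (\<forall>s\<in>D. bw M (nb D s) \<le> bw M (nb D t))" by metis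
    then show ?thesis unfolding sel_def by (rule someI_ex)
  qed
  define R where "R = rec_nat A (\<lambda>_ D. {z \<in> D. \<not> ed M z (sel D) \<le> a})"
  have R0: "R 0 = A" and RS: "R (Suc k) = {z \<in> R k. \<not> ed M z (sel (R k)) \<le> a}" for k
    by (auto simp: R_def)
  have Rdec: "R l \<subseteq> R k" if "k \<le> l" for k l
    using that by (induction l rule: dec_induct) (auto simp: RS)
  have RA: "R k \<subseteq> A" for k using Rdec[of 0 k] R0 by simp
  have finR: "finite (R k)" for k using RA A(1) by (rule finite_subset)
  have "card (R k) + k \<le> card A \<or> R k = {}" for k
  proof (induction k)
    case (Suc k)
    show ?case
    proof (cases "R k = {}")
      case False
      have "sel (R k) \<notin> R (Suc k)" using a by (simp add: RS)
      then have "R (Suc k) \<subset> R k" using sel[OF finR False] Rdec[of k "Suc k"] by auto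
      then have "card (R (Suc k)) < card (R k)" by (intro psubset_card_mono finR)
      then show ?thesis using Suc False by auto
    qed (simp add: RS)
  qed (simp add: R0)
  from this[of "Suc (card A)"] have ex: "R (Suc (card A)) = {}" by auto
  define K where "K = (LEAST k. R k = {})"
  have RK: "R K = {}" unfolding K_def using ex by (rule LeastI)
  have Rne: "R k \<noteq> {}" if "k < K" for k using that not_less_Least unfolding K_def by blast
  have K0: "0 < K" using RK A(2) R0 by (cases K) auto
  define t where "t k = sel (R k)" for k
  define P where "P k = {z \<in> R k. ed M z (t k) \<le> a}" for k
  have tR: "t k \<in> R k" if "k < K" for k using sel[OF finR Rne[OF that]] by (simp add: t_def)
  have tmax: "bw M (nb (R k) s) \<le> bw M (nb (R k) (t k))" if "k < K" "s \<in> R k" for k s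
    using sel[OF finR Rne[OF that(1)]] that(2) by (simp add: t_def)
  have far: "a < ed M z (t k)" if "z \<in> R l" "k < l" for z k l
    using Rdec[of "Suc k" l] that by (auto simp: RS t_def)
  have cover: "z \<in> R n \<or> (\<exists>k<n. z \<in> P k)" if "z \<in> A" for z n
  proof (induction n)
    case (Suc n)
    then show ?case by (auto simp: RS P_def t_def less_Suc_eq)
  qed (simp add: R0 that)
  show ?thesis
  proof (rule that[of K P t])
    show "A = (\<Union>k<K. P k)"
    proof
      show "A \<subseteq> (\<Union>k<K. P k)" using cover[of _ K] RK by blast
      show "(\<Union>k<K. P k) \<subseteq> A" using RA by (auto simp: P_def)
    qed
    have "P k \<inter> P l = {}" if "k < l" for k l
      using far[OF _ that] by (fastforce simp: P_def)
    then show "P k \<inter> P l = {}" if "k \<noteq> l" for k l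
      using that by (metis inf_commute linorder_neqE_nat)
    show "t k \<in> P k" if "k < K" for k using tR[OF that] a by (simp add: P_def)
    fix k s assume k: "k < K" and s: "s \<in> P k"
    show "ed M s (t k) \<le> a" using s by (simp add: P_def)
    have sR: "s \<in> R k" using s by (simp add: P_def)
    have "s \<in> {z \<in> P k. ed M z s \<le> a / ratio}" using s r0 by simp
    then have le: "bw M {z \<in> P k. ed M z s \<le> a / ratio} \<le> bw M (nb (R k) s)"
      using finR[of k] by (intro bw_mono) (auto simp: nb_def P_def)
    show "bw M {z \<in> P k. ed M z s \<le> a / ratio} \<le> bw M A - gain * a * excess k"
    proof (cases "4 \<le> ln (real (k + 1))")
      case False
      have "sqrt (ln (real (k + 1))) \<le> sqrt 4" using False by (intro real_sqrt_le_mono) simp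
      then have "excess k = 0" by (simp add: excess_def)
      moreover have "bw M (nb (R k) s) \<le> bw M A"
        using sR RA r0 A(1) by (intro bw_mono) (auto simp: nb_def)
      ultimately show ?thesis using le by simp
    next
      case True
      have "gain * a * sqrt (ln (card {..k})) + bw M (nb (R k) (t k)) \<le> bw M A"
      proof (rule bw_growth[where H = "\<lambda>l. nb (R l) (t l)" and t = t and y = y and w = w])
        fix l assume l: "l \<in> {..k}"
        then have lK: "l < K" "l \<le> k" using k by auto
        show "nb (R l) (t l) \<subseteq> A" using RA by (auto simp: nb_def)
        show "t l \<in> nb (R l) (t l)" using tR[OF lK(1)] r0 by (simp add: nb_def)
        show "\<bar>t l i - y i\<bar> \<le> w" if "i < M" for i using bd tR[OF lK(1)] RA that by blast
        show "ed M s (t l) \<le> a / ratio" if "s \<in> nb (R l) (t l)" for s using that by (simp add: nb_def)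
        show "a \<le> ed M (t l) (t j)" if "j \<in> {..k}" "l \<noteq> j" for j
        proof -
          have "j < K" using that k by auto
          then show ?thesis using that(2) far[OF tR[OF lK(1)], of j] far[OF tR[of j], of l]
            by (cases "l < j") (auto simp: ed_commute)
        qed
        have tk: "t k \<in> R l" using tR[OF k] Rdec[OF lK(2)] by auto
        have "bw M (nb (R k) (t k)) \<le> bw M (nb (R l) (t k))"
          using Rdec[OF lK(2)] finR[of l] tR[OF k] r0 by (intro bw_mono) (auto simp: nb_def)
        also have "\<dots> \<le> bw M (nb (R l) (t l))" by (rule tmax[OF lK(1) tk])
        finally show "bw M (nb (R k) (t k)) \<le> bw M (nb (R l) (t l))" .
      qed (use True a w A in \<open>auto simp: add.commute\<close>)
      then have *: "gain * a * sqrt (ln (real (k + 1))) + bw M (nb (R k) (t k)) \<le> bw M A"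
        by (simp add: add.commute)
      have "excess k \<le> sqrt (ln (real (k + 1)))" by (simp add: excess_def)
      then have "gain * a * excess k \<le> gain * a * sqrt (ln (real (k + 1)))"
        using gain_pos a by (intro mult_left_mono) auto
      then show ?thesis using * le tmax[OF k sR] by linarith
    qed
  qed (rule K0)
qed

section \<open>Truncation\<close>

definition trunc :: "(nat \<Rightarrow> real) \<Rightarrow> real \<Rightarrow> (nat \<Rightarrow> real) \<Rightarrow> nat \<Rightarrow> real" where
  "trunc x w t = (\<lambda>i. x i + max (- w) (min w (t i - x i)))"

lemma trunc_lipschitz: "\<bar>trunc x w s i - trunc x w t i\<bar> \<le> \<bar>s i - t i\<bar>"
  by (auto simp: trunc_def abs_if min_def max_def)

lemma trunc_bounded: "0 \<le> w \<Longrightarrow> \<bar>trunc x w t i - x i\<bar> \<le> w"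
  by (auto simp: trunc_def abs_if min_def max_def)

lemma trunc_center: "0 \<le> w \<Longrightarrow> trunc x w x = x"
  by (auto simp: trunc_def)

lemma trunc_RM: "0 \<le> w \<Longrightarrow> x \<in> RM M \<Longrightarrow> t \<in> RM M \<Longrightarrow> trunc x w t \<in> RM M"
  by (auto simp: trunc_def RM_def)

lemma ed_trunc: "ed M (trunc x w s) (trunc x w t) \<le> ed M s t"
  unfolding ed_def L2_set_def
  by (intro real_sqrt_le_mono sum_mono) (metis power2_abs power_mono abs_ge_zero trunc_lipschitz)

definition lp_le :: "nat \<Rightarrow> real \<Rightarrow> real \<Rightarrow> (nat \<Rightarrow> real) \<Rightarrow> bool" where
  "lp_le M p s v \<longleftrightarrow> (\<Sum>i<M. \<bar>v i\<bar> powr p) \<le> s powr p"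

lemma powr_convex_combination:
  fixes a b p \<theta> :: real
  assumes p: "1 \<le> p" and ab: "0 \<le> a" "0 \<le> b" and \<theta>: "0 < \<theta>" "\<theta> < 1"
  shows "((1 - \<theta>) * a + \<theta> * b) powr p \<le> (1 - \<theta>) * a powr p + \<theta> * b powr p"
proof -
  have *: "(c * x) powr p \<le> c * x powr p" if "0 < c" "c < 1" "0 \<le> x" for c x :: real
  proof -
    have "c powr p \<le> c powr 1" using that p by (intro powr_mono') auto
    then show ?thesis using that by (simp add: powr_mult mult_right_mono)
  qed
  consider "a = 0" | "b = 0" | "0 < a" "0 < b" using ab by fastforce
  then show ?thesis
  proof cases
    case 1 then show ?thesis using * \<theta> ab p by simp
  next
    case 2 then show ?thesis using *[of "1 - \<theta>" a] \<theta> ab p by simp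
  next
    case 3
    have "convex_on {0<..} (\<lambda>x::real. x powr p)" by (rule powr_convex[OF p])
    then show ?thesis using 3 \<theta> unfolding convex_on_def by (auto dest!: bspec[of _ _ a] bspec[of _ _ b])
  qed
qed

text \<open>
  Minkowski's inequality: \<open>(u + v) / (s + s')\<close> is a convex combination of \<open>u / s\<close> and \<open>v / s'\<close>.
\<close>

lemma lp_le_add:
  assumes p: "1 \<le> p" and s: "0 < s" "0 < s'" and u: "lp_le M p s u" and v: "lp_le M p s' v"
  shows "lp_le M p (s + s') (\<lambda>i. u i + v i)"
proof -
  define \<theta> where "\<theta> = s' / (s + s')"
  have \<theta>: "0 < \<theta>" "\<theta> < 1" "1 - \<theta> = s / (s + s')" using s by (auto simp: \<theta>_def field_simps)
  have "(\<Sum>i<M. \<bar>u i + v i\<bar> powr p) \<le>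
      (\<Sum>i<M. (s + s') powr p * ((1 - \<theta>) * (\<bar>u i\<bar> powr p / s powr p) + \<theta> * (\<bar>v i\<bar> powr p / s' powr p)))"
  proof (rule sum_mono)
    fix i
    have "\<bar>u i + v i\<bar> \<le> (s + s') * ((1 - \<theta>) * (\<bar>u i\<bar> / s) + \<theta> * (\<bar>v i\<bar> / s'))"
    proof -
      have "(s + s') * (1 - \<theta>) = s" "(s + s') * \<theta> = s'" unfolding \<theta>(3) using s by (auto simp: \<theta>_def)
      then have "(s + s') * ((1 - \<theta>) * (\<bar>u i\<bar> / s) + \<theta> * (\<bar>v i\<bar> / s')) = s * (\<bar>u i\<bar> / s) + s' * (\<bar>v i\<bar> / s')"
        by (simp only: distrib_left mult.assoc[symmetric])
      then show ?thesis using s by simp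
    qed
    then have "\<bar>u i + v i\<bar> powr p \<le> ((s + s') * ((1 - \<theta>) * (\<bar>u i\<bar> / s) + \<theta> * (\<bar>v i\<bar> / s'))) powr p"
      using p by (intro powr_mono2) auto
    also have "\<dots> = (s + s') powr p * ((1 - \<theta>) * (\<bar>u i\<bar> / s) + \<theta> * (\<bar>v i\<bar> / s')) powr p"
      by (rule powr_mult) 
    also have "\<dots> \<le> (s + s') powr p * ((1 - \<theta>) * (\<bar>u i\<bar> / s) powr p + \<theta> * (\<bar>v i\<bar> / s') powr p)"
      using powr_convex_combination[OF p _ _ \<theta>(1,2), of "\<bar>u i\<bar> / s" "\<bar>v i\<bar> / s'"] s
      by (intro mult_left_mono) auto
    finally show "\<bar>u i + v i\<bar> powr p \<le> (s + s') powr p * ((1 - \<theta>) * (\<bar>u i\<bar> powr p / s powr p) + \<theta> * (\<bar>v i\<bar> powr p / s' powr p))"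
      using s by (simp add: powr_divide)
  qed
  also have "\<dots> = (s + s') powr p * ((1 - \<theta>) * ((\<Sum>i<M. \<bar>u i\<bar> powr p) / s powr p) + \<theta> * ((\<Sum>i<M. \<bar>v i\<bar> powr p) / s' powr p))"
    by (simp add: sum.distrib flip: sum_distrib_left sum_divide_distrib)
  also have "\<dots> \<le> (s + s') powr p * ((1 - \<theta>) * 1 + \<theta> * 1)"
    using u v \<theta> s unfolding lp_le_def
    by (intro mult_left_mono add_mono) auto
  finally show ?thesis by (simp add: lp_le_def)
qed

lemma lp_le_mono: "0 \<le> p \<Longrightarrow> 0 \<le> s \<Longrightarrow> s \<le> s' \<Longrightarrow> lp_le M p s v \<Longrightarrow> lp_le M p s' v"
  unfolding lp_le_def by (meson order_trans powr_mono2)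

text \<open>
  Where truncation changes a coordinate, \<open>\<bar>t i - x i\<bar> > w\<close>, so that \<open>\<bar>t i - x i\<bar>\<^sup>p\<close> is at most
  \<open>w\<^sup>p\<^sup>-\<^sup>2 (t i - x i)\<^sup>2\<close> because of \<open>p \<le> 2\<close>.
\<close>

lemma trunc_error:
  assumes w: "0 < w" and p: "0 < p" "p \<le> 2" and d: "ed M t x \<le> d"
    and s: "w powr (p - 2) * d\<^sup>2 \<le> s powr p"
  shows "lp_le M p s (\<lambda>i. t i - trunc x w t i)"
proof -
  have "(\<Sum>i<M. \<bar>t i - trunc x w t i\<bar> powr p) \<le> (\<Sum>i<M. w powr (p - 2) * (t i - x i)\<^sup>2)"
  proof (rule sum_mono)
    fix i
    define e where "e = \<bar>t i - x i\<bar>"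
    show "\<bar>t i - trunc x w t i\<bar> powr p \<le> w powr (p - 2) * (t i - x i)\<^sup>2"
    proof (cases "e \<le> w")
      case True
      then have "trunc x w t i = t i" by (auto simp: trunc_def e_def abs_le_iff max_def min_def)
      then show ?thesis by simp
    next
      case False
      then have "\<bar>t i - trunc x w t i\<bar> \<le> e" using w
        by (auto simp: trunc_def e_def abs_if max_def min_def split: if_splits)
      then have "\<bar>t i - trunc x w t i\<bar> powr p \<le> e powr p" using p by (intro powr_mono2) auto
      also have "e powr p = e powr (p - 2) * e powr 2" by (simp flip: powr_add)
      also have "\<dots> \<le> w powr (p - 2) * e powr 2"
        using False w p by (intro mult_right_mono powr_mono2') auto
      also have "e powr 2 = (t i - x i)\<^sup>2" using False w by (simp add: e_def)
      finally show ?thesis .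
    qed
  qed
  also have "\<dots> = w powr (p - 2) * (ed M t x)\<^sup>2" by (simp add: ed_sq sum_distrib_left)
  also have "\<dots> \<le> w powr (p - 2) * d\<^sup>2" using d by (intro mult_left_mono power_mono) auto
  finally show ?thesis using s by (simp add: lp_le_def)
qed

section \<open>Majorizing measure integrals\<close>

text \<open>
  A measurable majorant of the integrand replaces the integrand, so that no measurability of
  \<open>\<epsilon> \<mapsto> \<mu>(B(u, \<epsilon>))\<close> has to be tracked through the recursion.
\<close>

definition entropy_integral_le :: "nat \<Rightarrow> (nat \<Rightarrow> real) pmf \<Rightarrow> (nat \<Rightarrow> real) \<Rightarrow> real \<Rightarrow> bool" where
  "entropy_integral_le M \<mu> u C \<longleftrightarrow> (\<exists>G\<in>borel_measurable borel.
     (\<forall>\<epsilon>\<ge>0. sqrt_log_inv (measure_pmf.prob \<mu> {y. ed M u y \<le> \<epsilon>}) \<le> G \<epsilon>) \<and>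
     (\<integral>\<^sup>+\<epsilon>. G \<epsilon> \<partial>lborel) \<le> ennreal C)"

lemma sqrt_log_inv_1 [simp]: "sqrt_log_inv 1 = 0"
  by (simp add: sqrt_log_inv_def)

lemma sqrt_log_inv_mult:
  assumes w: "0 < w" "w \<le> 1" and m: "0 \<le> m" "m \<le> 1" and a: "w * m \<le> a" "a \<le> 1"
  shows "sqrt_log_inv a \<le> ennreal (sqrt (ln (1 / w))) + sqrt_log_inv m"
proof (cases "m = 0")
  case True then show ?thesis by (simp add: sqrt_log_inv_def)
next
  case False
  then have m0: "0 < m" using m by simp
  then have a0: "0 < a" using a w by (smt (verit) mult_pos_pos)
  have "ln (1 / a) \<le> ln (1 / (w * m))"
    using a a0 w m0 by (subst ln_le_cancel_iff) (auto intro: divide_left_mono)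
  also have "\<dots> = ln (1 / w) + ln (1 / m)" using w m0 by (simp add: ln_div ln_mult)
  finally have "sqrt (ln (1 / a)) \<le> sqrt (ln (1 / w) + ln (1 / m))" by simp
  also have "\<dots> \<le> sqrt (ln (1 / w)) + sqrt (ln (1 / m))"
    using w m m0 by (intro sqrt_add_le_add_sqrt) auto
  finally have "ennreal (sqrt (ln (1 / a))) \<le> ennreal (sqrt (ln (1 / w)) + sqrt (ln (1 / m)))"
    by (rule ennreal_leI)
  also have "\<dots> = ennreal (sqrt (ln (1 / w))) + ennreal (sqrt (ln (1 / m)))"
    using w m m0 by (intro ennreal_plus) auto
  finally show ?thesis using a0 m0 by (simp add: sqrt_log_inv_def)
qed

lemma entropy_integral_le_return: "0 \<le> C \<Longrightarrow> entropy_integral_le M (return_pmf u) u C"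
  unfolding entropy_integral_le_def by (rule bexI[of _ "\<lambda>_. 0"]) auto

lemma entropy_integral_le_mono: "entropy_integral_le M \<mu> u C \<Longrightarrow> C \<le> C' \<Longrightarrow> entropy_integral_le M \<mu> u C'"
  unfolding entropy_integral_le_def by (meson ennreal_leI order_trans)

lemma prob_bind_pmf_ge:
  "pmf N k * measure_pmf.prob (f k) B \<le> measure_pmf.prob (bind_pmf N f) B"
proof -
  have "pmf N k * measure_pmf.prob (f k) B = measure_pmf.expectation N (\<lambda>x. indicator {k} x * measure_pmf.prob (f x) B)"
    by (subst integral_measure_pmf[where A = "{k}"]) (auto simp: indicator_def split: if_splits)
  also have "\<dots> \<le> measure_pmf.expectation N (\<lambda>x. measure_pmf.prob (f x) B)"
    by (intro integral_mono measure_pmf.integrable_const_bound[where B = 1])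
       (auto simp: indicator_def intro!: AE_I2)
  also have "\<dots> = measure_pmf.prob (bind_pmf N f) B"
    unfolding measure_pmf_bind
    by (subst measure_pmf.measure_bind[where N = "count_space UNIV"])
       (auto simp: measure_pmf_in_subprob_algebra)
  finally show ?thesis .
qed

text \<open>
  Radii above \<open>D\<close> contribute nothing as the ball contains the whole support. Below \<open>D\<close> the component \<open>f k\<close>
  gives mass at least \<open>w\<close> times its own, and the square root is subadditive.
\<close>

lemma entropy_integral_le_bind:
  assumes k: "w \<le> pmf N k" "0 < w" and D: "0 \<le> D"
    and supp: "\<And>y. y \<in> set_pmf (bind_pmf N f) \<Longrightarrow> ed M u y \<le> D"
    and C: "0 \<le> C" "entropy_integral_le M (f k) u C"
  shows "entropy_integral_le M (bind_pmf N f) u (D * sqrt (ln (1 / w)) + C)"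
proof -
  obtain G where G: "G \<in> borel_measurable borel"
    "\<And>\<epsilon>. 0 \<le> \<epsilon> \<Longrightarrow> sqrt_log_inv (measure_pmf.prob (f k) {y. ed M u y \<le> \<epsilon>}) \<le> G \<epsilon>"
    "(\<integral>\<^sup>+\<epsilon>. G \<epsilon> \<partial>lborel) \<le> ennreal C"
    using C(2) unfolding entropy_integral_le_def by auto
  have w1: "w \<le> 1" using k pmf_le_1[of N k] by linarith
  let ?c = "ennreal (sqrt (ln (1 / w)))"
  define G' where "G' \<epsilon> = ?c * indicator {0..D} \<epsilon> + G \<epsilon>" for \<epsilon>
  have "G' \<in> borel_measurable borel" unfolding G'_def using G(1) by measurable
  moreover have "sqrt_log_inv (measure_pmf.prob (bind_pmf N f) {y. ed M u y \<le> \<epsilon>}) \<le> G' \<epsilon>" if \<epsilon>: "0 \<le> \<epsilon>" for \<epsilon>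
  proof (cases "\<epsilon> \<le> D")
    case True
    have "w * measure_pmf.prob (f k) {y. ed M u y \<le> \<epsilon>} \<le> measure_pmf.prob (bind_pmf N f) {y. ed M u y \<le> \<epsilon>}"
      using k by (intro order_trans[OF _ prob_bind_pmf_ge[of N k]] mult_right_mono) auto
    then have "sqrt_log_inv (measure_pmf.prob (bind_pmf N f) {y. ed M u y \<le> \<epsilon>})
       \<le> ?c + sqrt_log_inv (measure_pmf.prob (f k) {y. ed M u y \<le> \<epsilon>})"
      using k w1 by (intro sqrt_log_inv_mult) auto
    also have "\<dots> \<le> ?c + G \<epsilon>" using G(2)[OF \<epsilon>] by (intro add_left_mono)
    finally show ?thesis using True \<epsilon> by (simp add: G'_def)
  next
    case False
    have "measure_pmf.prob (bind_pmf N f) {y. ed M u y \<le> \<epsilon>} = 1"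
      using supp False by (subst measure_pmf.prob_eq_1) (force simp: AE_measure_pmf_iff)+
    then show ?thesis by simp
  qed
  moreover have "(\<integral>\<^sup>+\<epsilon>. G' \<epsilon> \<partial>lborel) \<le> ennreal (D * sqrt (ln (1 / w)) + C)"
  proof -
    have "(\<integral>\<^sup>+\<epsilon>. G' \<epsilon> \<partial>lborel) = ?c * ennreal D + (\<integral>\<^sup>+\<epsilon>. G \<epsilon> \<partial>lborel)"
      unfolding G'_def using G(1) D by (subst nn_integral_add) (auto simp: nn_integral_cmult_indicator)
    also have "\<dots> \<le> ?c * ennreal D + ennreal C" using G(3) by (rule add_left_mono)
    also have "\<dots> = ennreal (D * sqrt (ln (1 / w)) + C)"
      using D C k w1 by (simp add: ennreal_plus ennreal_mult mult.commute)
    finally show ?thesis .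
  qed
  ultimately show ?thesis unfolding entropy_integral_le_def by blast
qed

text \<open>
  The sum of \<open>1 / ((k + 1) (k + 2))\<close> over \<open>k < K\<close> telescopes to less than one; normalizing it only
  enlarges the weights.
\<close>

lemma obtain_polynomial_weights:
  assumes "0 < K"
  obtains N :: "nat pmf" where "set_pmf N = {..<K}"
    "\<And>k. k < K \<Longrightarrow> 1 / (real (k + 1) * real (k + 2)) \<le> pmf N k"
proof -
  define v where "v k = 1 / (real (k + 1) * real (k + 2))" for k
  define S where "S = (\<Sum>k<K. v k)"
  have "(\<Sum>k<n. v k) = 1 - 1 / real (n + 1)" for n
  proof (induction n)
    case (Suc n)
    have "1 / (x + 1) - 1 / ((x + 1) * (x + 2)) = 1 / (x + 2)" if "0 \<le> x" for x :: real
      using that by (simp add: divide_simps)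
    from this[of "real n"] have "1 / real (n + 1) - v n = 1 / real (Suc n + 1)"
      by (simp add: v_def add.commute)
    then show ?case using Suc by simp
  qed simp
  then have S1: "S \<le> 1" by (simp add: S_def)
  have v0: "0 < v k" for k by (simp add: v_def)
  have S0: "0 < S" unfolding S_def using assms v0 by (intro sum_pos) auto
  define g where "g k = (if k < K then v k / S else 0)" for k
  have g0: "0 \<le> g k" for k using v0[of k] S0 by (simp add: g_def)
  have "(\<integral>\<^sup>+k. ennreal (g k) \<partial>count_space UNIV) = (\<Sum>k<K. ennreal (g k))"
    by (rule nn_integral_count_space') (auto simp: g_def)
  also have "\<dots> = ennreal (\<Sum>k<K. g k)" using g0 by (rule sum_ennreal)
  also have "(\<Sum>k<K. g k) = (\<Sum>k<K. v k / S)" by (simp add: g_def)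
  also have "\<dots> = S / S" unfolding sum_divide_distrib[symmetric] S_def[symmetric] ..
  finally have g1: "(\<integral>\<^sup>+k. ennreal (g k) \<partial>count_space UNIV) = 1" using S0 by simp
  define N where "N = embed_pmf g"
  have N: "pmf N k = g k" for k unfolding N_def by (rule pmf_embed_pmf[OF g0 g1])
  show ?thesis
  proof (rule that[of N])
    show "set_pmf N = {..<K}" using v0 S0 by (auto simp: set_pmf_eq N g_def less_le)
    fix k assume "k < K"
    then show "1 / (real (k + 1) * real (k + 2)) \<le> pmf N k"
      unfolding N g_def v_def[symmetric] using S0 S1 v0[of k] by (simp add: pos_le_divide_eq mult_left_le)
  qed
qed

section \<open>The decomposition tree\<close>

text \<open>
  The outcome of the construction for a set \<open>A\<close> near \<open>x\<close>: the map \<open>u\<close> moves the points of \<open>A\<close> by vectors of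
  \<open>p\<close>-norm at most \<open>L\<close> onto a set that stays near \<open>x\<close> and on which \<open>\<mu>\<close> is a majorizing measure with bound
  \<open>C\<close>.
\<close>

definition decomposes ::
  "nat \<Rightarrow> real \<Rightarrow> (nat \<Rightarrow> real) \<Rightarrow> real \<Rightarrow> real \<Rightarrow> real \<Rightarrow> (nat \<Rightarrow> real) set
    \<Rightarrow> (nat \<Rightarrow> real) pmf \<Rightarrow> ((nat \<Rightarrow> real) \<Rightarrow> nat \<Rightarrow> real) \<Rightarrow> bool" where
  "decomposes M p x R L C A \<mu> u \<longleftrightarrow> set_pmf \<mu> \<subseteq> u ` A \<and>
     (\<forall>t\<in>A. u t \<in> RM M \<and> ed M (u t) x \<le> R \<and> lp_le M p L (\<lambda>i. t i - u t i) \<and>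
        entropy_integral_le M \<mu> (u t) C)"

lemma sqrt_ln_weight_le:
  "sqrt (ln (1 / (1 / (real (k + 1) * real (k + 2))))) \<le> 2 * excess k + 6"
proof -
  define l where "l = ln (real (k + 1))"
  have l0: "0 \<le> l" by (simp add: l_def)
  have "ln (real (k + 1) * real (k + 2)) = l + ln (real (k + 2))"
    by (simp add: l_def ln_mult)
  also have "ln (real (k + 2)) \<le> ln (2 * real (k + 1))" by (subst ln_le_cancel_iff) auto
  also have "\<dots> = ln 2 + l" unfolding l_def by (rule ln_mult_pos) auto
  also have "ln 2 \<le> (1::real)" using ln_le_minus_one[of "2::real"] by simp
  finally have "ln (real (k + 1) * real (k + 2)) \<le> 2 * l + 1" by simp
  also have "\<dots> \<le> 4 * (sqrt l)\<^sup>2 + 4 * sqrt l + 1" using l0 by simp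
  also have "\<dots> = (2 * sqrt l + 1)\<^sup>2" by (simp add: power2_eq_square algebra_simps)
  finally have "sqrt (ln (real (k + 1) * real (k + 2))) \<le> sqrt ((2 * sqrt l + 1)\<^sup>2)"
    by (rule real_sqrt_le_mono)
  also have "\<dots> = 2 * sqrt l + 1" using l0 by simp
  also have "\<dots> \<le> 2 * excess k + 6"
  proof -
    have "sqrt l - 2 \<le> excess k" unfolding excess_def l_def by (rule max.cobounded2)
    then show ?thesis by linarith
  qed
  finally show ?thesis by simp
qed

text \<open>
  One level of the tree: the measures of the pieces are mixed with polynomially decreasing weights. Since
  all points stay within \<open>R\<close> of \<open>x\<close>, the entropy integrals grow by at most the diameter \<open>2 R\<close> times the
  square root of the logarithm of the inverse weight.
\<close>

lemma decomposes_Union: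
  assumes K: "0 < K" and A: "A = (\<Union>k<K. P k)"
    and disj: "\<And>k l. k < K \<Longrightarrow> l < K \<Longrightarrow> k \<noteq> l \<Longrightarrow> P k \<inter> P l = {}"
    and dec: "\<And>k. k < K \<Longrightarrow> \<exists>\<mu> u C. decomposes M p x R L C (P k) \<mu> u \<and> 0 \<le> C \<and>
        2 * R * (2 * excess k + 6) + C \<le> C'"
    and R: "0 \<le> R"
  shows "\<exists>\<mu> u. decomposes M p x R L C' A \<mu> u"
proof -
  obtain \<mu> u C where dec: "\<And>k. k < K \<Longrightarrow> decomposes M p x R L (C k) (P k) (\<mu> k) (u k)"
    and C: "\<And>k. k < K \<Longrightarrow> 0 \<le> C k" "\<And>k. k < K \<Longrightarrow> 2 * R * (2 * excess k + 6) + C k \<le> C'"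
    using dec by metis
  obtain N :: "nat pmf" where N: "set_pmf N = {..<K}"
    "\<And>k. k < K \<Longrightarrow> 1 / (real (k + 1) * real (k + 2)) \<le> pmf N k"
    using obtain_polynomial_weights[OF K] by blast
  define idx where "idx s = (THE k. k < K \<and> s \<in> P k)" for s
  have idx: "idx s = k" if "k < K" "s \<in> P k" for k s
    unfolding idx_def using that disj by (intro the_equality) blast+
  define v where "v s = u (idx s) s" for s
  have v: "v s = u k s" if "k < K" "s \<in> P k" for k s using idx[OF that] by (simp add: v_def)
  have supp: "set_pmf (bind_pmf N \<mu>) \<subseteq> v ` A"
  proof
    fix y assume "y \<in> set_pmf (bind_pmf N \<mu>)"
    then obtain k where k: "k < K" "y \<in> set_pmf (\<mu> k)" using N by auto
    then obtain s where "s \<in> P k" "y = u k s" using dec[OF k(1)] unfolding decomposes_def by blast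
    then show "y \<in> v ` A" using v[OF k(1)] k(1) A by force
  qed
  have near: "ed M (v s) x \<le> R" if "s \<in> A" for s
    using that A dec v unfolding decomposes_def by fastforce
  have "decomposes M p x R L C' A (bind_pmf N \<mu>) v"
    unfolding decomposes_def
  proof (intro conjI ballI supp)
    fix s assume s: "s \<in> A"
    then obtain k where k: "k < K" "s \<in> P k" using A by auto
    note d = dec[OF k(1), unfolded decomposes_def, THEN conjunct2, rule_format, OF k(2)]
    show "v s \<in> RM M" "ed M (v s) x \<le> R" "lp_le M p L (\<lambda>i. s i - v s i)"
      using d v[OF k] by auto
    have "entropy_integral_le M (bind_pmf N \<mu>) (v s)
        (2 * R * sqrt (ln (1 / (1 / (real (k + 1) * real (k + 2))))) + C k)"
    proof (rule entropy_integral_le_bind[OF N(2)[OF k(1)]])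
      fix y assume "y \<in> set_pmf (bind_pmf N \<mu>)"
      then obtain s' where s': "s' \<in> A" "y = v s'" using supp by auto
      show "ed M (v s) y \<le> 2 * R"
        using ed_triangle[of M "v s" y x] near[OF s] near[OF s'(1)] s'(2) by (simp add: ed_commute)
    qed (use R C(1)[OF k(1)] d v[OF k] in auto)
    moreover have "2 * R * sqrt (ln (1 / (1 / (real (k + 1) * real (k + 2))))) \<le> 2 * R * (2 * excess k + 6)"
      using sqrt_ln_weight_le R by (intro mult_left_mono) auto
    ultimately show "entropy_integral_le M (bind_pmf N \<mu>) (v s) C'"
      using C(2)[OF k(1)] by (elim entropy_integral_le_mono) linarith
  qed
  then show ?thesis by blast
qed

lemma decomposes_recenter:
  assumes "decomposes M p x' R' L C A \<mu> u" "R' + ed M x' x \<le> R"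
  shows "decomposes M p x R L C A \<mu> u"
proof -
  have "ed M (u t) x \<le> R" if "t \<in> A" for t
    using that assms ed_triangle[of M "u t" x x'] unfolding decomposes_def by fastforce
  then show ?thesis using assms unfolding decomposes_def by auto
qed

lemma decomposes_trunc:
  assumes d: "decomposes M p x R L C (trunc x' w ` A) \<mu> u"
    and p: "1 \<le> p" and L: "0 < L" "0 < L'" and err: "\<And>t. t \<in> A \<Longrightarrow> lp_le M p L' (\<lambda>i. t i - trunc x' w t i)"
  shows "decomposes M p x R (L' + L) C A \<mu> (\<lambda>t. u (trunc x' w t))"
proof -
  have "lp_le M p (L' + L) (\<lambda>i. t i - u (trunc x' w t) i)" if t: "t \<in> A" for t
    using lp_le_add[OF p L(2,1) err[OF t], of "\<lambda>i. trunc x' w t i - u (trunc x' w t) i"] d t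
    unfolding decomposes_def by auto
  then show ?thesis using d unfolding decomposes_def by (auto simp: image_image)
qed

definition rad :: "real \<Rightarrow> nat \<Rightarrow> real" where "rad Q j = Q / ratio ^ j"

text \<open>
  The truncation width in force during phase \<open>e\<close>. It is chosen for the smallest radius at which the
  growth inequality is used in that phase, and so it suits the larger ones as well.
\<close>

definition width :: "real \<Rightarrow> nat \<Rightarrow> real" where "width Q e = gain / 2 * (rad Q ((e + 1) ^ 3))\<^sup>2"

text \<open>
  The largest step cost that may be forfeited in phase \<open>e\<close>. It telescopes as a multiple of
  \<open>1 / e - 1 / (e + 1)\<close>, and \<open>gain\<close> times it, summed over the more than \<open>3 e (e + 1)\<close> steps of the phase,
  exceeds \<open>2\<close>.
\<close>

definition threshold :: "nat \<Rightarrow> real" where "threshold e = 2 / (gain * (real e * (real e + 1)))"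

lemma rad_pos: "0 < Q \<Longrightarrow> 0 < rad Q j" using ratio_ge by (simp add: rad_def)

lemma rad_Suc: "rad Q j = ratio * rad Q (Suc j)" using ratio_ge by (simp add: rad_def)

lemma rad_antimono: "0 < Q \<Longrightarrow> i \<le> j \<Longrightarrow> rad Q j \<le> rad Q i"
  unfolding rad_def using ratio_ge by (intro divide_left_mono power_increasing mult_pos_pos) auto

lemma width_pos: "0 < Q \<Longrightarrow> 0 < width Q e"
  using rad_pos[of Q "(e + 1) ^ 3"] gain_pos by (simp add: width_def)

lemma bw_near:
  assumes "finite A" "s \<in> A" "0 \<le> r"
  shows "bw M {z \<in> A. ed M z s \<le> r} \<le> bw M A" "0 \<le> bw M {z \<in> A. ed M z s \<le> r}"
proof -
  have s: "s \<in> {z \<in> A. ed M z s \<le> r}" using assms by simp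
  have ne: "{z \<in> A. ed M z s \<le> r} \<noteq> {}" using s by blast
  show "bw M {z \<in> A. ed M z s \<le> r} \<le> bw M A" using assms(1) ne by (intro bw_mono) auto
  show "0 \<le> bw M {z \<in> A. ed M z s \<le> r}" using assms(1) ne by (intro bw_nonneg) auto
qed

lemma excess_nonneg: "0 \<le> excess k" by (simp add: excess_def)

text \<open>
  Here \<open>A\<close> is a node of level \<open>j\<close> whose next truncation belongs to phase \<open>e\<close>; \<open>\<beta>0\<close> bounds its expected supremum and
  \<open>\<beta>1\<close> that of its subsets of radius \<open>rad Q (j + 1)\<close>. The potential \<open>\<beta>0 + \<beta>1\<close> is at most \<open>2\<close> in the
  beginning. The \<open>k\<close>-th piece has the bounds \<open>\<beta>1\<close> and \<open>\<beta>0 - gain * rad Q (j + 1) * excess k\<close>, so an ordinary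
  step lowers the potential by as much as its own cost requires. A truncated piece only keeps the bound \<open>\<beta>1\<close> for
  both, and its step cost is covered by \<open>threshold e\<close>. The last hypothesis records that each step of
  phase \<open>e\<close> so far was more expensive than \<open>threshold e\<close>. As the potential is nonnegative, it implies
  \<open>j < (e + 1) ^ 3\<close>. At level \<open>J\<close> the remaining sets are so small that each is collapsed to its centre.
\<close>

lemma decomposition_tree:
  fixes p Q Lp \<delta> :: real
  assumes p: "1 < p" "p < 2" and Q: "0 < Q" and Lp: "0 < Lp" and \<delta>: "0 < \<delta>" and e0: "1 \<le> e0"
    and trunc_cost: "\<And>e. e0 \<le> e \<Longrightarrow>
        width Q (e + 1) powr (p - 2) * (rad Q (e ^ 3))\<^sup>2 \<le> (Lp / (real e * (real e + 1))) powr p"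
    and last: "\<And>v. (\<And>i. i < M \<Longrightarrow> \<bar>v i\<bar> \<le> rad Q J) \<Longrightarrow> lp_le M p \<delta> v"
    and "j + n = J" "e0 \<le> e" "finite A" "A \<noteq> {}" "A \<subseteq> RM M" "x \<in> RM M"
    and "\<And>t. t \<in> A \<Longrightarrow> ed M t x \<le> rad Q j"
    and "\<And>t i. t \<in> A \<Longrightarrow> i < M \<Longrightarrow> \<bar>t i - y i\<bar> \<le> width Q e"
    and "bw M A \<le> \<beta>0" "\<And>s. s \<in> A \<Longrightarrow> bw M {z \<in> A. ed M z s \<le> rad Q (Suc j)} \<le> \<beta>1" "\<beta>1 \<le> \<beta>0"
    and "\<beta>0 + \<beta>1 \<le> 2 - gain * threshold e * real (j - e ^ 3)"
  shows "\<exists>\<mu> u. decomposes M p x (2 * rad Q j) (Lp / e + \<delta>)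
           (8 * ratio / gain * (\<beta>0 + \<beta>1) + 48 * rad Q j + 16 * ratio / gain / e) A \<mu> u"
  using assms(9-)
proof (induction n arbitrary: j e A x y \<beta>0 \<beta>1)
  case 0
  note prems = "0.prems"
  let ?L = "Lp / e + \<delta>" and ?C = "8 * ratio / gain * (\<beta>0 + \<beta>1) + 48 * rad Q j + 16 * ratio / gain / e"
  have e: "1 \<le> e" using e0 prems(2) by linarith
  obtain s where s: "s \<in> A" using prems by auto
  have "0 \<le> bw M {z \<in> A. ed M z s \<le> rad Q (Suc j)}" "0 \<le> bw M A"
    using prems s rad_pos[OF Q, of "Suc j"] by (auto intro!: bw_near bw_nonneg)
  then have \<beta>: "0 \<le> \<beta>0" "0 \<le> \<beta>1" using prems(9) prems(10)[OF s] by linarith+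
  have C0: "0 \<le> ?C"
    using \<beta> rad_pos[OF Q, of j] gain_pos ratio_ge
    by (intro add_nonneg_nonneg mult_nonneg_nonneg divide_nonneg_nonneg) auto
  have "decomposes M p x (2 * rad Q j) ?L ?C A (return_pmf x) (\<lambda>_. x)"
    unfolding decomposes_def
  proof (intro conjI ballI)
    fix t assume t: "t \<in> A"
    have "\<bar>t i - x i\<bar> \<le> rad Q J" if "i < M" for i
      using ed_coord[OF that, of t x] prems(7)[OF t] prems(1) by simp
    then have "lp_le M p \<delta> (\<lambda>i. t i - x i)" by (rule last)
    then show "lp_le M p ?L (\<lambda>i. t i - x i)"
      using Lp \<delta> p by (elim lp_le_mono[rotated 3]) auto
  qed (use prems C0 rad_pos[OF Q, of j] in \<open>auto intro: entropy_integral_le_return\<close>)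
  then show ?case by blast
next
  case (Suc n)
  note prems = Suc.prems
  let ?a = "rad Q (Suc j)"
  have a: "0 < ?a" by (rule rad_pos[OF Q])
  have r: "rad Q j = ratio * ?a" by (rule rad_Suc)
  have e: "1 \<le> e" using e0 prems(2) by linarith
  then have er: "1 \<le> real e" by simp
  have th: "0 \<le> threshold e" using gain_pos by (simp add: threshold_def)
  have gth: "gain * threshold e = 2 / (real e * (real e + 1))" using gain_pos by (simp add: threshold_def)
  have \<beta>1_nonneg: "0 \<le> \<beta>1"
  proof -
    obtain s where s: "s \<in> A" using prems by auto
    have "0 \<le> bw M {z \<in> A. ed M z s \<le> ?a}"
      using prems s a by (intro bw_near) auto
    then show ?thesis using prems(10)[OF s] by linarith
  qed
  then have \<beta>0_nonneg: "0 \<le> \<beta>0" using prems by linarith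
  have V2: "\<beta>0 + \<beta>1 \<le> 2"
  proof -
    have "0 \<le> gain * threshold e * real (j - e ^ 3)"
      using th gain_pos by (intro mult_nonneg_nonneg) auto
    then show ?thesis using prems(12) by linarith
  qed
  have j: "Suc j \<le> (e + 1) ^ 3"
  proof (rule ccontr)
    assume "\<not> Suc j \<le> (e + 1) ^ 3"
    moreover have "(e + 1) ^ 3 = 3 * (e * (e + 1)) + 1 + e ^ 3" by (simp add: power3_eq_cube algebra_simps)
    ultimately have "3 * (e * (e + 1)) \<le> j - e ^ 3" by simp
    then have "real (3 * (e * (e + 1))) \<le> real (j - e ^ 3)" by (simp only: of_nat_le_iff)
    then have "3 * (real e * (real e + 1)) \<le> real (j - e ^ 3)" by (simp add: algebra_simps)
    then have "gain * threshold e * (3 * (real e * (real e + 1))) \<le> gain * threshold e * real (j - e ^ 3)"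
      using th gain_pos by (intro mult_left_mono) auto
    moreover have "gain * threshold e * (3 * (real e * (real e + 1))) = 6"
      unfolding gth using er by simp
    ultimately show False using prems(12) \<beta>0_nonneg \<beta>1_nonneg by linarith
  qed
  have w: "0 < width Q e" "width Q e \<le> gain / 2 * ?a\<^sup>2"
  proof -
    show "0 < width Q e" by (rule width_pos[OF Q])
    show "width Q e \<le> gain / 2 * ?a\<^sup>2"
      unfolding width_def using gain_pos rad_antimono[OF Q j] less_imp_le[OF rad_pos[OF Q]]
      by (intro mult_left_mono power_mono) auto
  qed
  have bwA: "bw M A \<le> 2" using prems(9) V2 \<beta>1_nonneg by linarith
  have bd: "\<forall>t\<in>A. \<forall>i<M. \<bar>t i - y i\<bar> \<le> width Q e" using prems(8) by blast
  show ?case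
  proof (rule greedy_partition[where M = M and A = A and a = "?a" and w = "width Q e" and y = y,
        OF prems(3,4) bwA a w bd])
  fix K :: nat and t P
  assume K: "0 < K" and AP: "A = (\<Union>k<K. P k)"
    and disj: "\<And>k l. k < K \<Longrightarrow> l < K \<Longrightarrow> k \<noteq> l \<Longrightarrow> P k \<inter> P l = {}"
    and tP: "\<And>k. k < K \<Longrightarrow> t k \<in> P k" and Pa: "\<And>k s. k < K \<Longrightarrow> s \<in> P k \<Longrightarrow> ed M s (t k) \<le> ?a"
    and gainP: "\<And>k s. k < K \<Longrightarrow> s \<in> P k \<Longrightarrow>
       bw M {z \<in> P k. ed M z s \<le> ?a / ratio} \<le> bw M A - gain * ?a * excess k"
  show "\<exists>\<mu> u. decomposes M p x (2 * rad Q j) (Lp / e + \<delta>)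
      (8 * ratio / gain * (\<beta>0 + \<beta>1) + 48 * rad Q j + 16 * ratio / gain / e) A \<mu> u"
  proof (rule decomposes_Union[OF K AP disj])
    fix k assume k: "k < K"
    have PA: "P k \<subseteq> A" using AP k by auto
    have finP: "finite (P k)" using PA prems(3) by (rule finite_subset)
    have neP: "P k \<noteq> {}" using tP[OF k] by auto
    have tA: "t k \<in> A" using tP[OF k] PA by auto
    have tRM: "t k \<in> RM M" using tA prems(5) by auto
    have bwP: "bw M (P k) \<le> \<beta>1"
    proof -
      have "bw M (P k) \<le> bw M {z \<in> A. ed M z (t k) \<le> ?a}"
        using PA Pa[OF k] neP prems(3) by (intro bw_mono) auto
      then show ?thesis using prems(10)[OF tA] by linarith
    qed
    have center: "2 * ?a + ed M (t k) x \<le> 2 * rad Q j"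
      using prems(7)[OF tA] r ratio_ge a mult_right_mono[of 2 ratio ?a] by linarith
    have ra: "48 * ?a + 24 * rad Q j \<le> 48 * rad Q j"
      using r ratio_ge a mult_right_mono[of 2 ratio ?a] by linarith
    let ?ex = "excess k"
    show "\<exists>\<mu> u C. decomposes M p x (2 * rad Q j) (Lp / e + \<delta>) C (P k) \<mu> u \<and> 0 \<le> C \<and>
       2 * (2 * rad Q j) * (2 * ?ex + 6) + C
         \<le> 8 * ratio / gain * (\<beta>0 + \<beta>1) + 48 * rad Q j + 16 * ratio / gain / e"
    \<comment> \<open>Truncate the piece if its step is cheap enough to be forfeited.\<close>
    proof (cases "e ^ 3 \<le> j \<and> ?a * ?ex \<le> threshold e")
      case True
      let ?w = "width Q (e + 1)"
      let ?B = "trunc (t k) ?w ` P k"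
      let ?C = "8 * ratio / gain * (\<beta>1 + \<beta>1) + 48 * ?a + 16 * ratio / gain / (e + 1)"
      have w0: "0 < ?w" by (rule width_pos[OF Q])
      have bwB: "bw M ?B \<le> \<beta>1"
        using bw_contraction[OF finP neP, of M "trunc (t k) ?w"] trunc_lipschitz bwP by fastforce
      have ex: "\<exists>\<mu> u. decomposes M p (t k) (2 * ?a) (Lp / real (e + 1) + \<delta>) ?C ?B \<mu> u"
      proof (rule Suc.IH[where y = "t k"])
        show "Suc j + n = J" "e0 \<le> e + 1" using prems by auto
        show "finite ?B" "?B \<noteq> {}" using finP neP by auto
        show "?B \<subseteq> RM M" using trunc_RM[OF less_imp_le[OF w0] tRM] PA prems(5) by auto
        show "t k \<in> RM M" by (rule tRM)
        show "ed M s (t k) \<le> ?a" if sB: "s \<in> ?B" for s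
        proof -
          obtain s' where s': "s' \<in> P k" "s = trunc (t k) ?w s'" using sB by auto
          have "ed M s (t k) \<le> ed M s' (t k)"
            using ed_trunc[of M "t k" ?w s' "t k"] s'(2) trunc_center[of ?w "t k"] w0 by simp
          then show ?thesis using Pa[OF k s'(1)] by linarith
        qed
        show "\<bar>s i - t k i\<bar> \<le> width Q (e + 1)" if "s \<in> ?B" "i < M" for s i
          using that trunc_bounded[of ?w "t k"] w0 by auto
        show "bw M ?B \<le> \<beta>1" by (rule bwB)
        show "bw M {z \<in> ?B. ed M z s \<le> rad Q (Suc (Suc j))} \<le> \<beta>1" if "s \<in> ?B" for s
        proof -
          have "bw M {z \<in> ?B. ed M z s \<le> rad Q (Suc (Suc j))} \<le> bw M ?B"
            using finP that rad_pos[OF Q, of "Suc (Suc j)"] by (intro bw_near) auto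
          then show ?thesis using bwB by linarith
        qed
        have "Suc j - (e + 1) ^ 3 = 0" using j by simp
        then show "\<beta>1 + \<beta>1 \<le> 2 - gain * threshold (e + 1) * real (Suc j - (e + 1) ^ 3)"
          using V2 prems(11) by simp
      qed simp
      then obtain \<mu> u where d: "decomposes M p (t k) (2 * ?a) (Lp / real (e + 1) + \<delta>) ?C ?B \<mu> u" by blast
      have err: "lp_le M p (Lp / (real e * (real e + 1))) (\<lambda>i. s i - trunc (t k) ?w s i)" if "s \<in> P k" for s
      proof (rule trunc_error[OF w0])
        show "ed M s (t k) \<le> rad Q (e ^ 3)"
          using Pa[OF k that] rad_antimono[OF Q, of "e ^ 3" "Suc j"] True by linarith
      qed (use p trunc_cost prems(2) in auto)
      have "decomposes M p (t k) (2 * ?a) (Lp / (real e * (real e + 1)) + (Lp / real (e + 1) + \<delta>)) ?C (P k) \<mu>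
          (\<lambda>s. u (trunc (t k) ?w s))"
        using p Lp \<delta> er by (intro decomposes_trunc[OF d _ _ _ err] add_pos_pos divide_pos_pos mult_pos_pos) auto
      moreover have "Lp / (real e * (real e + 1)) + (Lp / real (e + 1) + \<delta>) = Lp / e + \<delta>"
        using er by (simp add: divide_simps) (simp add: algebra_simps)
      ultimately have "decomposes M p x (2 * rad Q j) (Lp / e + \<delta>) ?C (P k) \<mu> (\<lambda>s. u (trunc (t k) ?w s))"
        using decomposes_recenter[OF _ center] by (simp only:)
      moreover have "0 \<le> ?C"
        using \<beta>1_nonneg a gain_pos ratio_ge
        by (intro add_nonneg_nonneg mult_nonneg_nonneg divide_nonneg_nonneg) auto
      moreover have "2 * (2 * rad Q j) * (2 * ?ex + 6) + ?C
         \<le> 8 * ratio / gain * (\<beta>0 + \<beta>1) + 48 * rad Q j + 16 * ratio / gain / e"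
      proof -
        have "8 * ratio / gain * (\<beta>1 + \<beta>1) \<le> 8 * ratio / gain * (\<beta>0 + \<beta>1)"
          using prems(11) gain_pos ratio_ge by (intro mult_left_mono) auto
        moreover have "8 * rad Q j * ?ex \<le> 16 * ratio / gain / e - 16 * ratio / gain / (e + 1)"
        proof -
          have "8 * rad Q j * ?ex = 8 * ratio * (?a * ?ex)" using r by simp
          also have "\<dots> \<le> 8 * ratio * threshold e" using True ratio_ge by (intro mult_left_mono) auto
          also have "\<dots> = 16 * ratio / gain / e - 16 * ratio / gain / (e + 1)"
            using er gain_pos unfolding threshold_def by (simp add: divide_simps) (simp add: algebra_simps)
          finally show ?thesis .
        qed
        moreover have "2 * (2 * rad Q j) * (2 * ?ex + 6) = 8 * rad Q j * ?ex + 24 * rad Q j"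
          by (simp add: algebra_simps)
        ultimately show ?thesis using ra by linarith
      qed
      ultimately show ?thesis by blast
    next
      case False
      let ?b = "min \<beta>1 (\<beta>0 - gain * ?a * ?ex)"
      let ?C = "8 * ratio / gain * (\<beta>1 + ?b) + 48 * ?a + 16 * ratio / gain / e"
      have g0: "0 \<le> gain * ?a * ?ex" using gain_pos a excess_nonneg by (intro mult_nonneg_nonneg) auto
      have small: "bw M {z \<in> P k. ed M z s \<le> rad Q (Suc (Suc j))} \<le> ?b" if s: "s \<in> P k" for s
      proof -
        have "?a / ratio = rad Q (Suc (Suc j))" using rad_Suc[of Q "Suc j"] ratio_ge by simp
        then have "bw M {z \<in> P k. ed M z s \<le> rad Q (Suc (Suc j))} \<le> \<beta>0 - gain * ?a * ?ex"
          using gainP[OF k s] prems(9) by simp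
        moreover have "bw M {z \<in> P k. ed M z s \<le> rad Q (Suc (Suc j))} \<le> bw M (P k)"
          using finP s rad_pos[OF Q, of "Suc (Suc j)"] by (intro bw_near) auto
        ultimately show ?thesis using bwP by linarith
      qed
      have b0: "0 \<le> ?b"
      proof -
        have "0 \<le> bw M {z \<in> P k. ed M z (t k) \<le> rad Q (Suc (Suc j))}"
          using finP tP[OF k] rad_pos[OF Q, of "Suc (Suc j)"] by (intro bw_near) auto
        then show ?thesis using small[OF tP[OF k]] by linarith
      qed
      have Vdec: "\<beta>1 + ?b \<le> \<beta>0 + \<beta>1 - gain * ?a * ?ex" by linarith
      have "\<exists>\<mu> u. decomposes M p (t k) (2 * ?a) (Lp / e + \<delta>) ?C (P k) \<mu> u"
      proof (rule Suc.IH[where y = y])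
        show "Suc j + n = J" "e0 \<le> e" using prems by auto
        show "finite (P k)" "P k \<noteq> {}" by fact+
        show "P k \<subseteq> RM M" using PA prems(5) by auto
        show "t k \<in> RM M" by (rule tRM)
        show "ed M s (t k) \<le> ?a" if "s \<in> P k" for s using Pa[OF k that] .
        show "\<bar>s i - y i\<bar> \<le> width Q e" if "s \<in> P k" "i < M" for s i using that PA prems(8) by auto
        show "bw M (P k) \<le> \<beta>1" by (rule bwP)
        show "bw M {z \<in> P k. ed M z s \<le> rad Q (Suc (Suc j))} \<le> ?b" if "s \<in> P k" for s by (rule small[OF that])
        show "?b \<le> \<beta>1" by simp
        show "\<beta>1 + ?b \<le> 2 - gain * threshold e * real (Suc j - e ^ 3)"
        proof (cases "e ^ 3 \<le> j")
          case False
          then have "Suc j - e ^ 3 = 0" by simp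
          then show ?thesis using V2 Vdec g0 by simp
        next
          case True
          then have "threshold e \<le> ?a * ?ex" using False by simp
          then have "gain * threshold e \<le> gain * (?a * ?ex)" using gain_pos by (intro mult_left_mono) auto
          moreover have "real (Suc j - e ^ 3) = real (j - e ^ 3) + 1" using True by (simp add: Suc_diff_le)
          then have "gain * threshold e * real (Suc j - e ^ 3) = gain * threshold e * real (j - e ^ 3) + gain * threshold e"
            by (simp add: algebra_simps)
          ultimately show ?thesis using prems(12) Vdec unfolding mult.assoc by linarith
        qed
      qed
      then obtain \<mu> u where d: "decomposes M p (t k) (2 * ?a) (Lp / e + \<delta>) ?C (P k) \<mu> u" by blast
      have "0 \<le> ?C"
        using b0 \<beta>1_nonneg a gain_pos ratio_ge
        by (intro add_nonneg_nonneg mult_nonneg_nonneg divide_nonneg_nonneg) auto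
      moreover have "2 * (2 * rad Q j) * (2 * ?ex + 6) + ?C
         \<le> 8 * ratio / gain * (\<beta>0 + \<beta>1) + 48 * rad Q j + 16 * ratio / gain / e"
      proof -
        have "8 * ratio / gain * (\<beta>1 + ?b) \<le> 8 * ratio / gain * (\<beta>0 + \<beta>1 - gain * ?a * ?ex)"
          using Vdec gain_pos ratio_ge by (intro mult_left_mono) auto
        also have "\<dots> = 8 * ratio / gain * (\<beta>0 + \<beta>1) - 8 * rad Q j * ?ex"
          unfolding r using gain_pos by (simp add: field_simps)
        finally have "8 * ratio / gain * (\<beta>1 + ?b) \<le> 8 * ratio / gain * (\<beta>0 + \<beta>1) - 8 * rad Q j * ?ex" .
        moreover have "2 * (2 * rad Q j) * (2 * ?ex + 6) = 8 * rad Q j * ?ex + 24 * rad Q j"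
          by (simp add: algebra_simps)
        ultimately show ?thesis using ra by linarith
      qed
      ultimately show ?thesis using decomposes_recenter[OF d center] by blast
    qed
  qed (use rad_pos[OF Q, of j] in auto)
  qed
qed

section \<open>From weights to Borel measures\<close>

text \<open>
  For a finite set all subsets are Borel, so a discrete distribution on it is an admissible measure.
\<close>

lemma gamma_half_le:
  assumes U: "finite U" "U \<noteq> {}" and supp: "set_pmf \<mu> \<subseteq> U"
    and C: "\<And>x. x \<in> U \<Longrightarrow> entropy_integral_le M \<mu> x C"
  shows "gamma_half M U \<le> ennreal C"
proof -
  obtain u0 where u0: "u0 \<in> U" using U by auto
  \<comment> \<open>The identity on the support of \<open>\<mu>\<close>, extended so that it maps into \<open>U\<close>.\<close>
  define f where "f y = (if y \<in> U then y else u0)" for y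
  define \<nu> where "\<nu> = distr (measure_pmf \<mu>) (restrict_space borel U) f"
  have f: "f \<in> measurable (measure_pmf \<mu>) (restrict_space borel U)"
    using u0 by (auto simp: f_def space_restrict_space)
  have setsB: "B \<in> sets (restrict_space borel U)" if "B \<subseteq> U" for B
  proof -
    have "closed B" using that U(1) by (intro finite_imp_closed) (rule finite_subset)
    then have "B \<in> sets borel" by simp
    then show ?thesis using that by (auto simp: sets_restrict_space intro!: image_eqI[of _ _ B])
  qed
  have "\<nu> \<in> prob_measures_on U"
    unfolding prob_measures_on_def \<nu>_def using measure_pmf.prob_space_distr[OF f] by simp
  moreover have "(SUP x\<in>U. (\<integral>\<^sup>+\<epsilon>\<in>{0..}. sqrt_log_inv (measure \<nu> (ball_in M U x \<epsilon>)) \<partial>lborel)) \<le> ennreal C"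
  proof (rule SUP_least)
    fix x assume x: "x \<in> U"
    obtain G where G: "\<And>\<epsilon>. 0 \<le> \<epsilon> \<Longrightarrow> sqrt_log_inv (measure_pmf.prob \<mu> {y. ed M x y \<le> \<epsilon>}) \<le> G \<epsilon>"
      "(\<integral>\<^sup>+\<epsilon>. G \<epsilon> \<partial>lborel) \<le> ennreal C"
      using C[OF x] unfolding entropy_integral_le_def by auto
    have eq: "measure \<nu> (ball_in M U x \<epsilon>) = measure_pmf.prob \<mu> {y. ed M x y \<le> \<epsilon>}" for \<epsilon>
    proof -
      have "measure \<nu> (ball_in M U x \<epsilon>) = measure_pmf.prob \<mu> (f -` ball_in M U x \<epsilon>)"
        unfolding \<nu>_def by (subst measure_distr[OF f setsB]) (auto simp: ball_in_def)
      also have "\<dots> = measure_pmf.prob \<mu> {y. ed M x y \<le> \<epsilon>}"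
        using supp by (intro measure_prob_cong_0) (auto simp: f_def ball_in_def ed_def set_pmf_eq)
      finally show ?thesis .
    qed
    have "(\<integral>\<^sup>+\<epsilon>\<in>{0..}. sqrt_log_inv (measure \<nu> (ball_in M U x \<epsilon>)) \<partial>lborel) \<le> (\<integral>\<^sup>+\<epsilon>. G \<epsilon> \<partial>lborel)"
      unfolding eq using G(1) by (intro nn_integral_mono) (auto simp: indicator_def)
    then show "(\<integral>\<^sup>+\<epsilon>\<in>{0..}. sqrt_log_inv (measure \<nu> (ball_in M U x \<epsilon>)) \<partial>lborel) \<le> ennreal C"
      using G(2) by (rule order_trans)
  qed
  ultimately show ?thesis unfolding gamma_half_def by (rule INF_lower2)
qed

lemma ed_scale: "0 \<le> S \<Longrightarrow> ed M (\<lambda>i. S * x i) (\<lambda>i. S * y i) = S * ed M x y"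
  unfolding ed_def using L2_set_right_distrib[of S "\<lambda>i. x i - y i" "{..<M}"]
  by (simp add: right_diff_distrib)

lemma entropy_integral_le_scale:
  assumes S: "0 < S" and C: "0 \<le> C" "entropy_integral_le M \<mu> x C"
  shows "entropy_integral_le M (map_pmf (\<lambda>x i. S * x i) \<mu>) (\<lambda>i. S * x i) (S * C)"
proof -
  obtain G where G: "G \<in> borel_measurable borel"
    "\<And>\<epsilon>. 0 \<le> \<epsilon> \<Longrightarrow> sqrt_log_inv (measure_pmf.prob \<mu> {y. ed M x y \<le> \<epsilon>}) \<le> G \<epsilon>"
    "(\<integral>\<^sup>+\<epsilon>. G \<epsilon> \<partial>lborel) \<le> ennreal C"
    using C(2) unfolding entropy_integral_le_def by auto
  have m: "(\<lambda>\<epsilon>. G (\<epsilon> / S)) \<in> borel_measurable borel" using G(1) by measurable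
  have "(\<lambda>y i. S * y i) -` {y. ed M (\<lambda>i. S * x i) y \<le> \<epsilon>} = {y. ed M x y \<le> \<epsilon> / S}" for \<epsilon>
    using S by (auto simp: ed_scale field_simps)
  then have p: "measure_pmf.prob (map_pmf (\<lambda>x i. S * x i) \<mu>) {y. ed M (\<lambda>i. S * x i) y \<le> \<epsilon>}
      = measure_pmf.prob \<mu> {y. ed M x y \<le> \<epsilon> / S}" for \<epsilon>
    by (simp add: measure_map_pmf)
  have "(\<integral>\<^sup>+\<epsilon>. G (\<epsilon> / S) \<partial>lborel) = ennreal \<bar>S\<bar> * (\<integral>\<^sup>+\<epsilon>. G ((0 + S * \<epsilon>) / S) \<partial>lborel)"
    using S by (intro nn_integral_real_affine m) auto
  also have "\<dots> = ennreal S * (\<integral>\<^sup>+\<epsilon>. G \<epsilon> \<partial>lborel)" using S by simp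
  also have "\<dots> \<le> ennreal S * ennreal C" using G(3) by (intro mult_left_mono) auto
  also have "\<dots> = ennreal (S * C)" using S C by (simp add: ennreal_mult)
  finally show ?thesis
    unfolding entropy_integral_le_def p using m G(2) S by (intro bexI[of _ "\<lambda>\<epsilon>. G (\<epsilon> / S)"]) auto
qed

section \<open>Reduction to finite sets\<close>

text \<open>
  Points of \<open>T\<close> whose coordinates fall into the same cells of a grid of mesh \<open>\<delta>\<close> are close to each other.
\<close>

lemma finite_net:
  fixes T :: "(nat \<Rightarrow> real) set"
  assumes \<delta>: "0 < \<delta>" and T: "T \<noteq> {}" and R: "\<And>t i. t \<in> T \<Longrightarrow> i < M \<Longrightarrow> \<bar>t i - t0 i\<bar> \<le> R"
  obtains F where "finite F" "F \<noteq> {}" "F \<subseteq> T" "\<And>t. t \<in> T \<Longrightarrow> \<exists>s\<in>F. \<forall>i<M. \<bar>t i - s i\<bar> \<le> \<delta>"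
proof -
  define \<phi> where "\<phi> t = restrict (\<lambda>i. \<lfloor>t i / \<delta>\<rfloor>) {..<M}" for t :: "nat \<Rightarrow> real"
  have "\<phi> ` T \<subseteq> PiE {..<M} (\<lambda>i. {\<lfloor>(t0 i - R) / \<delta>\<rfloor>..\<lfloor>(t0 i + R) / \<delta>\<rfloor>})"
  proof
    fix z assume "z \<in> \<phi> ` T"
    then obtain t where t: "t \<in> T" "z = \<phi> t" by auto
    have "\<lfloor>t i / \<delta>\<rfloor> \<in> {\<lfloor>(t0 i - R) / \<delta>\<rfloor>..\<lfloor>(t0 i + R) / \<delta>\<rfloor>}" if "i < M" for i
      using R[OF t(1) that] \<delta> by (auto intro!: floor_mono divide_right_mono simp: abs_le_iff)
    then show "z \<in> PiE {..<M} (\<lambda>i. {\<lfloor>(t0 i - R) / \<delta>\<rfloor>..\<lfloor>(t0 i + R) / \<delta>\<rfloor>})"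
      unfolding t(2) \<phi>_def by (intro restrict_PiE_iff[THEN iffD2]) auto
  qed
  then have fin: "finite (\<phi> ` T)" by (rule finite_subset) (intro finite_PiE; simp)
  define pick where "pick z = (SOME t. t \<in> T \<and> \<phi> t = z)" for z
  have pick: "pick (\<phi> t) \<in> T \<and> \<phi> (pick (\<phi> t)) = \<phi> t" if "t \<in> T" for t
    unfolding pick_def by (rule someI[of _ t]) (use that in simp)
  show ?thesis
  proof (rule that[of "pick ` \<phi> ` T"])
    show "finite (pick ` \<phi> ` T)" using fin by simp
    show "pick ` \<phi> ` T \<noteq> {}" using T by simp
    show "pick ` \<phi> ` T \<subseteq> T" using pick by auto
    fix t assume t: "t \<in> T"
    have "\<bar>t i - pick (\<phi> t) i\<bar> \<le> \<delta>" if i: "i < M" for i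
    proof -
      let ?s = "pick (\<phi> t) i"
      have "\<lfloor>t i / \<delta>\<rfloor> = \<lfloor>?s / \<delta>\<rfloor>"
        using pick[OF t] i unfolding \<phi>_def by (auto dest!: fun_cong[of _ _ i] conjunct2)
      then have "\<bar>t i / \<delta> - ?s / \<delta>\<bar> \<le> 1"
        using floor_correct[of "t i / \<delta>"] floor_correct[of "?s / \<delta>"] by linarith
      then have "\<bar>(t i - ?s) / \<delta>\<bar> \<le> 1" by (simp add: diff_divide_distrib)
      then show ?thesis using \<delta> by (simp add: abs_divide divide_le_eq)
    qed
    then show "\<exists>s\<in>pick ` \<phi> ` T. \<forall>i<M. \<bar>t i - s i\<bar> \<le> \<delta>" using t by auto
  qed
qed

lemma lp_le_of_sup_bound:
  assumes p: "1 \<le> p" and s: "0 < s" and v: "\<And>i. i < M \<Longrightarrow> \<bar>v i\<bar> \<le> s / M"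
  shows "lp_le M p s v"
proof (cases "M = 0")
  case False
  then have M: "1 \<le> real M" by simp
  have "(\<Sum>i<M. \<bar>v i\<bar> powr p) \<le> (\<Sum>i<M. (s / M) powr p)"
    using v p by (intro sum_mono powr_mono2) auto
  also have "\<dots> = M * (s powr p * (1 / M) powr p)"
    using powr_mult[of s "1 / M" p] by simp
  also have "\<dots> \<le> M * (s powr p * (1 / M) powr 1)"
    using p M by (intro mult_left_mono powr_mono') auto
  also have "\<dots> = s powr p" using M by simp
  finally show ?thesis by (simp add: lp_le_def)
qed (simp add: lp_le_def)

lemma lp_le_imp_dilate:
  assumes v: "v \<in> RM M" "lp_le M q c v" and c: "0 < c" and pq: "0 < q" "q \<le> p"
  shows "v \<in> dilate c (Bp M p)"
proof -
  define z where "z = (\<lambda>i. v i / c)"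
  have "(\<Sum>i<M. \<bar>z i\<bar> powr q) = (\<Sum>i<M. \<bar>v i\<bar> powr q) / c powr q"
    unfolding z_def sum_divide_distrib using c by (simp add: abs_divide powr_divide)
  also have "\<dots> \<le> 1" using v(2) c by (simp add: lp_le_def)
  finally have q1: "(\<Sum>i<M. \<bar>z i\<bar> powr q) \<le> 1" .
  have "(\<Sum>i<M. \<bar>z i\<bar> powr p) \<le> (\<Sum>i<M. \<bar>z i\<bar> powr q)"
  proof (rule sum_mono)
    fix i assume i: "i \<in> {..<M}"
    have "\<bar>z i\<bar> powr q \<le> (\<Sum>i<M. \<bar>z i\<bar> powr q)" using i by (intro member_le_sum) auto
    then have "\<bar>z i\<bar> powr q \<le> 1 powr q" using q1 by simp
    then have "\<bar>z i\<bar> \<le> 1" using powr_less_mono2[OF pq(1), of 1 "\<bar>z i\<bar>"] by (meson not_le zero_le_one)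
    then show "\<bar>z i\<bar> powr p \<le> \<bar>z i\<bar> powr q" using pq by (intro powr_mono') auto
  qed
  then have "z \<in> Bp M p" using q1 v(1) by (auto simp: Bp_def RM_def z_def)
  moreover have "v = (\<lambda>i. c * z i)" using c by (simp add: z_def)
  ultimately show ?thesis unfolding dilate_def by blast
qed

lemma bw_scale:
  assumes "finite S" "S \<noteq> {}" "0 \<le> c"
  shows "bw M ((\<lambda>t i. c * t i) ` S) = c * bw M S"
proof -
  have "Max (ip M \<epsilon> ` (\<lambda>t i. c * t i) ` S) = c * Max (ip M \<epsilon> ` S)" for \<epsilon>
  proof -
    have "ip M \<epsilon> (\<lambda>i. c * t i) = c * ip M \<epsilon> t" for t by (simp add: ip_def sum_distrib_left mult_ac)
    then have "ip M \<epsilon> ` (\<lambda>t i. c * t i) ` S = (\<lambda>x. c * x) ` (ip M \<epsilon> ` S)" by (auto simp: image_image)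
    moreover have "mono ((*) c)" using assms(3) by (auto intro!: monoI mult_left_mono)
    ultimately show ?thesis using mono_Max_commute[of "(*) c" "ip M \<epsilon> ` S"] assms by simp
  qed
  then show ?thesis by (simp add: bw_def avg_cmult)
qed

section \<open>The decomposition theorem\<close>

text \<open>
  The quotient of \<open>(e + 2)\<^sup>3\<close> and \<open>e\<^sup>3\<close> tends to one. The factor \<open>1 - q\<close> will be \<open>2 - p\<close>, the exponent that
  decides about the cost of truncation, so this is where \<open>p > 1\<close> is used.
\<close>

lemma cubes_grow_slowly:
  fixes q :: real
  assumes q: "0 < q" "q \<le> 1"
  shows "\<exists>e0\<ge>1. \<forall>e\<ge>e0. (1 - q) * (real e + 2) ^ 3 \<le> real e ^ 3 - real e"
proof -
  obtain n :: nat where n: "27 / q \<le> real n" using real_arch_simple by blast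
  show ?thesis
  proof (intro exI[of _ "max 1 n"] conjI allI impI)
    fix e assume e: "max 1 n \<le> e"
    then have e1: "1 \<le> real e" and "27 / q \<le> real e" using n by auto
    then have "27 \<le> q * real e" using q by (simp add: divide_le_eq mult.commute)
    then have 1: "27 * (real e)\<^sup>2 \<le> q * real e * (real e)\<^sup>2" by (intro mult_right_mono) auto
    have e2: "1 \<le> (real e)\<^sup>2" "real e \<le> (real e)\<^sup>2"
      using e1 by (auto intro: one_le_power self_le_power)
    have "(real e + 2) ^ 3 = real e ^ 3 + 6 * (real e)\<^sup>2 + 12 * real e + 8"
      by (simp add: power3_eq_cube power2_eq_square algebra_simps)
    also have "\<dots> \<le> real e ^ 3 + 26 * (real e)\<^sup>2" using e2 by linarith
    finally have "(1 - q) * (real e + 2) ^ 3 \<le> (1 - q) * (real e ^ 3 + 26 * (real e)\<^sup>2)"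
      using q by (intro mult_left_mono) auto
    also have "\<dots> = real e ^ 3 + 26 * (real e)\<^sup>2 - q * real e * (real e)\<^sup>2 - 26 * (q * (real e)\<^sup>2)"
      by (simp add: power3_eq_cube power2_eq_square algebra_simps)
    also have "\<dots> \<le> real e ^ 3 + 26 * (real e)\<^sup>2 - q * real e * (real e)\<^sup>2" using q by simp
    finally show "(1 - q) * (real e + 2) ^ 3 \<le> real e ^ 3 - real e" using 1 e2 by linarith
  qed simp
qed

text \<open>
  In powers of \<open>ratio\<close> the left-hand side has exponent \<open>2 ((2 - p) (e + 2)\<^sup>3 - e\<^sup>3) \<le> - 2 e\<close>, and \<open>ratio ^ e\<close>
  exceeds \<open>e (e + 1)\<close>. The right-hand side telescopes in \<open>decomposition_tree\<close>.
\<close>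

lemma truncation_costs_summable:
  assumes p: "1 < p" "p < 2" and Q: "0 < Q"
    and e0: "1 \<le> e0" "\<forall>e\<ge>e0. (2 - p) * (real e + 2) ^ 3 \<le> real e ^ 3 - real e"
  shows "\<exists>L>0. \<forall>e\<ge>e0.
    width Q (e + 1) powr (p - 2) * (rad Q (e ^ 3))\<^sup>2 \<le> (L / (real e * (real e + 1))) powr p"
proof -
  define D where "D = (gain / 2) powr (p - 2) * Q powr (2 * (p - 2)) * Q\<^sup>2"
  have D: "0 < D" using gain_pos Q by (simp add: D_def)
  have r: "1 < ratio" using ratio_ge by simp
  have rad: "rad Q j = Q * ratio powr (- real j)" for j
    using r by (simp add: rad_def powr_minus powr_realpow divide_inverse)
  show ?thesis
  proof (intro exI[of _ "max 1 D"] conjI allI impI)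
    fix e assume e: "e0 \<le> e"
    define k where "k = real e * (real e + 1)"
    have e1: "1 \<le> real e" using e e0(1) by simp
    have k: "1 \<le> k" unfolding k_def using e1 mult_mono[of 1 "real e" 1 "real e + 1"] by simp
    have n2: "real ((e + 1 + 1) ^ 3) = (real e + 2) ^ 3" by (simp add: add.commute)
    have "width Q (e + 1) = gain / 2 * (Q powr 2 * ratio powr (2 * (- ((real e + 2) ^ 3))))"
    proof -
      have "(rad Q ((e + 1 + 1) ^ 3))\<^sup>2 = Q\<^sup>2 * (ratio powr (- ((real e + 2) ^ 3)) * ratio powr (- ((real e + 2) ^ 3)))"
        unfolding rad n2 by (simp only: power2_eq_square mult_ac)
      also have "\<dots> = Q powr 2 * ratio powr (2 * (- ((real e + 2) ^ 3)))"
        using Q by (simp flip: powr_add)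
      finally show ?thesis unfolding width_def by (simp only:)
    qed
    then have "width Q (e + 1) powr (p - 2)
        = (gain / 2) powr (p - 2) * (Q powr (2 * (p - 2)) * ratio powr (2 * (- ((real e + 2) ^ 3)) * (p - 2)))"
      by (simp only: powr_mult powr_powr)
    moreover have "(rad Q (e ^ 3))\<^sup>2 = Q\<^sup>2 * ratio powr (- 2 * real e ^ 3)"
    proof -
      have "(ratio powr (- real (e ^ 3)))\<^sup>2 = ratio powr (- real (e ^ 3) + - real (e ^ 3))"
        by (simp only: power2_eq_square powr_add)
      then show ?thesis unfolding rad by (simp add: power_mult_distrib)
    qed
    ultimately have "width Q (e + 1) powr (p - 2) * (rad Q (e ^ 3))\<^sup>2
        = D * (ratio powr (2 * (- ((real e + 2) ^ 3)) * (p - 2)) * ratio powr (- 2 * real e ^ 3))"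
      by (simp add: D_def mult_ac)
    also have "\<dots> = D * ratio powr (2 * ((2 - p) * (real e + 2) ^ 3 - real e ^ 3))"
      by (simp add: algebra_simps flip: powr_add)
    also have "\<dots> \<le> D * ratio powr (2 * (- real e))"
      using e0(2)[rule_format, OF e] r D by (intro mult_left_mono powr_mono) auto
    also have "ratio powr (2 * (- real e)) \<le> (1 / k) powr p"
    proof -
      have "k \<le> 4 ^ e"
      proof -
        have "e + 1 \<le> 2 ^ e" using less_exp[of e] by (simp add: Suc_le_eq)
        then have "e * (e + 1) \<le> 2 ^ e * 2 ^ e" by (intro mult_mono) auto
        also have "\<dots> = (4::nat) ^ e" by (simp flip: power_mult_distrib)
        finally have "real (e * (e + 1)) \<le> real (4 ^ e)" by (simp only: of_nat_le_iff)
        then show ?thesis by (simp add: k_def algebra_simps)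
      qed
      also have "(4::real) ^ e \<le> ratio ^ e" using ratio_ge by (intro power_mono) auto
      finally have "1 / ratio ^ e \<le> 1 / k" using k by (intro divide_left_mono) auto
      then have "(1 / ratio ^ e) powr 2 \<le> (1 / k) powr 2" using r by (intro powr_mono2) auto
      also have "\<dots> \<le> (1 / k) powr p" using k p by (intro powr_mono') auto
      also have "(1 / ratio ^ e) powr 2 = ratio powr (2 * (- real e))"
      proof -
        have "1 / ratio ^ e = ratio powr (- real e)" using r by (simp add: powr_minus powr_realpow divide_inverse)
        then show ?thesis by (simp add: powr_powr mult.commute)
      qed
      finally show ?thesis .
    qed
    also have "D \<le> max 1 D powr p"
    proof -
      have "max 1 D powr 1 \<le> max 1 D powr p" using p by (intro powr_mono) auto
      then show ?thesis by simp
    qed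
    finally have "width Q (e + 1) powr (p - 2) * (rad Q (e ^ 3))\<^sup>2 \<le> max 1 D powr p * (1 / k) powr p"
      using D by (simp add: mult_left_mono mult_right_mono)
    also have "\<dots> = (max 1 D / k) powr p" by (simp flip: powr_mult)
    finally show "width Q (e + 1) powr (p - 2) * (rad Q (e ^ 3))\<^sup>2 \<le> (max 1 D / (real e * (real e + 1))) powr p"
      by (simp add: k_def)
  qed simp
qed

text \<open>
  The tree is started at level \<open>e0\<^sup>3\<close>, where \<open>Q\<close> is scaled so that the radius is \<open>4\<close>, a bound for the radius
  of \<open>T\<close>. Before that, \<open>T\<close> itself is truncated once, at a cost that depends on \<open>p\<close> only.
\<close>

lemma finite_decomposition:
  fixes p :: real
  assumes p: "1 < p" "p < 2"
  shows "\<exists>K>0. \<forall>M T. finite T \<longrightarrow> T \<noteq> {} \<longrightarrow> T \<subseteq> RM M \<longrightarrow> bw M T \<le> 1 \<longrightarrow>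
    (\<exists>\<mu> u x R. decomposes M p x R K K T \<mu> u)"
proof -
  obtain e0 :: nat where e0: "1 \<le> e0"
    "\<forall>e\<ge>e0. (2 - p) * (real e + 2) ^ 3 \<le> real e ^ 3 - real e"
    using cubes_grow_slowly[of "p - 1"] p by auto
  define Q where "Q = 4 * ratio ^ (e0 ^ 3)"
  have Q: "0 < Q" using ratio_ge by (simp add: Q_def)
  have rad0: "rad Q (e0 ^ 3) = 4" using ratio_ge by (simp add: rad_def Q_def)
  obtain L where L: "0 < L" "\<forall>e\<ge>e0.
    width Q (e + 1) powr (p - 2) * (rad Q (e ^ 3))\<^sup>2 \<le> (L / (real e * (real e + 1))) powr p"
    using truncation_costs_summable[OF p Q e0] by blast
  define w where "w = width Q e0"
  have w: "0 < w" unfolding w_def by (rule width_pos[OF Q])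
  define L' where "L' = max 1 (w powr (p - 2) * 4\<^sup>2)"
  have L': "1 \<le> L'" "w powr (p - 2) * 4\<^sup>2 \<le> L'" by (auto simp: L'_def)
  have L'p: "w powr (p - 2) * 4\<^sup>2 \<le> L' powr p"
  proof -
    have "L' powr 1 \<le> L' powr p" using L'(1) p by (intro powr_mono) auto
    then show ?thesis using L' by simp
  qed
  define C where "C = 8 * ratio / gain * (1 + 1) + 48 * rad Q (e0 ^ 3) + 16 * ratio / gain / e0"
  define K where "K = max C (L' + (L / e0 + 1))"
  have K: "0 < K" "C \<le> K" "L' + (L / e0 + 1) \<le> K"
    using L' L by (auto simp: K_def less_max_iff_disj intro!: disjI2 add_pos_nonneg)
  show ?thesis
  proof (intro exI[of _ K] conjI K(1) allI impI)
    fix M T assume T: "finite T" "T \<noteq> {}" "T \<subseteq> RM M" "bw M T \<le> 1"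
    obtain t0 where t0: "t0 \<in> T" using T by auto
    have t0RM: "t0 \<in> RM M" using t0 T by auto
    have near: "ed M t t0 \<le> 4" if "t \<in> T" for t using ed_le_bw[OF T(1) that t0, of M] T(4) by linarith
    obtain n where n: "Q * (real M + 1) < ratio ^ n" using real_arch_pow[of ratio] ratio_ge by auto
    define J where "J = e0 ^ 3 + n"
    have radJ: "rad Q J \<le> 1 / (real M + 1)"
    proof -
      have "rad Q J \<le> rad Q n" by (rule rad_antimono[OF Q]) (simp add: J_def)
      also have "\<dots> \<le> 1 / (real M + 1)"
        using n ratio_ge by (simp add: rad_def field_simps)
      finally show ?thesis .
    qed
    let ?A = "trunc t0 w ` T"
    have bwA: "bw M ?A \<le> 1"
      using bw_contraction[OF T(1,2), of M "trunc t0 w"] trunc_lipschitz T(4) by fastforce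
    have "\<exists>\<mu> u. decomposes M p t0 (2 * rad Q (e0 ^ 3)) (L / e0 + 1) C ?A \<mu> u"
      unfolding C_def
    proof (rule decomposition_tree[OF p Q L(1) _ e0(1) L(2)[rule_format], where J = J and n = n and y = t0])
      show "lp_le M p 1 v" if "\<And>i. i < M \<Longrightarrow> \<bar>v i\<bar> \<le> rad Q J" for v
      proof (rule lp_le_of_sup_bound)
        fix i assume i: "i < M"
        have "1 / (real M + 1) \<le> 1 / real M" using i by (intro divide_left_mono) auto
        then show "\<bar>v i\<bar> \<le> 1 / real M" using that[OF i] radJ by linarith
      qed (use p in auto)
      show "?A \<subseteq> RM M" using trunc_RM[OF less_imp_le[OF w] t0RM] T by auto
      show "ed M t t0 \<le> rad Q (e0 ^ 3)" if tA: "t \<in> ?A" for t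
      proof -
        obtain s where s: "s \<in> T" "t = trunc t0 w s" using tA by auto
        have "ed M t t0 \<le> ed M s t0" using ed_trunc[of M t0 w s t0] s(2) trunc_center[of w t0] w by simp
        then show ?thesis using near[OF s(1)] rad0 by linarith
      qed
      show "\<bar>t i - t0 i\<bar> \<le> width Q e0" if "t \<in> ?A" "i < M" for t i
        using that trunc_bounded[of w t0] w unfolding w_def[symmetric] by auto
      show "bw M ?A \<le> 1" by (rule bwA)
      show "bw M {z \<in> ?A. ed M z s \<le> rad Q (Suc (e0 ^ 3))} \<le> 1" if "s \<in> ?A" for s
        using bw_near(1)[of ?A s "rad Q (Suc (e0 ^ 3))" M] that T(1) rad_pos[OF Q, of "Suc (e0 ^ 3)"] bwA
        by fastforce
    qed (use T t0RM in \<open>auto simp: J_def\<close>)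
    then obtain \<mu> u where "decomposes M p t0 (2 * rad Q (e0 ^ 3)) (L / e0 + 1) C ?A \<mu> u" by blast
    then have d: "decomposes M p t0 (2 * rad Q (e0 ^ 3)) (L' + (L / e0 + 1)) C T \<mu> (\<lambda>t. u (trunc t0 w t))"
    proof (rule decomposes_trunc)
      show "lp_le M p L' (\<lambda>i. t i - trunc t0 w t i)" if "t \<in> T" for t
        using p near[OF that] L'p by (intro trunc_error[OF w]) auto
    qed (use p L L' e0 in \<open>auto intro!: add_nonneg_pos\<close>)
    have "decomposes M p t0 (2 * rad Q (e0 ^ 3)) K K T \<mu> (\<lambda>t. u (trunc t0 w t))"
      unfolding decomposes_def
    proof (intro conjI ballI)
      fix t assume t: "t \<in> T"
      note d' = d[unfolded decomposes_def, THEN conjunct2, rule_format, OF t]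
      show "lp_le M p K (\<lambda>i. t i - u (trunc t0 w t) i)"
        using d' K p L' L by (elim conjE lp_le_mono[rotated 3]) (auto intro!: add_nonneg_nonneg)
      show "entropy_integral_le M \<mu> (u (trunc t0 w t)) K"
        using d' K by (elim conjE entropy_integral_le_mono)
    qed (use d in \<open>auto simp: decomposes_def\<close>)
    then show "\<exists>\<mu> u x R. decomposes M p x R K K T \<mu> u" by blast
  qed
qed

theorem theorem1p4:
  fixes p :: real
  assumes "p > 1"
  shows "\<exists>K::real. K > 0 \<and>
    (\<forall>M\<ge>1. \<forall>T. T \<subseteq> RM M \<longrightarrow> T \<noteq> {} \<longrightarrow> bernoulli_b M T < \<infinity> \<longrightarrow>
      (\<exists>U\<subseteq>RM M.
         T \<subseteq> U + dilate (K * real_of_ereal (bernoulli_b M T)) (Bp M p) \<and>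
         gamma_half M U \<le> ennreal (K * real_of_ereal (bernoulli_b M T))))"
proof -
  \<comment> \<open>The construction needs an exponent below \<open>2\<close>, and the balls \<open>B\<^sub>q\<close> increase with \<open>q\<close>.\<close>
  define q where "q = min p (3/2)"
  have q: "1 < q" "q < 2" "q \<le> p" using assms by (auto simp: q_def)
  obtain K where K: "0 < K" "\<And>M T. finite T \<Longrightarrow> T \<noteq> {} \<Longrightarrow> T \<subseteq> RM M \<Longrightarrow> bw M T \<le> 1 \<Longrightarrow>
    \<exists>\<mu> u x R. decomposes M q x R K K T \<mu> u"
    using finite_decomposition[OF q(1,2)] by blast
  have main: "\<exists>U\<subseteq>RM M. T \<subseteq> U + dilate ((K + 1) * S) (Bp M p) \<and> gamma_half M U \<le> ennreal ((K + 1) * S)"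
    if M: "1 \<le> M" and T: "T \<subseteq> RM M" "T \<noteq> {}" and fin: "bernoulli_b M T < \<infinity>"
      and S: "S = real_of_ereal (bernoulli_b M T)" for M T S
  proof -
    have bwS: "bw M F \<le> S" if F: "finite F" "F \<noteq> {}" "F \<subseteq> T" for F
    proof -
      have "ereal (bw M F) \<le> bernoulli_b M T" by (rule bw_le_bernoulli_b[OF F])
      then show ?thesis unfolding S using fin by (cases "bernoulli_b M T") auto
    qed
    have edS: "ed M s t \<le> 4 * S" if "s \<in> T" "t \<in> T" for s t
      using ed_le_bw[of "{s, t}" s t M] bwS[of "{s, t}"] that by simp
    obtain t0 where t0: "t0 \<in> T" using T by auto
    have S0: "0 \<le> S" using bw_nonneg[of "{t0}" M] bwS[of "{t0}"] t0 by simp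
    show ?thesis
    proof (cases "S = 0")
      case True
      have "t = t0" if t: "t \<in> T" for t
      proof
        fix i
        show "t i = t0 i"
        proof (cases "i < M")
          case True
          then show ?thesis using ed_coord[OF True, of t t0] edS[OF t t0] \<open>S = 0\<close> by simp
        next
          case False
          have "t \<in> RM M" "t0 \<in> RM M" using t t0 T(1) by auto
          then show ?thesis using False by (simp add: RM_def)
        qed
      qed
      then have "T = {t0}" using t0 by blast
      have "(\<lambda>_. 0) \<in> Bp M p" by (simp add: Bp_def RM_def)
      then have "(\<lambda>_. 0) \<in> dilate ((K + 1) * S) (Bp M p)" unfolding dilate_def
        by (intro image_eqI[of _ _ "\<lambda>_. 0"]) simp_all
      then have "t0 + (\<lambda>_. 0) \<in> {t0} + dilate ((K + 1) * S) (Bp M p)" by (intro set_plus_intro) auto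
      moreover have "t0 + (\<lambda>_. 0) = t0" by (simp add: fun_eq_iff)
      moreover have "gamma_half M {t0} \<le> ennreal ((K + 1) * S)"
        by (rule gamma_half_le[where \<mu> = "return_pmf t0"]) (auto simp: True intro: entropy_integral_le_return)
      ultimately show ?thesis using \<open>T = {t0}\<close> T by (intro exI[of _ "{t0}"]) auto
    next
      case False
      then have Sp: "0 < S" using S0 by simp
      \<comment> \<open>Points of \<open>T\<close> differ from a finite net by elements of \<open>S B\<^sub>q\<close>; the net is rescaled to \<open>b \<le> 1\<close>.\<close>
      obtain F where F: "finite F" "F \<noteq> {}" "F \<subseteq> T"
        and net: "\<And>t. t \<in> T \<Longrightarrow> \<exists>s\<in>F. \<forall>i<M. \<bar>t i - s i\<bar> \<le> S / M"
      proof (rule finite_net)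
        show "0 < S / M" using Sp M by simp
        show "\<bar>t i - t0 i\<bar> \<le> 4 * S" if "t \<in> T" "i < M" for t i
          using ed_coord[OF that(2), of t t0] edS[OF that(1) t0] by linarith
      qed (use T in auto)
      define F' where "F' = (\<lambda>t i. (1 / S) * t i) ` F"
      have "bw M F' \<le> 1"
        unfolding F'_def using bw_scale[OF F(1,2), of "1 / S" M] bwS[OF F] Sp by (simp add: divide_le_eq)
      moreover have "F' \<subseteq> RM M" unfolding F'_def using F T by (auto simp: RM_def)
      ultimately obtain \<mu> u x R where d: "decomposes M q x R K K F' \<mu> u"
        using K(2)[of F' M] F unfolding F'_def by auto
      define u' where "u' t = (\<lambda>i. S * u (\<lambda>i. (1 / S) * t i) i)" for t
      define U where "U = u' ` F"
      have dF: "u (\<lambda>i. (1 / S) * s i) \<in> RM M \<and> lp_le M q K (\<lambda>i. (1 / S) * s i - u (\<lambda>i. (1 / S) * s i) i)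
          \<and> entropy_integral_le M \<mu> (u (\<lambda>i. (1 / S) * s i)) K" if "s \<in> F" for s
        using d that unfolding decomposes_def F'_def by auto
      have URM: "U \<subseteq> RM M" unfolding U_def u'_def using dF by (auto simp: RM_def)
      have "gamma_half M U \<le> ennreal (S * K)"
      proof (rule gamma_half_le[where \<mu> = "map_pmf (\<lambda>x i. S * x i) \<mu>"])
        show "set_pmf (map_pmf (\<lambda>x i. S * x i) \<mu>) \<subseteq> U"
          using d unfolding decomposes_def F'_def U_def u'_def by auto
        show "entropy_integral_le M (map_pmf (\<lambda>x i. S * x i) \<mu>) y (S * K)" if "y \<in> U" for y
          using that dF K(1) unfolding U_def u'_def by (auto intro!: entropy_integral_le_scale[OF Sp])
      qed (use F in \<open>auto simp: U_def\<close>)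
      also have "ennreal (S * K) \<le> ennreal ((K + 1) * S)" using Sp by (intro ennreal_leI) (simp add: algebra_simps)
      finally have gamma: "gamma_half M U \<le> ennreal ((K + 1) * S)" .
      have "T \<subseteq> U + dilate ((K + 1) * S) (Bp M p)"
      proof
        fix t assume t: "t \<in> T"
        obtain s where s: "s \<in> F" "\<And>i. i < M \<Longrightarrow> \<bar>t i - s i\<bar> \<le> S / M" using net[OF t] by auto
        have 1: "lp_le M q (S * K) (\<lambda>i. s i - u' s i)"
        proof -
          have "(\<Sum>i<M. \<bar>s i - u' s i\<bar> powr q)
              = (\<Sum>i<M. S powr q * \<bar>(1 / S) * s i - u (\<lambda>i. (1 / S) * s i) i\<bar> powr q)"
          proof (rule sum.cong[OF refl])
            fix i
            have "s i - u' s i = S * ((1 / S) * s i - u (\<lambda>i. (1 / S) * s i) i)"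
              unfolding u'_def using Sp by (simp add: right_diff_distrib)
            then show "\<bar>s i - u' s i\<bar> powr q = S powr q * \<bar>(1 / S) * s i - u (\<lambda>i. (1 / S) * s i) i\<bar> powr q"
              using Sp by (simp add: abs_mult powr_mult)
          qed
          also have "\<dots> \<le> S powr q * K powr q"
            unfolding sum_distrib_left[symmetric] using dF[OF s(1)]
            by (intro mult_left_mono) (auto simp: lp_le_def)
          finally show ?thesis using Sp K(1) by (simp add: lp_le_def powr_mult)
        qed
        have 2: "lp_le M q S (\<lambda>i. t i - s i)" using q s Sp by (intro lp_le_of_sup_bound) auto
        define v where "v = (\<lambda>i. (s i - u' s i) + (t i - s i))"
        have "lp_le M q (S * K + S) v"
          unfolding v_def using q Sp K(1) by (intro lp_le_add 1 2) auto
        then have "lp_le M q ((K + 1) * S) v" by (simp add: algebra_simps)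
        moreover have "v \<in> RM M"
        proof -
          have "t \<in> RM M" "u' s \<in> RM M" using URM s(1) t T(1) by (auto simp: U_def)
          then show ?thesis by (simp add: v_def RM_def)
        qed
        ultimately have "v \<in> dilate ((K + 1) * S) (Bp M p)"
          using q Sp K(1) by (intro lp_le_imp_dilate[of v M q]) auto
        then have "u' s + v \<in> U + dilate ((K + 1) * S) (Bp M p)"
          using s(1) by (intro set_plus_intro) (auto simp: U_def)
        moreover have "u' s + v = t" by (simp add: v_def fun_eq_iff)
        ultimately show "t \<in> U + dilate ((K + 1) * S) (Bp M p)" by simp
      qed
      then show ?thesis using URM gamma by blast
    qed
  qed
  show ?thesis
    by (rule exI[of _ "K + 1"]) (use K(1) main in auto)
qed

end
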